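(* Let $N\ge2$ be an integer, $\lambda>1$, and let $X=\{1,\dots,N\}^{\mathbb N}$ be equipped with the ultrametric $d(x,y)=\lambda^{-\inf\{k-1:\,x_k\ne y_k\}}$ and the Bernoulli measure $\mu$, so that $(X,d,\mu)$ is Ahlfors $\delta$-regular with $\delta=\log N/\log\lambda$. Let $\Delta$ be its logarithmic Dirichlet Laplacian. For $n\ge0$ let $P_n$ be the orthogonal projection of $L^2(X,\mu)$ onto the span of the characteristic functions of the cylinder sets $C_w$ with $|w|=n$, and let $Q_n=P_{n+1}-P_n$. Then the projections $Q_n$, $n\ge0$, yield a spectral decomposition of $\Delta$; that is, $L^2(X,\mu)$ is the orthogonal direct sum of $\operatorname{Im}P_0=\operatorname{Ker}\Delta$ (the constant functions) and the subspaces $\operatorname{Im}Q_n$, $n\ge0$, and $\Delta$ acts on each $\operatorname{Im}Q_n\subset\operatorname{Dom}\Delta$ as a scalar. Consequently, the Lipschitz functions on $(X,d)$ are a core for $\Delta$, and the compact operator $e^{-t\Delta}$, $t>0$, is trace class if and only if $$t>\frac{N\log N}{N-1}.$$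
   Context: For a finite word $w=w_1\cdots w_n$ with letters in $\{1,\dots,N\}$, $|w|=n$ is its length and $C_w=\{x\in X:x_k=w_k,\ 1\le k\le n\}$; for the empty word (length $0$) the cylinder set is $X$. The Bernoulli measure is determined by $\mu(C_w)=N^{-|w|}$. (By convention $d(x,x)=0$.) $L^2(X,\mu)$ is the real Hilbert space. Let $$\operatorname{Dom}\mathcal E=\Big\{f\in L^2(X,\mu):\int_X\int_X\frac{|f(x)-f(y)|^2}{d(x,y)^\delta}\,d\mu(y)\,d\mu(x)<\infty\Big\},$$ $$\mathcal E(f,g)=\frac12\int_X\int_X\frac{(f(x)-f(y))(g(x)-g(y))}{d(x,y)^\delta}\,d\mu(y)\,d\mu(x),$$ the integrals being over the complement of the diagonal; this is a densely defined closed form. The logarithmic Dirichlet Laplacian $\Delta$ is the associated positive self-adjoint operator: if $R:L^2(X,\mu)\to\operatorname{Dom}\mathcal E$ is determined by $\langle Rf,g\rangle_{L^2}+\mathcal E(Rf,g)=\langle f,g\rangle_{L^2}$ for all $g\in\operatorname{Dom}\mathcal E$, then $\operatorname{Dom}\Delta=\operatorname{Im}R$ and $\Delta Rf=f-Rf$; thus $R=(1+\Delta)^{-1}$, $\operatorname{Dom}\mathcal E=\operatorname{Dom}\Delta^{1/2}$ and $\mathcal E(f,g)=\langle\Delta^{1/2}f,\Delta^{1/2}g\rangle_{L^2}$. Lipschitz functions lie in $\operatorname{Dom}\Delta$; they form a core if the restriction of $\Delta$ to them is essentially self-adjoint with closure $\Delta$. *)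

theory Defs
  imports "HOL-Probability.Probability"
begin

section \<open>The ultrametric measure space\<close>

text \<open>
  The alphabet with \<open>N\<close> letters is a finite type \<open>'a\<close> with \<open>CARD('a) = N\<close>, and a point of
  \<open>X\<close> is a sequence \<open>x :: nat \<Rightarrow> 'a\<close>.  Indices start at \<open>0\<close>, so that the letter written \<open>x\<^sub>k\<close>
  (\<open>k \<ge> 1\<close>) is \<open>x (k - 1)\<close>; this absorbs the \<open>k - 1\<close> in the exponent of the ultrametric.
\<close>

definition bernoulli :: "(nat \<Rightarrow> 'a::finite) measure" where
  "bernoulli = PiM UNIV (\<lambda>_. uniform_count_measure UNIV)"

definition cylinder :: "'a list \<Rightarrow> (nat \<Rightarrow> 'a) set" where
  "cylinder w = {x. \<forall>k<length w. x k = w ! k}"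

definition ultra_dist :: "real \<Rightarrow> (nat \<Rightarrow> 'a) \<Rightarrow> (nat \<Rightarrow> 'a) \<Rightarrow> real" where
  "ultra_dist lam x y = (if x = y then 0 else lam powr - real (LEAST k. x k \<noteq> y k))"

lemma space_bernoulli [simp]: "space bernoulli = (UNIV :: (nat \<Rightarrow> 'a::finite) set)"
  by (auto simp: bernoulli_def space_PiM space_uniform_count_measure)

lemma prob_space_bernoulli: "prob_space (bernoulli :: (nat \<Rightarrow> 'a::finite) measure)"
  unfolding bernoulli_def by (intro prob_space_PiM prob_space_uniform_count_measure) auto

interpretation bernoulli: prob_space "bernoulli :: (nat \<Rightarrow> 'a::finite) measure"
  by (rule prob_space_bernoulli)

lemma sets_cylinder [measurable, simp]:
  "cylinder w \<in> sets (bernoulli :: (nat \<Rightarrow> 'a::finite) measure)"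
proof -
  have "{x \<in> space bernoulli. \<forall>k<length w. x k = w ! k} \<in> sets (bernoulli :: (nat \<Rightarrow> 'a) measure)"
    unfolding bernoulli_def by measurable (auto simp: sets_uniform_count_measure)
  then show ?thesis by (simp add: cylinder_def)
qed

lemma measure_cylinder:
  fixes w :: "'a::finite list"
  shows "measure bernoulli (cylinder w) = 1 / real CARD('a) ^ length w"
proof -
  let ?U = "uniform_count_measure (UNIV :: 'a set)"
  have ps: "prob_space ?U"
    by (intro prob_space_uniform_count_measure) auto
  interpret product_prob_space "\<lambda>_::nat. ?U" UNIV
    by (rule product_prob_spaceI) (rule ps)
  have c: "cylinder w = prod_emb UNIV (\<lambda>_::nat. ?U) {..<length w} (PiE {..<length w} (\<lambda>k. {w ! k}))"
    by (auto simp: cylinder_def prod_emb_def space_PiM space_uniform_count_measure PiE_def Pi_def extensional_def)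
  have "measure bernoulli (cylinder w) = (\<Prod>k<length w. measure ?U {w ! k})"
    unfolding bernoulli_def c by (intro measure_PiM_emb) (auto simp: sets_uniform_count_measure)
  also have "\<dots> = 1 / real CARD('a) ^ length w"
    by (simp add: measure_uniform_count_measure power_one_over)
  finally show ?thesis .
qed

lemma measurable_ultra_dist [measurable]:
  "(\<lambda>p. ultra_dist lam (fst p) (snd p))
     \<in> borel_measurable (bernoulli \<Otimes>\<^sub>M (bernoulli :: (nat \<Rightarrow> 'a::finite) measure))"
proof -
  let ?B = "bernoulli :: (nat \<Rightarrow> 'a) measure"
  have c [measurable]: "(\<lambda>x. x k) \<in> ?B \<rightarrow>\<^sub>M count_space UNIV" for k
  proof -
    have "(\<lambda>x. x k) \<in> ?B \<rightarrow>\<^sub>M uniform_count_measure UNIV"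
      unfolding bernoulli_def by measurable
    then show ?thesis
      by (simp cong: measurable_cong_sets add: sets_uniform_count_measure measurable_def space_uniform_count_measure)
  qed
  have [measurable]: "Measurable.pred (?B \<Otimes>\<^sub>M ?B) (\<lambda>p. fst p k \<noteq> snd p k)" for k
  proof -
    have [measurable]: "(\<lambda>p. fst p k) \<in> ?B \<Otimes>\<^sub>M ?B \<rightarrow>\<^sub>M count_space UNIV"
      "(\<lambda>p. snd p k) \<in> ?B \<Otimes>\<^sub>M ?B \<rightarrow>\<^sub>M count_space UNIV"
      by measurable
    have "(\<lambda>p. fst p k \<noteq> snd p k) = (\<lambda>p. \<exists>a::'a. fst p k = a \<and> snd p k \<noteq> a)" by auto
    moreover have "Measurable.pred (?B \<Otimes>\<^sub>M ?B) (\<lambda>p. \<exists>a::'a. fst p k = a \<and> snd p k \<noteq> a)"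
      by measurable
    ultimately show ?thesis by simp
  qed
  have e: "(fst p = snd p) = (\<forall>k. \<not> fst p k \<noteq> snd p k)" for p :: "(nat \<Rightarrow> 'a) \<times> (nat \<Rightarrow> 'a)"
    by auto
  show ?thesis unfolding ultra_dist_def e by measurable
qed

lemma pred_diagonal [measurable]:
  "Measurable.pred (bernoulli \<Otimes>\<^sub>M (bernoulli :: (nat \<Rightarrow> 'a::finite) measure)) (\<lambda>p. fst p = snd p)"
proof -
  have "(fst p = snd p) = (ultra_dist 2 (fst p) (snd p) = 0)" for p :: "(nat \<Rightarrow> 'a) \<times> (nat \<Rightarrow> 'a)"
    by (auto simp: ultra_dist_def)
  moreover have "Measurable.pred (bernoulli \<Otimes>\<^sub>M (bernoulli :: (nat \<Rightarrow> 'a) measure))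
      (\<lambda>p. ultra_dist 2 (fst p) (snd p) = 0)"
    by measurable
  ultimately show ?thesis by simp
qed


section \<open>The real Hilbert space \<open>L\<^sup>2(X, \<mu>)\<close>\<close>

definition square_integrable :: "((nat \<Rightarrow> 'a::finite) \<Rightarrow> real) \<Rightarrow> bool" where
  "square_integrable f \<longleftrightarrow> f \<in> borel_measurable bernoulli \<and> integrable bernoulli (\<lambda>x. (f x)\<^sup>2)"

definition l2_rel :: "((nat \<Rightarrow> 'a::finite) \<Rightarrow> real) \<Rightarrow> ((nat \<Rightarrow> 'a) \<Rightarrow> real) \<Rightarrow> bool" where
  "l2_rel f g \<longleftrightarrow> square_integrable f \<and> square_integrable g \<and> (AE x in bernoulli. f x = g x)"

lemma square_integrable_measurable [measurable_dest]:
  "square_integrable f \<Longrightarrow> f \<in> borel_measurable bernoulli"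
  by (simp add: square_integrable_def)

lemma square_integrable_mult:
  assumes "square_integrable f" "square_integrable g"
  shows "integrable bernoulli (\<lambda>x. f x * g x)"
proof (rule Bochner_Integration.integrable_bound)
  show "integrable bernoulli (\<lambda>x. (f x)\<^sup>2 + (g x)\<^sup>2)"
    using assms by (simp add: square_integrable_def)
  show "(\<lambda>x. f x * g x) \<in> borel_measurable bernoulli"
    using assms by measurable
  have "norm (a * b) \<le> norm (a\<^sup>2 + b\<^sup>2)" for a b :: real
  proof -
    have "2 * (\<bar>a\<bar> * \<bar>b\<bar>) \<le> a\<^sup>2 + b\<^sup>2"
      using sum_squares_bound[of "\<bar>a\<bar>" "\<bar>b\<bar>"] by simp
    moreover have "0 \<le> \<bar>a\<bar> * \<bar>b\<bar>" by simp
    ultimately have "\<bar>a\<bar> * \<bar>b\<bar> \<le> a\<^sup>2 + b\<^sup>2" by linarith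
    then show ?thesis by (simp add: abs_mult)
  qed
  then show "AE x in bernoulli. norm (f x * g x) \<le> norm ((f x)\<^sup>2 + (g x)\<^sup>2)" by simp
qed

lemma square_integrable_add [intro]:
  assumes "square_integrable f" "square_integrable g"
  shows "square_integrable (\<lambda>x. f x + g x)"
  using assms square_integrable_mult[OF assms]
  by (auto simp: square_integrable_def power2_sum mult.assoc)

lemma square_integrable_scale [intro]:
  "square_integrable f \<Longrightarrow> square_integrable (\<lambda>x. c * f x)"
  by (auto simp: square_integrable_def power_mult_distrib)

lemma square_integrable_uminus [intro]:
  "square_integrable f \<Longrightarrow> square_integrable (\<lambda>x. - f x)"
  by (auto simp: square_integrable_def)

lemma square_integrable_diff [intro]:
  "square_integrable f \<Longrightarrow> square_integrable g \<Longrightarrow> square_integrable (\<lambda>x. f x - g x)"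
  using square_integrable_add[of f "\<lambda>x. - g x"] by auto

lemma square_integrable_const [simp, intro]: "square_integrable (\<lambda>_. c)"
  by (simp add: square_integrable_def)

lemma square_integrable_indicator [simp, intro]:
  "A \<in> sets bernoulli \<Longrightarrow> square_integrable (indicator A)"
  by (auto simp: square_integrable_def power2_eq_square indicator_inter_arith[symmetric]
      intro!: integrable_real_indicator bernoulli.emeasure_finite[THEN top.not_eq_extremum[THEN iffD1]])

quotient_type 'a l2 = "(nat \<Rightarrow> 'a::finite) \<Rightarrow> real" / partial: l2_rel
  morphisms rep_l2 abs_l2
proof (rule part_equivpI)
  show "\<exists>f. l2_rel f f"
    by (intro exI[of _ "\<lambda>_. 0"]) (simp add: l2_rel_def)
  show "symp l2_rel"
    by (auto simp: symp_def l2_rel_def)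
  show "transp l2_rel"
    by (auto simp: transp_def l2_rel_def)
qed

instantiation l2 :: (finite) real_inner
begin

lift_definition zero_l2 :: "'a l2" is "\<lambda>_. 0"
  by (simp add: l2_rel_def)

lift_definition plus_l2 :: "'a l2 \<Rightarrow> 'a l2 \<Rightarrow> 'a l2" is "\<lambda>f g x. f x + g x"
  by (auto simp: l2_rel_def)

lift_definition uminus_l2 :: "'a l2 \<Rightarrow> 'a l2" is "\<lambda>f x. - f x"
  by (auto simp: l2_rel_def)

lift_definition minus_l2 :: "'a l2 \<Rightarrow> 'a l2 \<Rightarrow> 'a l2" is "\<lambda>f g x. f x - g x"
  by (auto simp: l2_rel_def)

lift_definition scaleR_l2 :: "real \<Rightarrow> 'a l2 \<Rightarrow> 'a l2" is "\<lambda>c f x. c * f x"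
  by (auto simp: l2_rel_def)

lift_definition inner_l2 :: "'a l2 \<Rightarrow> 'a l2 \<Rightarrow> real" is "\<lambda>f g. \<integral>x. f x * g x \<partial>bernoulli"
proof -
  fix f f' g g' :: "(nat \<Rightarrow> 'a) \<Rightarrow> real"
  assume fg: "l2_rel f f'" "l2_rel g g'"
  then have [measurable]: "f \<in> borel_measurable bernoulli" "f' \<in> borel_measurable bernoulli"
    "g \<in> borel_measurable bernoulli" "g' \<in> borel_measurable bernoulli"
    by (auto simp: l2_rel_def square_integrable_def)
  show "(\<integral>x. f x * g x \<partial>bernoulli) = (\<integral>x. f' x * g' x \<partial>bernoulli)"
    using fg by (intro integral_cong_AE) (auto simp: l2_rel_def)
qed

definition norm_l2 :: "'a l2 \<Rightarrow> real" where "norm_l2 u = sqrt (inner u u)"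
definition dist_l2 :: "'a l2 \<Rightarrow> 'a l2 \<Rightarrow> real" where "dist_l2 u v = norm (u - v)"
definition sgn_l2 :: "'a l2 \<Rightarrow> 'a l2" where "sgn_l2 u = inverse (norm u) *\<^sub>R u"
definition uniformity_l2 :: "('a l2 \<times> 'a l2) filter" where
  "uniformity_l2 = (INF e\<in>{0<..}. principal {(u, v). dist u v < e})"
definition open_l2 :: "'a l2 set \<Rightarrow> bool" where
  "open_l2 U \<longleftrightarrow> (\<forall>u\<in>U. \<forall>\<^sub>F (u', v) in uniformity. u' = u \<longrightarrow> v \<in> U)"

instance
proof
  fix u v w :: "'a l2" and a b :: real and U :: "'a l2 set"
  show "u + v + w = u + (v + w)" by transfer (auto simp: l2_rel_def add.assoc)
  show "u + v = v + u" by transfer (auto simp: l2_rel_def add.commute)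
  show "0 + u = u" by transfer (auto simp: l2_rel_def)
  show "- u + u = 0" by transfer (auto simp: l2_rel_def)
  show "u - v = u + - v" by transfer (auto simp: l2_rel_def)
  show "a *\<^sub>R (u + v) = a *\<^sub>R u + a *\<^sub>R v" by transfer (auto simp: l2_rel_def distrib_left)
  show "(a + b) *\<^sub>R u = a *\<^sub>R u + b *\<^sub>R u" by transfer (auto simp: l2_rel_def distrib_right)
  show "a *\<^sub>R b *\<^sub>R u = (a * b) *\<^sub>R u"
    by transfer (auto simp: l2_rel_def mult.assoc intro!: square_integrable_scale)
  show "1 *\<^sub>R u = u" by transfer (auto simp: l2_rel_def)
  show "sgn u = inverse (norm u) *\<^sub>R u" by (rule sgn_l2_def)
  show "dist u v = norm (u - v)" by (rule dist_l2_def)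
  show "uniformity = (INF e\<in>{0<..}. principal {(u :: 'a l2, v). dist u v < e})"
    by (rule uniformity_l2_def)
  show "open U = (\<forall>u\<in>U. \<forall>\<^sub>F (u', v) in uniformity. u' = u \<longrightarrow> v \<in> U)" by (rule open_l2_def)
  show "norm u = sqrt (inner u u)" by (rule norm_l2_def)
  show "inner u v = inner v u" by transfer (simp add: mult.commute)
  show "inner (u + v) w = inner u w + inner v w"
    by transfer (auto simp: l2_rel_def distrib_right square_integrable_mult)
  show "inner (a *\<^sub>R u) v = a * inner u v"
    by transfer (auto simp: l2_rel_def mult.assoc)
  show "0 \<le> inner u u"
    by transfer simp
  show "inner u u = 0 \<longleftrightarrow> u = 0"
    by transfer (auto simp: l2_rel_def square_integrable_def power2_eq_square[symmetric] integral_nonneg_eq_0_iff_AE)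
qed

end

lemma AE_convergent_of_summable_L1:
  fixes f :: "nat \<Rightarrow> 'x \<Rightarrow> real"
  assumes [measurable]: "\<And>n. f n \<in> borel_measurable M"
    and b: "\<And>n. (\<integral>\<^sup>+x. ennreal \<bar>f (Suc n) x - f n x\<bar> \<partial>M) \<le> ennreal ((1 / 2) ^ n)"
  shows "AE x in M. convergent (\<lambda>n. f n x)"
proof -
  have "(\<integral>\<^sup>+x. (\<Sum>n. ennreal \<bar>f (Suc n) x - f n x\<bar>) \<partial>M) = (\<Sum>n. \<integral>\<^sup>+x. ennreal \<bar>f (Suc n) x - f n x\<bar> \<partial>M)"
    by (rule nn_integral_suminf) measurable
  also have "\<dots> \<le> (\<Sum>n. ennreal ((1 / 2) ^ n))"
    by (intro suminf_le b summableI)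
  also have "\<dots> < \<infinity>"
    by (subst suminf_ennreal2) (auto simp: summable_geometric)
  finally have "AE x in M. (\<Sum>n. ennreal \<bar>f (Suc n) x - f n x\<bar>) \<noteq> \<infinity>"
    by (intro nn_integral_PInf_AE) auto
  then show ?thesis
  proof (rule AE_mp, intro AE_I2 impI)
    fix x assume "(\<Sum>n. ennreal \<bar>f (Suc n) x - f n x\<bar>) \<noteq> \<infinity>"
    then have "summable (\<lambda>n. \<bar>f (Suc n) x - f n x\<bar>)"
      by (intro summable_suminf_not_top) (auto simp: top_ennreal_def[symmetric])
    then have "summable (\<lambda>n. f (Suc n) x - f n x)"
      by (rule summable_rabs_cancel)
    then have "convergent (\<lambda>n. \<Sum>k<n. f (Suc k) x - f k x)"
      by (simp add: summable_iff_convergent)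
    then have "convergent (\<lambda>n. f n x - f 0 x)"
      unfolding sum_lessThan_telescope[of "\<lambda>n. f n x"] .
    from convergent_add[OF this convergent_const[of "f 0 x"]]
    show "convergent (\<lambda>n. f n x)" by simp
  qed
qed

lemma norm_l2_abs:
  assumes "square_integrable f"
  shows "(norm (abs_l2 f))\<^sup>2 = (\<integral>x. (f x)\<^sup>2 \<partial>bernoulli)"
proof -
  have "l2_rel f f" using assms by (simp add: l2_rel_def)
  then show ?thesis
    unfolding power2_norm_eq_inner by (simp add: inner_l2.abs_eq power2_eq_square)
qed

lemma abs_l2_surj: "\<exists>f. square_integrable f \<and> abs_l2 f = u"
  by (metis Quotient_l2 Quotient_abs_rep Quotient_rep_reflp l2_rel_def)

instance l2 :: (finite) complete_space
proof
  fix X :: "nat \<Rightarrow> 'a l2"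
  assume X: "Cauchy X"
  have "\<forall>n. \<exists>M. \<forall>m\<ge>M. \<forall>k\<ge>M. dist (X m) (X k) < (1 / 2) ^ n"
    using X unfolding Cauchy_def by simp
  then obtain M where M: "\<And>n m k. m \<ge> M n \<Longrightarrow> k \<ge> M n \<Longrightarrow> dist (X m) (X k) < (1 / 2) ^ n"
    by metis
  define r where "r n = (\<Sum>k\<le>n. M k) + n" for n
  have rM: "r n \<ge> M n" for n
    unfolding r_def using member_le_sum[of n "{..n}" M] by (simp add: trans_le_add1)
  have rn: "r n \<ge> n" for n by (simp add: r_def)
  have rmono: "r n \<le> r (Suc n)" for n by (simp add: r_def)
  obtain F where F: "\<And>n. square_integrable (F n)" "\<And>n. abs_l2 (F n) = X n"
    using choice[of "\<lambda>n f. square_integrable f \<and> abs_l2 f = X n"] abs_l2_surj by blast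
  note [measurable] = square_integrable_measurable[OF F(1)]
  have rel: "l2_rel (F n) (F n)" for n using F by (simp add: l2_rel_def)
  have dF: "(dist (X m) (X k))\<^sup>2 = (\<integral>x. (F m x - F k x)\<^sup>2 \<partial>bernoulli)" for m k
    using norm_l2_abs[OF square_integrable_diff[OF F(1) F(1), of m k]]
    unfolding dist_norm minus_l2.abs_eq[OF rel rel, symmetric] F(2) .
  have iF: "integrable bernoulli (\<lambda>x. (F m x - F k x)\<^sup>2)" for m k
    using square_integrable_diff[OF F(1) F(1), of m k] by (simp add: square_integrable_def)
  have nF: "(\<integral>\<^sup>+x. ennreal ((F m x - F k x)\<^sup>2) \<partial>bernoulli) = ennreal ((dist (X m) (X k))\<^sup>2)" for m k
    unfolding dF by (intro nn_integral_eq_integral iF) auto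
  have "AE x in bernoulli. convergent (\<lambda>n. F (r n) x)"
  proof (rule AE_convergent_of_summable_L1)
    fix n
    let ?g = "\<lambda>x. F (r (Suc n)) x - F (r n) x"
    have sg: "square_integrable ?g" using F by auto
    have ig: "integrable bernoulli (\<lambda>x. \<bar>?g x\<bar>)"
      using square_integrable_mult[OF sg square_integrable_const[of 1]] by auto
    have "(\<integral>x. \<bar>?g x\<bar> \<partial>bernoulli)\<^sup>2 \<le> (\<integral>x. \<bar>?g x\<bar>\<^sup>2 \<partial>bernoulli)"
    proof -
      have "0 \<le> (\<integral>x. (\<bar>?g x\<bar> - (\<integral>x. \<bar>?g x\<bar> \<partial>bernoulli))\<^sup>2 \<partial>bernoulli)" by simp
      also have "\<dots> = (\<integral>x. \<bar>?g x\<bar>\<^sup>2 \<partial>bernoulli) - (\<integral>x. \<bar>?g x\<bar> \<partial>bernoulli)\<^sup>2"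
        by (rule bernoulli.variance_eq[OF ig]) (simp add: iF)
      finally show ?thesis by simp
    qed
    also have "\<dots> = (dist (X (r (Suc n))) (X (r n)))\<^sup>2" by (simp add: dF)
    finally have "(\<integral>x. \<bar>?g x\<bar> \<partial>bernoulli) \<le> dist (X (r (Suc n))) (X (r n))"
      by (rule power2_le_imp_le) simp
    also have "\<dots> \<le> (1 / 2) ^ n"
      using M[of n "r (Suc n)" "r n"] rM[of n] rmono[of n] by simp
    finally show "(\<integral>\<^sup>+x. ennreal \<bar>?g x\<bar> \<partial>bernoulli) \<le> ennreal ((1 / 2) ^ n)"
      by (subst nn_integral_eq_integral[OF ig]) (auto intro: ennreal_leI)
  qed measurable
  then have conv: "AE x in bernoulli. (\<lambda>n. F (r n) x) \<longlonglongrightarrow> lim (\<lambda>n. F (r n) x)"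
    by (auto simp: convergent_LIMSEQ_iff)
  define f where "f x = lim (\<lambda>n. F (r n) x)" for x
  have [measurable]: "f \<in> borel_measurable bernoulli"
    unfolding f_def by measurable
  have bound: "(\<integral>\<^sup>+x. ennreal ((f x - F m x)\<^sup>2) \<partial>bernoulli) \<le> ennreal (((1 / 2) ^ n)\<^sup>2)"
    if "m \<ge> M n" for m n
  proof -
    have "(\<integral>\<^sup>+x. ennreal ((f x - F m x)\<^sup>2) \<partial>bernoulli)
        = (\<integral>\<^sup>+x. liminf (\<lambda>k. ennreal ((F (r k) x - F m x)\<^sup>2)) \<partial>bernoulli)"
    proof (rule nn_integral_cong_AE, rule AE_mp[OF conv], intro AE_I2 impI)
      fix x assume "(\<lambda>n. F (r n) x) \<longlonglongrightarrow> lim (\<lambda>n. F (r n) x)"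
      then have "(\<lambda>k. ennreal ((F (r k) x - F m x)\<^sup>2)) \<longlonglongrightarrow> ennreal ((f x - F m x)\<^sup>2)"
        unfolding f_def by (intro tendsto_intros)
      then show "ennreal ((f x - F m x)\<^sup>2) = liminf (\<lambda>k. ennreal ((F (r k) x - F m x)\<^sup>2))"
        by (rule lim_imp_Liminf[OF trivial_limit_sequentially, symmetric])
    qed
    also have "\<dots> \<le> liminf (\<lambda>k. \<integral>\<^sup>+x. ennreal ((F (r k) x - F m x)\<^sup>2) \<partial>bernoulli)"
      by (rule nn_integral_liminf) measurable
    also have "\<dots> \<le> limsup (\<lambda>k. \<integral>\<^sup>+x. ennreal ((F (r k) x - F m x)\<^sup>2) \<partial>bernoulli)"
      by (rule Liminf_le_Limsup) simp
    also have "\<dots> \<le> ennreal (((1 / 2) ^ n)\<^sup>2)"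
    proof (rule Limsup_bounded)
      show "\<forall>\<^sub>F k in sequentially. (\<integral>\<^sup>+x. ennreal ((F (r k) x - F m x)\<^sup>2) \<partial>bernoulli) \<le> ennreal (((1 / 2) ^ n)\<^sup>2)"
        using eventually_ge_at_top[of "M n"]
      proof eventually_elim
        case (elim k)
        then have "dist (X (r k)) (X m) \<le> (1 / 2) ^ n"
          using that rn[of k] M[of n "r k" m] elim by simp
        then show ?case unfolding nF by (intro ennreal_leI power_mono) auto
      qed
    qed
    finally show ?thesis .
  qed
  have sd: "square_integrable (\<lambda>x. f x - F m x)" if "m \<ge> M n" for m n
    using bound[OF that] unfolding square_integrable_def
    by (auto simp: integrable_iff_bounded le_less_trans)
  have sf: "square_integrable f"
    using square_integrable_add[OF sd[OF order_refl, of 0] F(1)[of "M 0"]] by simp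
  then have relf: "l2_rel f f" by (simp add: l2_rel_def)
  have dist_le: "dist (X m) (abs_l2 f) \<le> (1 / 2) ^ n" if "m \<ge> M n" for m n
  proof -
    have i: "integrable bernoulli (\<lambda>x. (f x - F m x)\<^sup>2)"
      using sd[OF that] by (simp add: square_integrable_def)
    have "(dist (X m) (abs_l2 f))\<^sup>2 = (\<integral>x. (f x - F m x)\<^sup>2 \<partial>bernoulli)"
      using norm_l2_abs[OF sd[OF that]]
      unfolding dist_norm norm_minus_commute[of "X m"] minus_l2.abs_eq[OF relf rel, symmetric] F(2) .
    also have "\<dots> \<le> ((1 / 2) ^ n)\<^sup>2"
      using bound[OF that] by (subst (asm) nn_integral_eq_integral[OF i]) auto
    finally show ?thesis by (rule power2_le_imp_le) simp
  qed
  have "X \<longlonglongrightarrow> abs_l2 f"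
  proof (rule metric_LIMSEQ_I)
    fix e :: real assume "e > 0"
    then obtain n where "(1 / 2) ^ n < e"
      using real_arch_pow_inv[of e "1 / 2"] by auto
    then show "\<exists>k. \<forall>m\<ge>k. dist (X m) (abs_l2 f) < e"
      using dist_le by (meson le_less_trans)
  qed
  then show "convergent X" by (auto simp: convergent_def)
qed


section \<open>Operators on a real Hilbert space\<close>

text \<open>
  Unbounded operators are represented by their graphs.
\<close>

type_synonym 'h graph = "('h \<times> 'h) set"

definition adjoint_graph :: "'h::real_inner graph \<Rightarrow> 'h graph" where
  "adjoint_graph A = {(u, v). \<forall>(x, y)\<in>A. inner y u = inner x v}"

definition self_adjoint :: "'h::real_inner graph \<Rightarrow> bool" where
  "self_adjoint A \<longleftrightarrow> closure (Domain A) = UNIV \<and> adjoint_graph A = A"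

definition essentially_self_adjoint :: "'h::real_inner graph \<Rightarrow> bool" where
  "essentially_self_adjoint A \<longleftrightarrow> self_adjoint (closure A)"

definition is_core :: "'h::real_inner set \<Rightarrow> 'h graph \<Rightarrow> bool" where
  "is_core D A \<longleftrightarrow> D \<subseteq> Domain A \<and> essentially_self_adjoint (A \<inter> D \<times> UNIV)
     \<and> closure (A \<inter> D \<times> UNIV) = A"

definition orth_proj :: "'h::real_inner set \<Rightarrow> 'h \<Rightarrow> 'h" where
  "orth_proj W x = (THE p. p \<in> W \<and> (\<forall>w\<in>W. orthogonal (x - p) w))"

definition is_orth_proj :: "('h::real_inner \<Rightarrow> 'h) \<Rightarrow> bool" where
  "is_orth_proj T \<longleftrightarrow> bounded_linear T \<and> T \<circ> T = T \<and> (\<forall>x y. inner (T x) y = inner x (T y))"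

definition orthogonal_direct_sum :: "('i \<Rightarrow> 'h::real_inner set) \<Rightarrow> bool" where
  "orthogonal_direct_sum W \<longleftrightarrow>
     (\<forall>i. subspace (W i) \<and> closed (W i)) \<and>
     (\<forall>i j. i \<noteq> j \<longrightarrow> (\<forall>u\<in>W i. \<forall>v\<in>W j. orthogonal u v)) \<and>
     closure (span (\<Union>i. W i)) = UNIV"

definition compact_operator :: "('h::real_inner \<Rightarrow> 'h) \<Rightarrow> bool" where
  "compact_operator T \<longleftrightarrow> linear T \<and> compact (closure (T ` cball 0 1))"

definition positive_operator :: "('h::real_inner \<Rightarrow> 'h) \<Rightarrow> bool" where
  "positive_operator S \<longleftrightarrow> bounded_linear S \<and> (\<forall>x y. inner (S x) y = inner x (S y))
     \<and> (\<forall>x. inner (S x) x \<ge> 0)"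

definition orthonormal_basis :: "'h::real_inner set \<Rightarrow> bool" where
  "orthonormal_basis B \<longleftrightarrow> pairwise orthogonal B \<and> (\<forall>e\<in>B. norm e = 1) \<and> closure (span B) = UNIV"

text \<open>In the next definition \<open>S\<close> is the absolute value \<open>(T\<^sup>* T)\<^bsup>1/2\<^esup>\<close>.\<close>

definition trace_class :: "('h::real_inner \<Rightarrow> 'h) \<Rightarrow> bool" where
  "trace_class T \<longleftrightarrow> bounded_linear T \<and>
     (\<exists>S B. positive_operator S \<and> S \<circ> S = adjoint T \<circ> T \<and> orthonormal_basis B \<and>
       (\<lambda>e. inner (S e) e) summable_on B)"

subsection \<open>Borel functional calculus\<close>

definition projection_valued_measure :: "(real set \<Rightarrow> 'h::real_inner \<Rightarrow> 'h) \<Rightarrow> bool" where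
  "projection_valued_measure E \<longleftrightarrow>
     (\<forall>B\<in>sets borel. is_orth_proj (E B)) \<and> E UNIV = id \<and>
     (\<forall>A u. range A \<subseteq> sets borel \<longrightarrow> disjoint_family A \<longrightarrow>
        (\<lambda>n::nat. E (A n) u) sums E (\<Union>n. A n) u)"

definition scalar_measure :: "(real set \<Rightarrow> 'h::real_inner \<Rightarrow> 'h) \<Rightarrow> 'h \<Rightarrow> real measure" where
  "scalar_measure E u = measure_of UNIV (sets borel) (\<lambda>B. ennreal (inner (E B u) u))"

text \<open>
  The graph of \<open>\<integral>\<phi> dE\<close>.  The signed measure \<open>B \<mapsto> \<langle>E(B)u, w\<rangle>\<close> is written by polarization as
  \<open>(\<mu>\<^bsub>u+w\<^esub> - \<mu>\<^bsub>u-w\<^esub>)/4\<close>, where \<open>\<mu>\<^sub>u(B) = \<langle>E(B)u, u\<rangle>\<close>.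
\<close>

definition spectral_domain :: "(real set \<Rightarrow> 'h::real_inner \<Rightarrow> 'h) \<Rightarrow> (real \<Rightarrow> real) \<Rightarrow> 'h set" where
  "spectral_domain E \<phi> = {u. integrable (scalar_measure E u) (\<lambda>s. (\<phi> s)\<^sup>2)}"

definition spectral_integral :: "(real set \<Rightarrow> 'h::real_inner \<Rightarrow> 'h) \<Rightarrow> (real \<Rightarrow> real) \<Rightarrow> 'h graph" where
  "spectral_integral E \<phi> = {(u, v). u \<in> spectral_domain E \<phi> \<and>
     (\<forall>w\<in>spectral_domain E \<phi>. inner v w =
        ((\<integral>s. \<phi> s \<partial>scalar_measure E (u + w)) - (\<integral>s. \<phi> s \<partial>scalar_measure E (u - w))) / 4)}"

definition is_spectral_measure :: "'h::real_inner graph \<Rightarrow> (real set \<Rightarrow> 'h \<Rightarrow> 'h) \<Rightarrow> bool" where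
  "is_spectral_measure A E \<longleftrightarrow>
     projection_valued_measure E \<and> A = spectral_integral E (\<lambda>s. s)"

text \<open>\<open>\<phi>(A)\<close> as an everywhere defined operator, for \<open>A\<close> self-adjoint and \<open>\<phi>\<close> bounded on its spectrum\<close>

definition functional_calculus :: "'h::real_inner graph \<Rightarrow> (real \<Rightarrow> real) \<Rightarrow> 'h \<Rightarrow> 'h" where
  "functional_calculus A \<phi> u =
     (THE v. \<exists>E. is_spectral_measure A E \<and> (u, v) \<in> spectral_integral E \<phi>)"


section \<open>The logarithmic Dirichlet Laplacian\<close>

text \<open>The exponent \<open>\<delta>\<close> is \<open>log N / log \<lambda>\<close>; the inner integrals run over \<open>y \<noteq> x\<close>.\<close>

lift_definition dirichlet_energy :: "real \<Rightarrow> 'a::finite l2 \<Rightarrow> ennreal" is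
  "\<lambda>lam f. \<integral>\<^sup>+x. (\<integral>\<^sup>+y\<in>-{x}.
     ennreal (\<bar>f x - f y\<bar>\<^sup>2 / ultra_dist lam x y powr (ln (real CARD('a)) / ln lam)) \<partial>bernoulli) \<partial>bernoulli"
proof -
  fix lam and f g :: "(nat \<Rightarrow> 'a) \<Rightarrow> real"
  assume "l2_rel f g"
  then have ae: "AE x in bernoulli. f x = g x" by (simp add: l2_rel_def)
  show "(\<integral>\<^sup>+x. (\<integral>\<^sup>+y\<in>-{x}.
     ennreal (\<bar>f x - f y\<bar>\<^sup>2 / ultra_dist lam x y powr (ln (real CARD('a)) / ln lam)) \<partial>bernoulli) \<partial>bernoulli) =
   (\<integral>\<^sup>+x. (\<integral>\<^sup>+y\<in>-{x}.
     ennreal (\<bar>g x - g y\<bar>\<^sup>2 / ultra_dist lam x y powr (ln (real CARD('a)) / ln lam)) \<partial>bernoulli) \<partial>bernoulli)"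
  proof (rule nn_integral_cong_AE, rule AE_mp[OF ae], intro AE_I2 impI)
    fix x
    assume x: "f x = g x"
    show "(\<integral>\<^sup>+y\<in>-{x}.
        ennreal (\<bar>f x - f y\<bar>\<^sup>2 / ultra_dist lam x y powr (ln (real CARD('a)) / ln lam)) \<partial>bernoulli) =
      (\<integral>\<^sup>+y\<in>-{x}.
        ennreal (\<bar>g x - g y\<bar>\<^sup>2 / ultra_dist lam x y powr (ln (real CARD('a)) / ln lam)) \<partial>bernoulli)"
      unfolding x
    proof (rule nn_integral_cong_AE, rule AE_mp[OF ae], intro AE_I2 impI)
      fix y
      assume y: "f y = g y"
      show "ennreal (\<bar>g x - f y\<bar>\<^sup>2 / ultra_dist lam x y powr (ln (real CARD('a)) / ln lam)) * indicator (-{x}) y =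
        ennreal (\<bar>g x - g y\<bar>\<^sup>2 / ultra_dist lam x y powr (ln (real CARD('a)) / ln lam)) * indicator (-{x}) y"
        unfolding y ..
    qed
  qed
qed

lift_definition dirichlet_form :: "real \<Rightarrow> 'a::finite l2 \<Rightarrow> 'a l2 \<Rightarrow> real" is
  "\<lambda>lam f g. 1 / 2 * (\<integral>x. (LINT y:-{x}|bernoulli.
     (f x - f y) * (g x - g y) / ultra_dist lam x y powr (ln (real CARD('a)) / ln lam)) \<partial>bernoulli)"
proof -
  fix lam and f f' g g' :: "(nat \<Rightarrow> 'a) \<Rightarrow> real"
  assume fg: "l2_rel f f'" "l2_rel g g'"
  let ?k = "\<lambda>f g x y. (f x - f y) * (g x - g y) / ultra_dist lam x y powr (ln (real CARD('a)) / ln lam)"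
  have kj: "(\<lambda>(x, y). indicator (-{x}) y *\<^sub>R ?k f g x y) \<in> borel_measurable (bernoulli \<Otimes>\<^sub>M bernoulli)"
    if [measurable]: "f \<in> borel_measurable bernoulli" "g \<in> borel_measurable bernoulli"
    for f g :: "(nat \<Rightarrow> 'a) \<Rightarrow> real"
  proof -
    have "(\<lambda>p. (if fst p = snd p then 0 else 1) * ?k f g (fst p) (snd p))
        \<in> borel_measurable (bernoulli \<Otimes>\<^sub>M bernoulli)"
      by measurable
    moreover have "(\<lambda>(x, y). indicator (-{x}) y *\<^sub>R ?k f g x y) =
        (\<lambda>p. (if fst p = snd p then 0 else 1) * ?k f g (fst p) (snd p))"
      by (auto simp: fun_eq_iff indicator_def simp del: times_divide_eq_right)
    ultimately show ?thesis by (simp only:)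
  qed
  have ms: "f \<in> borel_measurable bernoulli" "f' \<in> borel_measurable bernoulli"
    "g \<in> borel_measurable bernoulli" "g' \<in> borel_measurable bernoulli"
    using fg by (auto simp: l2_rel_def square_integrable_def)
  have ae: "AE x in bernoulli. f x = f' x \<and> g x = g' x"
    using fg by (auto simp: l2_rel_def)
  have "(\<integral>x. (LINT y:-{x}|bernoulli. ?k f g x y) \<partial>bernoulli) =
      (\<integral>x. (LINT y:-{x}|bernoulli. ?k f' g' x y) \<partial>bernoulli)"
    unfolding set_lebesgue_integral_def
  proof (rule integral_cong_AE)
    show "(\<lambda>x. LINT y|bernoulli. indicator (-{x}) y *\<^sub>R ?k f g x y) \<in> borel_measurable bernoulli"
      "(\<lambda>x. LINT y|bernoulli. indicator (-{x}) y *\<^sub>R ?k f' g' x y) \<in> borel_measurable bernoulli"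
      by (rule bernoulli.borel_measurable_lebesgue_integral[OF kj[OF ms(1,3)]],
          rule bernoulli.borel_measurable_lebesgue_integral[OF kj[OF ms(2,4)]])
    show "AE x in bernoulli. (LINT y|bernoulli. indicator (-{x}) y *\<^sub>R ?k f g x y) =
       (LINT y|bernoulli. indicator (-{x}) y *\<^sub>R ?k f' g' x y)"
    proof (rule AE_mp[OF ae], intro AE_I2 impI, rule integral_cong_AE)
      fix x
      show "(\<lambda>y. indicator (-{x}) y *\<^sub>R ?k f g x y) \<in> borel_measurable bernoulli"
        "(\<lambda>y. indicator (-{x}) y *\<^sub>R ?k f' g' x y) \<in> borel_measurable bernoulli"
        using measurable_Pair2[OF kj[OF ms(1,3)], of x] measurable_Pair2[OF kj[OF ms(2,4)], of x]
        by (simp_all only: case_prod_conv space_bernoulli UNIV_I simp_thms)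
      assume "f x = f' x \<and> g x = g' x"
      then show "AE y in bernoulli. indicator (-{x}) y *\<^sub>R ?k f g x y = indicator (-{x}) y *\<^sub>R ?k f' g' x y"
        by (rule_tac AE_mp[OF ae], intro AE_I2 impI) (simp only:)
    qed
  qed
  then show "1 / 2 * (\<integral>x. (LINT y:-{x}|bernoulli. ?k f g x y) \<partial>bernoulli) =
      1 / 2 * (\<integral>x. (LINT y:-{x}|bernoulli. ?k f' g' x y) \<partial>bernoulli)" by simp
qed

definition dirichlet_domain :: "real \<Rightarrow> 'a::finite l2 set" where
  "dirichlet_domain lam = {u. dirichlet_energy lam u < \<infinity>}"

text \<open>
  The graph of \<open>R = (1 + \<Delta>)\<^bsup>-1\<^esup>\<close>; it is single-valued because
  \<open>\<langle>u, u\<rangle> + \<E>(u, u) = 0\<close> forces \<open>u = 0\<close>.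
\<close>

definition resolvent :: "real \<Rightarrow> 'a::finite l2 graph" where
  "resolvent lam = {(f, u). u \<in> dirichlet_domain lam \<and>
     (\<forall>g\<in>dirichlet_domain lam. inner u g + dirichlet_form lam u g = inner f g)}"

definition laplacian :: "real \<Rightarrow> 'a::finite l2 graph" where
  "laplacian lam = {(u, f - u) | f u. (f, u) \<in> resolvent lam}"

definition cylinder_span :: "nat \<Rightarrow> 'a::finite l2 set" where
  "cylinder_span n = span {abs_l2 (indicator (cylinder w)) | w. length w = n}"

definition lipschitz_functions :: "real \<Rightarrow> 'a::finite l2 set" where
  "lipschitz_functions lam = {abs_l2 f | f. square_integrable f \<and>
     (\<exists>C. \<forall>x y. \<bar>f x - f y\<bar> \<le> C * ultra_dist lam x y)}"

end

theory Submission
  imports Defs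
begin

text \<open>
  The kernel \<open>d(x,y)\<^bsup>-\<delta>\<^esup>\<close> equals \<open>N\<^sup>k\<close> when the longest common prefix of \<open>x\<close> and \<open>y\<close> has length
  \<open>k\<close>.  Telescoping \<open>N\<^sup>k\<close> makes it a positive combination of the indicators of the relations
  ``common prefix of length \<open>j\<close>'', and the integral of \<open>(f x - f y)\<^sup>2\<close> over such a relation is
  \<open>2 N\<^bsup>-j\<^esup> \<parallel>f - P\<^sub>j f\<parallel>\<^sup>2\<close>.  Adding up, with \<open>E\<^sub>0 = P\<^sub>0\<close>, \<open>E\<^bsub>k+1\<^esub> = Q\<^sub>k\<close>,
  \<open>a\<^sub>0 = 0\<close> and \<open>a\<^bsub>k+1\<^esub> = 1 + k (1 - 1/N)\<close>, one obtains
  \<open>\<E>(f, f) = \<Sum>n. a\<^sub>n \<parallel>E\<^sub>n f\<parallel>\<^sup>2\<close> (\<open>dirichlet_energy_eq\<close>).  By polarization the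
  Laplacian is the diagonal operator that multiplies \<open>E\<^sub>n u\<close> by \<open>a\<^sub>n\<close> (\<open>laplacian_diagonal\<close>).  The
  differences \<open>E\<^sub>n\<close> resolve the identity because a function with zero integral over all cylinders
  vanishes (\<open>cylinders_total\<close>).

  What remains concerns diagonal operators.  Truncating the expansion shows that they are self-adjoint and
  that any part of the domain containing all truncations is a core.  For a Lipschitz function
  \<open>\<parallel>Q\<^sub>n f\<parallel> \<le> C \<lambda>\<^bsup>-n\<^esup>\<close>, which beats the linear growth of the \<open>a\<^sub>n\<close>, so these functions lie in the
  domain, and among them are the cylinder functions, hence all truncations.

  The functional calculus refers to an arbitrary spectral measure \<open>F\<close> of the operator, which therefore has to be
  identified: an eigenvector with eigenvalue \<open>c\<close> is fixed by \<open>F {c}\<close> (\<open>pvm_eigenvector\<close>), and this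
  determines \<open>F\<close>.  So \<open>e\<^bsup>-t\<Delta>\<^esup>\<close> multiplies \<open>E\<^sub>n u\<close> by \<open>e\<^bsup>-t a\<^sub>n\<^esup>\<close>
  (\<open>functional_calculus_diagonal\<close>).  It is a norm limit of operators of finite rank, hence compact.  Its absolute
  value is the operator itself, and since \<open>Q\<^sub>k\<close> has rank \<open>N\<^bsup>k+1\<^esup> - N\<^sup>k\<close>, its trace in any orthonormal
  basis is \<open>1 + (N - 1) e\<^bsup>-t\<^esup> \<Sum>k. (N e\<^bsup>-t(1-1/N)\<^esup>)\<^sup>k\<close>
  (\<open>trace_class_diagonal_op\<close>).  This geometric series converges exactly when
  \<open>N e\<^bsup>-t(1-1/N)\<^esup> < 1\<close>, that is, when \<open>t > N log N / (N - 1)\<close>.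
\<close>


section \<open>Orthogonal projections\<close>

lemma is_orth_projD:
  assumes "is_orth_proj T"
  shows "bounded_linear T" "T (T x) = T x" "inner (T x) y = inner x (T y)"
  using assms by (auto simp: is_orth_proj_def fun_eq_iff)

text \<open>
  Boundedness comes for free: \<open>\<parallel>T x\<parallel>\<^sup>2 = \<langle>x, T x\<rangle> \<le> \<parallel>x\<parallel> \<parallel>T x\<parallel>\<close>.
\<close>

lemma is_orth_projI:
  assumes "\<And>x y. T (x + y) = T x + T y" "\<And>c x. T (c *\<^sub>R x) = c *\<^sub>R T x"
    and idem: "\<And>x. T (T x) = T x" and sym: "\<And>x y. inner (T x) y = inner x (T y)"
  shows "is_orth_proj T"
  unfolding is_orth_proj_def
proof (intro conjI allI)
  have "norm (T x) \<le> norm x * 1" for x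
  proof -
    have "(norm (T x))\<^sup>2 = inner x (T x)"
      by (simp add: power2_norm_eq_inner sym idem)
    also have "\<dots> \<le> norm x * norm (T x)" by (rule norm_cauchy_schwarz)
    finally show ?thesis
      by (cases "norm (T x) = 0") (auto simp: power2_eq_square mult_right_le_imp_le)
  qed
  then show "bounded_linear T" by (intro bounded_linear_intro assms)
qed (auto simp: idem sym)

lemma inner_orth_proj_self: "is_orth_proj T \<Longrightarrow> inner (T x) x = (norm (T x))\<^sup>2"
  by (metis is_orth_projD(2,3) power2_norm_eq_inner)

lemma inner_orth_proj_both: "is_orth_proj T \<Longrightarrow> inner (T x) (T y) = inner (T x) y"
  by (metis is_orth_projD(2,3))

lemma norm_orth_proj_le:
  assumes "is_orth_proj T" shows "norm (T x) \<le> norm x"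
proof -
  have "(norm (T x))\<^sup>2 = inner (T x) x" by (simp add: inner_orth_proj_self assms)
  also have "\<dots> \<le> norm (T x) * norm x" by (rule norm_cauchy_schwarz)
  finally show ?thesis
    by (cases "norm (T x) = 0") (auto simp: power2_eq_square)
qed

lemma norm_orth_proj_compl:
  assumes "is_orth_proj T" shows "(norm (x - T x))\<^sup>2 = (norm x)\<^sup>2 - (norm (T x))\<^sup>2"
  using inner_orth_proj_self[OF assms, of x]
  by (simp add: power2_norm_eq_inner inner_diff inner_commute)

lemma range_orth_proj: "is_orth_proj T \<Longrightarrow> range T = {x. T x = x}"
  by (auto simp: is_orth_projD(2)) (metis rangeI)

lemma subspace_range_orth_proj: "is_orth_proj T \<Longrightarrow> subspace (range T)"
  using is_orth_projD(1)[of T] by (auto intro!: subspace_UNIV linear_subspace_image bounded_linear.linear)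

lemma closed_range_orth_proj:
  assumes "is_orth_proj T" shows "closed (range T)"
  unfolding range_orth_proj[OF assms]
  by (intro closed_Collect_eq continuous_intros
      linear_continuous_on is_orth_projD(1)[OF assms])

text \<open>
  By symmetry \<open>Q P = P\<close> implies \<open>P Q = P\<close>, and then \<open>(Q - P)\<^sup>2 = Q - P\<close>.
\<close>

lemma is_orth_proj_diff:
  assumes P: "is_orth_proj P" and Q: "is_orth_proj Q" and nested: "\<And>x. Q (P x) = P x"
  shows "is_orth_proj (\<lambda>x. Q x - P x)"
proof -
  have PQ: "P (Q x) = P x" for x
  proof -
    have "inner (P (Q x)) y = inner (P x) y" for y
      by (simp add: is_orth_projD(3)[OF P] is_orth_projD(3)[OF Q] nested)
    then have "inner (P (Q x) - P x) (P (Q x) - P x) = 0" by (simp add: inner_diff_left)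
    then show ?thesis by simp
  qed
  interpret P: bounded_linear P by (rule is_orth_projD[OF P])
  interpret Q: bounded_linear Q by (rule is_orth_projD[OF Q])
  show ?thesis
    by (rule is_orth_projI)
       (simp_all add: P.add Q.add P.scaleR Q.scaleR P.diff Q.diff nested PQ is_orth_projD(2)[OF P]
         is_orth_projD(2)[OF Q] algebra_simps inner_diff is_orth_projD(3)[OF P] is_orth_projD(3)[OF Q])
qed

lemma orth_proj_eqI:
  assumes "subspace W" "p \<in> W" "\<And>w. w \<in> W \<Longrightarrow> orthogonal (x - p) w"
  shows "orth_proj W x = p"
  unfolding orth_proj_def
proof (rule the_equality)
  fix q assume q: "q \<in> W \<and> (\<forall>w\<in>W. orthogonal (x - q) w)"
  have "p - q \<in> W" using assms q by (simp add: subspace_diff)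
  then have "inner (x - q) (p - q) = 0" "inner (x - p) (p - q) = 0"
    using q assms(3) by (auto simp: orthogonal_def)
  then have "inner (p - q) (p - q) = 0" by (simp add: inner_diff algebra_simps)
  then show "q = p" by simp
qed (use assms in auto)


section \<open>Orthonormal systems\<close>

definition orthonormal :: "'h::real_inner set \<Rightarrow> bool" where
  "orthonormal G \<longleftrightarrow> pairwise orthogonal G \<and> (\<forall>e\<in>G. norm e = 1)"

definition fourier :: "'h::real_inner set \<Rightarrow> 'h \<Rightarrow> 'h" where
  "fourier G x = (\<Sum>g\<in>G. inner x g *\<^sub>R g)"

lemma orthonormal_inner:
  assumes "orthonormal G" "g \<in> G" "h \<in> G"
  shows "inner g h = (if g = h then 1 else 0)"
  using assms by (auto simp: orthonormal_def pairwise_def orthogonal_def norm_eq_1)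

context
  fixes G :: "'h::real_inner set"
  assumes fin: "finite G" and on: "orthonormal G"
begin

lemma inner_fourier_basis: "h \<in> G \<Longrightarrow> inner (fourier G x) h = inner x h"
  using fin by (simp add: fourier_def inner_sum_left orthonormal_inner[OF on] if_distrib sum.delta cong: if_cong)

lemma fourier_in_span: "fourier G x \<in> span G"
  unfolding fourier_def by (intro span_sum span_scale span_base)

lemma fourier_orthogonal: "w \<in> span G \<Longrightarrow> orthogonal (x - fourier G x) w"
  by (rule orthogonal_to_span[of _ G]) (auto simp: orthogonal_def inner_diff_left inner_fourier_basis)

lemma orth_proj_span: "orth_proj (span G) x = fourier G x"
  by (rule orth_proj_eqI) (auto simp: fourier_in_span fourier_orthogonal)

lemma inner_fourier: "inner (fourier G x) y = (\<Sum>g\<in>G. inner x g * inner y g)"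
  by (simp add: fourier_def inner_sum_left inner_commute[of y])

lemma norm_fourier: "(norm (fourier G x))\<^sup>2 = (\<Sum>g\<in>G. (inner x g)\<^sup>2)"
proof -
  have "(norm (fourier G x))\<^sup>2 = (\<Sum>g\<in>G. inner x g * inner (fourier G x) g)"
    by (simp add: power2_norm_eq_inner inner_fourier)
  also have "\<dots> = (\<Sum>g\<in>G. (inner x g)\<^sup>2)"
    by (intro sum.cong) (simp_all add: inner_fourier_basis power2_eq_square)
  finally show ?thesis .
qed

lemma is_orth_proj_fourier: "is_orth_proj (fourier G)"
proof (rule is_orth_projI)
  fix x y :: 'h and c :: real
  show "fourier G (fourier G x) = fourier G x"
    unfolding fourier_def[of G "fourier G x"] by (simp add: inner_fourier_basis fourier_def[symmetric] cong: sum.cong)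
  show "inner (fourier G x) y = inner x (fourier G y)"
    by (subst inner_commute[of x]) (simp add: inner_fourier mult.commute)
qed (simp_all add: fourier_def inner_add_left scaleR_add_left sum.distrib scaleR_sum_right)

lemma fourier_span: "w \<in> span G \<Longrightarrow> fourier G w = w"
  using orth_proj_eqI[of "span G" w w] by (simp add: orth_proj_span[symmetric] orthogonal_def)

lemma range_fourier: "range (fourier G) = span G"
proof
  show "range (fourier G) \<subseteq> span G" using fourier_in_span by blast
  show "span G \<subseteq> range (fourier G)"
  proof
    fix x assume "x \<in> span G"
    then have "x = fourier G x" using fourier_span by simp
    then show "x \<in> range (fourier G)" by blast
  qed
qed

lemma fourier_best: "v \<in> span G \<Longrightarrow> norm (x - fourier G x) \<le> norm (x - v)"
proof -
  assume v: "v \<in> span G"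
  have "orthogonal (x - fourier G x) (fourier G x - v)"
    by (intro fourier_orthogonal span_diff fourier_in_span v)
  from norm_add_Pythagorean[OF this]
  have "(norm (x - fourier G x))\<^sup>2 \<le> (norm (x - v))\<^sup>2" by simp
  then show ?thesis by (rule power2_le_imp_le) simp
qed

end

text \<open>
  Parseval's identity: an element of the dense span lies in the span of a finite part \<open>F\<close> of the
  basis, and the orthogonal projection onto \<open>span F\<close> is at least as good an approximation.
\<close>

lemma parseval_has_sum:
  fixes B :: "'h::real_inner set"
  assumes B: "orthonormal_basis B"
  shows "((\<lambda>e. (inner x e)\<^sup>2) has_sum (norm x)\<^sup>2) B"
proof -
  have on: "orthonormal F" if "F \<subseteq> B" for F
    using B that by (auto simp: orthonormal_basis_def orthonormal_def pairwise_def subset_iff)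
  have sum: "(\<Sum>e\<in>F. (inner x e)\<^sup>2) = (norm x)\<^sup>2 - (norm (x - fourier F x))\<^sup>2"
    if "finite F" "F \<subseteq> B" for F
    using that by (simp add: norm_fourier on norm_orth_proj_compl is_orth_proj_fourier)
  show ?thesis
    unfolding has_sum_def tendsto_iff eventually_finite_subsets_at_top
  proof (intro allI impI)
    fix \<epsilon> :: real assume "\<epsilon> > 0"
    then have s: "sqrt \<epsilon> > 0" by simp
    have "x \<in> closure (span B)" using B by (simp add: orthonormal_basis_def)
    then obtain v where v: "v \<in> span B" "norm (x - v) < sqrt \<epsilon>"
      using s unfolding closure_approachable by (metis dist_norm norm_minus_commute)
    then obtain F where F: "finite F" "F \<subseteq> B" "v \<in> span F"
      unfolding span_explicit[of B] by (smt (verit) mem_Collect_eq span_base span_scale span_sum subset_iff)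
    have "dist (\<Sum>e\<in>F'. (inner x e)\<^sup>2) ((norm x)\<^sup>2) < \<epsilon>" if F': "finite F'" "F' \<subseteq> B" "F \<subseteq> F'" for F'
    proof -
      have "norm (x - fourier F' x) \<le> norm (x - v)"
        using F F' by (intro fourier_best on) (auto dest: span_mono)
      then have "(norm (x - fourier F' x))\<^sup>2 < (sqrt \<epsilon>)\<^sup>2"
        using v(2) by (intro power_strict_mono) auto
      then show ?thesis using \<open>\<epsilon> > 0\<close> by (simp add: sum F' dist_real_def)
    qed
    then show "\<exists>X. finite X \<and> X \<subseteq> B \<and> (\<forall>Y. finite Y \<and> X \<subseteq> Y \<and> Y \<subseteq> B \<longrightarrow>
        dist (\<Sum>e\<in>Y. (inner x e)\<^sup>2) ((norm x)\<^sup>2) < \<epsilon>)"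
      using F by blast
  qed
qed

lemma has_sum_finite_sum:
  fixes f :: "'i \<Rightarrow> 'x \<Rightarrow> real"
  assumes "finite I" "\<And>i. i \<in> I \<Longrightarrow> (f i has_sum s i) A"
  shows "((\<lambda>x. \<Sum>i\<in>I. f i x) has_sum (\<Sum>i\<in>I. s i)) A"
  using assms by (induction I rule: finite_induct) (auto intro: has_sum_add)

text \<open>
  By Parseval each \<open>g \<in> G\<close> contributes \<open>\<parallel>g\<parallel>\<^sup>2 = 1\<close>.  This is how the rank of a projection, as its trace,
  is read off in a basis unrelated to \<open>G\<close>.
\<close>

lemma has_sum_norm_fourier:
  assumes "finite G" "orthonormal G" "orthonormal_basis B"
  shows "((\<lambda>e. (norm (fourier G e))\<^sup>2) has_sum real (card G)) B"
proof -
  have "((\<lambda>e. \<Sum>g\<in>G. (inner g e)\<^sup>2) has_sum (\<Sum>g\<in>G. (norm g)\<^sup>2)) B"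
    by (intro has_sum_finite_sum parseval_has_sum assms)
  moreover have "(\<Sum>g\<in>G. (norm g)\<^sup>2) = real (card G)"
    using assms(2) by (simp add: orthonormal_def)
  ultimately show ?thesis
    using assms by (simp add: norm_fourier inner_commute)
qed


instance l2 :: (finite) banach ..

section \<open>Spectral resolutions\<close>

text \<open>Riesz--Fischer: by Pythagoras the partial sums are Cauchy.\<close>

lemma summable_orthogonal:
  fixes x :: "nat \<Rightarrow> 'h::{real_inner,banach}"
  assumes orth: "\<And>m n. m \<noteq> n \<Longrightarrow> orthogonal (x m) (x n)"
    and sm: "summable (\<lambda>n. (norm (x n))\<^sup>2)"
  shows "summable x"
  unfolding summable_Cauchy
proof (intro allI impI)
  fix e :: real assume "e > 0"
  then have "e\<^sup>2 > 0" by simp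
  then obtain N where N: "\<And>m n. m \<ge> N \<Longrightarrow> norm (\<Sum>k=m..<n. (norm (x k))\<^sup>2) < e\<^sup>2"
    using sm unfolding summable_Cauchy by blast
  have "norm (sum x {m..<n}) < e" if "m \<ge> N" for m n
  proof -
    have "(norm (sum x {m..<n}))\<^sup>2 = (\<Sum>k=m..<n. (norm (x k))\<^sup>2)"
      by (intro norm_sum_Pythagorean) (auto simp: pairwise_def orth)
    also have "\<dots> < e\<^sup>2" using N[OF that, of n] by (simp add: sum_nonneg)
    finally show ?thesis using \<open>e > 0\<close> by (intro power2_less_imp_less[of _ e]) auto
  qed
  then show "\<exists>N. \<forall>m\<ge>N. \<forall>n. norm (sum x {m..<n}) < e" by blast
qed

text \<open>
  When the \<open>E n\<close> are mutually orthogonal projections with sum \<open>1\<close>, this is the graph of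
  \<open>\<Sum>n. c n E n\<close> on its maximal domain.
\<close>

definition diagonal_graph :: "(nat \<Rightarrow> 'h::real_inner \<Rightarrow> 'h) \<Rightarrow> (nat \<Rightarrow> real) \<Rightarrow> 'h graph" where
  "diagonal_graph E c = {(u, v). \<forall>n. E n v = c n *\<^sub>R E n u}"

locale spectral_resolution =
  fixes E :: "nat \<Rightarrow> 'h::{real_inner,banach} \<Rightarrow> 'h"
  assumes proj: "is_orth_proj (E n)"
    and disjoint: "m \<noteq> n \<Longrightarrow> E m (E n u) = 0"
    and complete: "(\<lambda>n. E n u) sums u"
begin

lemma linear_E: "bounded_linear (E n)" using is_orth_projD(1)[OF proj] .

lemmas E_add [simp] = linear_simps(1)[OF linear_E]
  and E_diff [simp] = linear_simps(2)[OF linear_E]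
  and E_minus [simp] = linear_simps(4)[OF linear_E]
  and E_zero [simp] = linear_simps(3)[OF linear_E]
  and E_scale [simp] = linear_simps(5)[OF linear_E]

lemma E_E: "E m (E n u) = (if m = n then E n u else 0)"
  by (simp add: disjoint is_orth_projD(2)[OF proj])

lemma E_sum: "E n (sum f A) = (\<Sum>i\<in>A. E n (f i))"
  by (rule linear_sum[OF bounded_linear.linear[OF linear_E]])

lemma E_sym: "inner (E n u) v = inner u (E n v)"
  by (rule is_orth_projD(3)[OF proj])

lemma inner_E_both: "inner (E n u) (E n v) = inner (E n u) v"
  by (rule inner_orth_proj_both[OF proj])

lemma orthogonal_E: "m \<noteq> n \<Longrightarrow> inner (E m u) (E n v) = 0"
  by (simp add: E_sym[of m] disjoint)

lemma inner_sums: "(\<lambda>n. inner (E n u) (E n v)) sums inner u v"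
  using bounded_linear.sums[OF bounded_linear_inner_left complete, of u v]
  by (simp add: inner_E_both)

lemma norm_sums: "(\<lambda>n. (norm (E n u))\<^sup>2) sums (norm u)\<^sup>2"
  using inner_sums[of u u] by (simp add: power2_norm_eq_inner)

lemma E_eqI:
  assumes "\<And>n. E n u = E n v" shows "u = v"
  using complete[of u] complete[of v] unfolding assms by (rule sums_unique2)

lemma E_suminf:
  assumes "summable (\<lambda>k. c k *\<^sub>R E k u)"
  shows "E n (\<Sum>k. c k *\<^sub>R E k u) = c n *\<^sub>R E n u"
proof -
  have "(\<lambda>k. E n (c k *\<^sub>R E k u)) sums E n (\<Sum>k. c k *\<^sub>R E k u)"
    by (rule bounded_linear.sums[OF linear_E summable_sums[OF assms]])
  moreover have "(\<lambda>k. E n (c k *\<^sub>R E k u)) = (\<lambda>k. if k = n then c n *\<^sub>R E n u else 0)"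
    by (auto simp: E_E fun_eq_iff)
  ultimately show ?thesis
    using sums_single[of n "\<lambda>_. c n *\<^sub>R E n u"] by (simp add: sums_iff)
qed

lemma diagonal_summable:
  assumes "summable (\<lambda>n. (c n)\<^sup>2 * (norm (E n u))\<^sup>2)"
  shows "summable (\<lambda>n. c n *\<^sub>R E n u)"
  by (rule summable_orthogonal) (use assms in \<open>auto simp: orthogonal_def orthogonal_E power_mult_distrib\<close>)

lemma mem_diagonal_graph: "(u, v) \<in> diagonal_graph E c \<longleftrightarrow> (\<forall>n. E n v = c n *\<^sub>R E n u)"
  by (simp add: diagonal_graph_def)

lemma Domain_diagonal_graph:
  "u \<in> Domain (diagonal_graph E c) \<longleftrightarrow> summable (\<lambda>n. (c n)\<^sup>2 * (norm (E n u))\<^sup>2)"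
proof
  assume "u \<in> Domain (diagonal_graph E c)"
  then obtain v where v: "\<And>n. E n v = c n *\<^sub>R E n u" by (auto simp: diagonal_graph_def)
  from norm_sums[of v] show "summable (\<lambda>n. (c n)\<^sup>2 * (norm (E n u))\<^sup>2)"
    unfolding v by (simp add: sums_iff power_mult_distrib)
next
  assume "summable (\<lambda>n. (c n)\<^sup>2 * (norm (E n u))\<^sup>2)"
  then have "(u, \<Sum>n. c n *\<^sub>R E n u) \<in> diagonal_graph E c"
    by (simp add: mem_diagonal_graph E_suminf diagonal_summable)
  then show "u \<in> Domain (diagonal_graph E c)" by blast
qed

lemma diagonal_graph_E: "(E n u, v) \<in> diagonal_graph E c \<longleftrightarrow> v = c n *\<^sub>R E n u"
proof
  assume "(E n u, v) \<in> diagonal_graph E c"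
  then have v: "E m v = c m *\<^sub>R E m (E n u)" for m by (simp add: mem_diagonal_graph)
  show "v = c n *\<^sub>R E n u"
    by (rule E_eqI) (simp add: v E_E)
qed (simp add: mem_diagonal_graph E_E)

lemma diagonal_graph_kernel:
  assumes c: "c 0 = 0" "\<And>n. c (Suc n) \<noteq> 0"
  shows "{u. (u, 0) \<in> diagonal_graph E c} = range (E 0)"
proof -
  have "(u, 0) \<in> diagonal_graph E c \<longleftrightarrow> E 0 u = u" for u
  proof
    assume "(u, 0) \<in> diagonal_graph E c"
    then have z: "E (Suc n) u = 0" for n using c(2)[of n] by (auto simp: mem_diagonal_graph dest: spec[of _ "Suc n"])
    show "E 0 u = u"
    proof (rule E_eqI)
      show "E n (E 0 u) = E n u" for n by (cases n) (simp_all add: E_E z)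
    qed
  next
    assume "E 0 u = u"
    then show "(u, 0) \<in> diagonal_graph E c" using diagonal_graph_E[of 0 u 0 c] c(1) by simp
  qed
  then show ?thesis by (simp add: range_orth_proj[OF proj])
qed

lemma orthogonal_direct_sum_E: "orthogonal_direct_sum (\<lambda>n. range (E n))"
  unfolding orthogonal_direct_sum_def
proof (intro conjI allI impI ballI)
  fix m n u v assume "m \<noteq> n" "u \<in> range (E m)" "v \<in> range (E n)"
  then show "orthogonal u v" by (auto simp: orthogonal_def orthogonal_E)
next
  have "u \<in> closure (span (\<Union>i. range (E i)))" for u
    unfolding closure_sequential
    by (intro exI[of _ "\<lambda>n. \<Sum>i<n. E i u"] conjI allI span_sum)
       (use complete[of u] in \<open>auto simp: sums_def intro: span_base\<close>)
  then show "closure (span (\<Union>i. range (E i))) = UNIV" by auto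
qed (auto simp: subspace_range_orth_proj closed_range_orth_proj proj)


section \<open>Diagonal operators are self-adjoint\<close>

lemma closed_diagonal_graph: "closed (diagonal_graph E c)"
proof -
  have "diagonal_graph E c = (\<Inter>n. {p. E n (snd p) = c n *\<^sub>R E n (fst p)})"
    by (auto simp: diagonal_graph_def)
  also have "closed \<dots>"
    by (intro closed_INT ballI closed_Collect_eq continuous_intros bounded_linear.continuous_on[OF linear_E])
  finally show ?thesis .
qed

lemma diagonal_graph_partial_sums:
  "(\<Sum>k<n. E k u, \<Sum>k<n. c k *\<^sub>R E k u) \<in> diagonal_graph E c"
  by (auto simp: mem_diagonal_graph E_sum E_E if_distrib cong: if_cong)

text \<open>
  A pair \<open>(u, v)\<close> of the adjoint graph, tested against the eigenvectors \<open>E n x\<close>, has the components of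
  a pair of the graph itself; symmetry of the operator is a comparison of two series term by term.
\<close>

lemma self_adjoint_diagonal_graph: "self_adjoint (diagonal_graph E c)"
  unfolding self_adjoint_def
proof
  show "closure (Domain (diagonal_graph E c)) = UNIV"
  proof -
    have "u \<in> closure (Domain (diagonal_graph E c))" for u
      unfolding closure_sequential
      by (intro exI[of _ "\<lambda>n. \<Sum>i<n. E i u"])
        (use complete[of u] diagonal_graph_partial_sums in \<open>auto simp: sums_def\<close>)
    then show ?thesis by auto
  qed
  have "(u, v) \<in> adjoint_graph (diagonal_graph E c) \<longleftrightarrow> (u, v) \<in> diagonal_graph E c" for u v
  proof
    assume *: "(u, v) \<in> adjoint_graph (diagonal_graph E c)"
    show "(u, v) \<in> diagonal_graph E c"
      unfolding mem_diagonal_graph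
    proof
      fix n
      have "inner (c n *\<^sub>R E n x) u = inner (E n x) v" for x
        using * diagonal_graph_E[of n x "c n *\<^sub>R E n x" c] by (auto simp: adjoint_graph_def)
      then have "inner x (E n v - c n *\<^sub>R E n u) = 0" for x
        by (simp add: inner_diff_right E_sym)
      then show "E n v = c n *\<^sub>R E n u"
        by (metis inner_eq_zero_iff eq_iff_diff_eq_0)
    qed
  next
    assume *: "(u, v) \<in> diagonal_graph E c"
    have "inner y u = inner x v" if "(x, y) \<in> diagonal_graph E c" for x y
    proof -
      have "(\<lambda>n. inner (E n y) (E n u)) = (\<lambda>n. inner (E n x) (E n v))"
        using * that by (simp add: mem_diagonal_graph)
      then show ?thesis using inner_sums[of y u] inner_sums[of x v] by (simp add: sums_iff)
    qed
    then show "(u, v) \<in> adjoint_graph (diagonal_graph E c)" by (auto simp: adjoint_graph_def)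
  qed
  then show "adjoint_graph (diagonal_graph E c) = diagonal_graph E c" by auto
qed

text \<open>
  The operator commutes with the truncations, so those of \<open>u\<close> and of its image converge together.
\<close>

lemma is_core_diagonal_graph:
  assumes L: "L \<subseteq> Domain (diagonal_graph E c)" and E: "\<And>n u. (\<Sum>k<n. E k u) \<in> L"
  shows "is_core L (diagonal_graph E c)"
proof -
  let ?D = "diagonal_graph E c"
  have "closure (?D \<inter> L \<times> UNIV) = ?D"
  proof
    show "closure (?D \<inter> L \<times> UNIV) \<subseteq> ?D"
      by (intro closure_minimal closed_diagonal_graph) auto
    show "?D \<subseteq> closure (?D \<inter> L \<times> UNIV)"
    proof clarify
      fix u v assume uv: "(u, v) \<in> ?D"
      let ?s = "\<lambda>n. (\<Sum>k<n. E k u, \<Sum>k<n. E k v)"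
      have "?s \<longlonglongrightarrow> (u, v)"
        using complete[of u] complete[of v] by (intro tendsto_Pair) (auto simp: sums_def)
      moreover have "?s n \<in> ?D \<inter> L \<times> UNIV" for n
        using diagonal_graph_partial_sums[of u n c] uv E by (simp add: mem_diagonal_graph)
      ultimately show "(u, v) \<in> closure (?D \<inter> L \<times> UNIV)"
        unfolding closure_sequential by (intro exI[of _ ?s]) blast
    qed
  qed
  then show ?thesis
    using L self_adjoint_diagonal_graph by (simp add: is_core_def essentially_self_adjoint_def)
qed

end


text \<open>
  Bessel's inequality makes \<open>P n u\<close> converge for every increasing sequence of projections, and the
  difference of \<open>u\<close> and the limit is annihilated by all of them.
\<close>

lemma spectral_resolution_increasing:
  fixes P :: "nat \<Rightarrow> 'h::{real_inner,banach} \<Rightarrow> 'h"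
  assumes P: "\<And>n. is_orth_proj (P n)"
    and incr: "\<And>n u. P (Suc n) (P n u) = P n u"
    and total: "\<And>u. (\<And>n. P n u = 0) \<Longrightarrow> u = 0"
  shows "spectral_resolution (\<lambda>n. case n of 0 \<Rightarrow> P 0 | Suc k \<Rightarrow> (\<lambda>u. P (Suc k) u - P k u))"
    (is "spectral_resolution ?E")
proof -
  have lin: "bounded_linear (P n)" for n by (rule is_orth_projD(1)[OF P])
  note P_simps = linear_simps[OF lin]
  have up: "P m (P n u) = P n u" if "n \<le> m" for m n u
    using that
  proof (induction m rule: dec_induct)
    case base then show ?case by (rule is_orth_projD(2)[OF P])
  next
    case (step m) then show ?case using incr[of m "P n u"] by simp
  qed
  have down: "P n (P m u) = P n u" if "n \<le> m" for m n u
  proof -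
    have "inner (P n (P m u) - P n u) y = 0" for y
      by (simp add: inner_diff_left is_orth_projD(3)[OF P] up[OF that])
    from this[of "P n (P m u) - P n u"] show ?thesis by simp
  qed
  have proj: "is_orth_proj (?E n)" for n
    by (cases n) (simp_all add: P is_orth_proj_diff[OF P P] incr)
  have EP: "?E m (P n u) = (if m \<le> n then ?E m u else 0)" for m n u
    by (cases m) (simp_all add: up down)
  have linE: "bounded_linear (?E m)" for m by (rule is_orth_projD(1)[OF proj])
  have disj: "?E m (?E n u) = 0" if "m \<noteq> n" for m n u
  proof (cases n)
    case 0
    then show ?thesis using that EP[of m 0 u] by simp
  next
    case (Suc k)
    have "?E m (?E n u) = ?E m (P (Suc k) u) - ?E m (P k u)"
      unfolding Suc nat.case by (rule linear_simps(2)[OF linE])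
    also have "\<dots> = 0" unfolding EP using that Suc by auto
    finally show ?thesis .
  qed
  have psum: "(\<Sum>k<Suc n. ?E k u) = P n u" for n u
    by (induction n) auto
  have orth: "orthogonal (?E m u) (?E n u)" if "m \<noteq> n" for m n u
    using disj[OF that] by (simp only: orthogonal_def is_orth_projD(3)[OF proj] inner_zero_right)
  have "(\<lambda>n. ?E n u) sums u" for u
  proof -
    have bd: "(\<Sum>k<n. (norm (?E k u))\<^sup>2) \<le> (norm u)\<^sup>2" for n
    proof (cases n)
      case (Suc m)
      have "(\<Sum>k<n. (norm (?E k u))\<^sup>2) = (norm (\<Sum>k<n. ?E k u))\<^sup>2"
        by (rule norm_sum_Pythagorean[symmetric]) (auto simp: pairwise_def orth)
      also have "\<dots> \<le> (norm u)\<^sup>2"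
        unfolding Suc psum using norm_orth_proj_le[OF P] by (intro power_mono) auto
      finally show ?thesis .
    qed simp
    have "summable (\<lambda>n. (norm (?E n u))\<^sup>2)"
      by (rule summableI_nonneg_bounded[OF _ bd]) simp
    from summable_orthogonal[OF orth this] have sm: "summable (\<lambda>n. ?E n u)" by simp
    define v where "v = (\<Sum>n. ?E n u)"
    have "(\<lambda>n. \<Sum>k<n. ?E k u) \<longlonglongrightarrow> v" using summable_LIMSEQ[OF sm] by (simp add: v_def)
    from LIMSEQ_Suc[OF this] have Pv: "(\<lambda>n. P n u) \<longlonglongrightarrow> v" unfolding psum .
    have "P n (u - v) = 0" for n
    proof -
      have "(\<lambda>m. P n (P m u)) \<longlonglongrightarrow> P n v" by (rule bounded_linear.tendsto[OF lin Pv])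
      moreover have "\<forall>\<^sub>F m in sequentially. P n (P m u) = P n u"
        using eventually_ge_at_top[of n] by eventually_elim (simp add: down)
      then have "(\<lambda>m. P n (P m u)) \<longlonglongrightarrow> P n u" by (rule tendsto_eventually)
      ultimately have "P n v = P n u" by (rule LIMSEQ_unique)
      then show ?thesis by (simp add: P_simps)
    qed
    then have "u = v" using total[of "u - v"] by simp
    then show ?thesis using summable_sums[OF sm] by (simp add: v_def)
  qed
  note sums = this
  show ?thesis
  proof (rule spectral_resolution.intro)
    show "is_orth_proj (?E n)" for n by (rule proj)
    show "?E m (?E n u) = 0" if "m \<noteq> n" for m n u by (rule disj[OF that])
    show "(\<lambda>n. ?E n u) sums u" for u by (rule sums)
  qed
qed


section \<open>Projection-valued measures\<close>

context
  fixes E :: "real set \<Rightarrow> 'h::real_inner \<Rightarrow> 'h"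
  assumes pvm: "projection_valued_measure E"
begin

lemma pvm_proj: "B \<in> sets borel \<Longrightarrow> is_orth_proj (E B)"
  and pvm_UNIV: "E UNIV u = u"
  and pvm_sums: "range A \<subseteq> sets borel \<Longrightarrow> disjoint_family A \<Longrightarrow> (\<lambda>n. E (A n) u) sums E (\<Union>n. A n) u"
  using pvm by (auto simp: projection_valued_measure_def)

lemma pvm_empty: "E {} u = 0"
proof -
  have "(\<lambda>n::nat. E {} u) sums E (\<Union>n::nat. {}) u"
    by (rule pvm_sums) (auto simp: disjoint_family_on_def)
  then have "(\<lambda>n::nat. E {} u) \<longlonglongrightarrow> 0" by (intro summable_LIMSEQ_zero sums_summable)
  then show ?thesis by (simp add: LIMSEQ_const_iff)
qed

lemma pvm_Un:
  assumes "A \<in> sets borel" "B \<in> sets borel" "A \<inter> B = {}"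
  shows "E (A \<union> B) u = E A u + E B u"
proof -
  have "(\<lambda>n. E (binaryset A B n) u) sums E (\<Union>n. binaryset A B n) u"
    using assms by (intro pvm_sums) (auto simp: range_binaryset_eq disjoint_family_on_def binaryset_def)
  moreover have "(\<lambda>n. E (binaryset A B n) u) sums (\<Sum>n<2. E (binaryset A B n) u)"
    by (rule sums_finite) (auto simp: binaryset_def pvm_empty)
  moreover have "(\<Sum>n<2. E (binaryset A B n) u) = E A u + E B u"
    by (simp add: numeral_2_eq_2 binaryset_def)
  ultimately show ?thesis by (metis UN_binaryset_eq sums_unique2)
qed

text \<open>
  For \<open>v = E B u\<close> the inequality \<open>\<parallel>E A v\<parallel>\<^sup>2 + \<parallel>E B v\<parallel>\<^sup>2 \<le> \<parallel>v\<parallel>\<^sup>2\<close>, which is contractivity of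
  \<open>E (A \<union> B)\<close>, leaves no room for \<open>E A v\<close>, because \<open>E B v = v\<close>.
\<close>

lemma pvm_disjoint:
  assumes "A \<in> sets borel" "B \<in> sets borel" "A \<inter> B = {}"
  shows "E A (E B u) = 0"
proof -
  let ?v = "E B u"
  have "(norm (E (A \<union> B) ?v))\<^sup>2 = inner (E (A \<union> B) ?v) ?v"
    using assms by (intro inner_orth_proj_self[symmetric] pvm_proj) auto
  also have "\<dots> = (norm (E A ?v))\<^sup>2 + (norm (E B ?v))\<^sup>2"
    by (simp add: pvm_Un assms inner_add_left inner_orth_proj_self pvm_proj)
  finally have *: "(norm (E A ?v))\<^sup>2 + (norm (E B ?v))\<^sup>2 \<le> (norm ?v)\<^sup>2"
    using power_mono[OF norm_orth_proj_le[OF pvm_proj[of "A \<union> B"], of ?v], of 2] assms by simp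
  moreover have "E B ?v = ?v" by (rule is_orth_projD(2)[OF pvm_proj[OF assms(2)]])
  ultimately have "(norm (E A ?v))\<^sup>2 \<le> 0" by simp
  then show ?thesis by simp
qed

lemma pvm_add: "B \<in> sets borel \<Longrightarrow> E B (u + v) = E B u + E B v"
  and pvm_scale: "B \<in> sets borel \<Longrightarrow> E B (c *\<^sub>R u) = c *\<^sub>R E B u"
  using linear_simps[OF is_orth_projD(1)[OF pvm_proj]] by auto

lemma pvm_Int:
  assumes "A \<in> sets borel" "B \<in> sets borel"
  shows "E A (E B u) = E (A \<inter> B) u"
proof -
  have "E A (E B u) = E (A \<inter> B) (E B u) + E (A - B) (E B u)"
    using assms pvm_Un[of "A \<inter> B" "A - B" "E B u"] by (auto simp: Int_Diff_Un)
  also have "E (A - B) (E B u) = 0" using assms by (intro pvm_disjoint) auto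
  also have "E (A \<inter> B) (E B u) = E (A \<inter> B) (E B u) + E (A \<inter> B) (E (- B) u)"
    using assms pvm_disjoint[of "A \<inter> B" "- B" u] by auto
  also have "\<dots> = E (A \<inter> B) (E B u + E (- B) u)"
    using assms by (simp add: pvm_add)
  also have "E B u + E (- B) u = u"
    using assms pvm_Un[of B "- B" u] by (auto simp: pvm_UNIV)
  finally show ?thesis by simp
qed

lemma sets_scalar_measure: "sets (scalar_measure E u) = sets borel"
  and space_scalar_measure: "space (scalar_measure E u) = UNIV"
  using sigma_algebra.sigma_sets_eq[OF sets.sigma_algebra_axioms[of "borel :: real measure"]]
  by (auto simp: scalar_measure_def)

lemma measurable_scalar_measure: "f \<in> borel_measurable borel \<Longrightarrow> f \<in> borel_measurable (scalar_measure E u)"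
  by (simp cong: measurable_cong_sets add: sets_scalar_measure)

lemma emeasure_scalar_measure:
  assumes "B \<in> sets borel"
  shows "emeasure (scalar_measure E u) B = ennreal (inner (E B u) u)"
proof (rule emeasure_measure_of[OF scalar_measure_def])
  show "B \<in> sets (scalar_measure E u)" using assms by (simp add: sets_scalar_measure)
  show "positive (sets (scalar_measure E u)) (\<lambda>B. ennreal (inner (E B u) u))"
    by (simp add: positive_def pvm_empty)
  show "countably_additive (sets (scalar_measure E u)) (\<lambda>B. ennreal (inner (E B u) u))"
    unfolding countably_additive_def sets_scalar_measure
  proof (intro allI impI)
    fix A :: "nat \<Rightarrow> real set"
    assume A: "range A \<subseteq> sets borel" "disjoint_family A"
    have "(\<lambda>n. inner (E (A n) u) u) sums inner (E (\<Union>n. A n) u) u"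
      by (rule bounded_linear.sums[OF bounded_linear_inner_left pvm_sums[OF A]])
    moreover have "0 \<le> inner (E (A n) u) u" for n
      using A(1) by (subst inner_orth_proj_self[OF pvm_proj]) auto
    ultimately show "(\<Sum>n. ennreal (inner (E (A n) u) u)) = ennreal (inner (E (\<Union> (range A)) u) u)"
      by (intro suminf_ennreal_eq)
  qed
qed auto

lemma finite_measure_scalar_measure: "finite_measure (scalar_measure E u)"
  by (rule finite_measureI) (simp add: space_scalar_measure emeasure_scalar_measure)

text \<open>
  In the spectral picture \<open>\<alpha> u + \<beta> E B u\<close> is \<open>u\<close> multiplied by the function \<open>\<alpha> + \<beta> 1\<^sub>B\<close>.  This
  evaluates the polarized integrals in the definition of a spectral integral.
\<close>

lemma scalar_measure_combination:
  assumes B: "B \<in> sets borel"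
  shows "scalar_measure E (\<alpha> *\<^sub>R u + \<beta> *\<^sub>R E B u) =
    density (scalar_measure E u) (\<lambda>s. ennreal ((\<alpha> + \<beta> * indicator B s)\<^sup>2))"
    (is "?L = density ?M ?g")
proof (rule measure_eqI)
  show "sets ?L = sets (density ?M ?g)" by (simp add: sets_scalar_measure)
  fix A assume "A \<in> sets ?L"
  then have A: "A \<in> sets borel" by (simp add: sets_scalar_measure)
  note pr = pvm_proj[OF A] pvm_proj[OF B]
  have [measurable]: "A \<in> sets ?M" "B \<in> sets ?M" using A B by (auto simp: sets_scalar_measure)
  have "emeasure (density ?M ?g) A = (\<integral>\<^sup>+s. ?g s * indicator A s \<partial>?M)"
    by (rule emeasure_density) measurable
  also have "\<dots> = (\<integral>\<^sup>+s. ennreal (\<alpha>\<^sup>2) * indicator (A - B) s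
       + ennreal ((\<alpha> + \<beta>)\<^sup>2) * indicator (A \<inter> B) s \<partial>?M)"
    by (intro nn_integral_cong) (auto split: split_indicator)
  also have "\<dots> = ennreal (\<alpha>\<^sup>2) * emeasure ?M (A - B) + ennreal ((\<alpha> + \<beta>)\<^sup>2) * emeasure ?M (A \<inter> B)"
    by (subst nn_integral_add) (auto simp: nn_integral_cmult_indicator)
  also have "\<dots> = ennreal (\<alpha>\<^sup>2 * inner (E (A - B) u) u + (\<alpha> + \<beta>)\<^sup>2 * inner (E (A \<inter> B) u) u)"
    using A B by (simp add: emeasure_scalar_measure ennreal_mult[symmetric] ennreal_plus[symmetric]
        inner_orth_proj_self pvm_proj del: ennreal_plus)
  also have "\<alpha>\<^sup>2 * inner (E (A - B) u) u + (\<alpha> + \<beta>)\<^sup>2 * inner (E (A \<inter> B) u) u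
      = inner (E A (\<alpha> *\<^sub>R u + \<beta> *\<^sub>R E B u)) (\<alpha> *\<^sub>R u + \<beta> *\<^sub>R E B u)"
  proof -
    have 1: "inner (E A u) (E B u) = inner (E (A \<inter> B) u) u"
      "inner (E (A \<inter> B) u) (E B u) = inner (E (A \<inter> B) u) u"
      using A B by (simp_all add: is_orth_projD(3)[OF pvm_proj[OF B], symmetric] pvm_Int Int_commute Int_left_commute)
    have 2: "inner (E A u) u = inner (E (A - B) u) u + inner (E (A \<inter> B) u) u"
    proof -
      have "(A - B) \<inter> (A \<inter> B) = {}" "(A - B) \<union> (A \<inter> B) = A" by auto
      then show ?thesis using A B pvm_Un[of "A - B" "A \<inter> B" u] by (simp add: inner_add_left)
    qed
    show ?thesis
      using A B by (simp add: pvm_add pvm_scale pvm_Int inner_add 1 2 power2_eq_square algebra_simps)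
  qed
  finally show "emeasure ?L A = emeasure (density ?M ?g) A"
    using A by (simp add: emeasure_scalar_measure)
qed

text \<open>
  Eigenvectors are concentrated on their eigenvalue.  Testing \<open>\<integral> s dE u = c u\<close> against \<open>E B u\<close>
  gives \<open>\<integral>\<^sub>B (s - c) d\<mu>\<^sub>u = 0\<close> for every Borel set \<open>B\<close>; the two half-lines on
  either side of \<open>c\<close> are therefore null sets for \<open>\<mu>\<^sub>u\<close>.
\<close>

lemma pvm_eigenvector:
  assumes eig: "(u, c *\<^sub>R u) \<in> spectral_integral E (\<lambda>s. s)"
  shows "E {c} u = u"
proof -
  let ?M = "scalar_measure E u"
  interpret M: finite_measure ?M by (rule finite_measure_scalar_measure)
  have meas: "(\<lambda>s. s) \<in> borel_measurable ?M" by (rule measurable_scalar_measure) simp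
  have sq: "integrable ?M (\<lambda>s. s\<^sup>2)"
    using eig by (simp add: spectral_integral_def spectral_domain_def)
  have int: "integrable ?M (\<lambda>s. s)"
  proof (rule Bochner_Integration.integrable_bound)
    show "integrable ?M (\<lambda>s. 1 + s\<^sup>2)" using sq by simp
    have "\<bar>s\<bar> \<le> 1 + s\<^sup>2" for s :: real
      using sum_squares_bound[of "\<bar>s\<bar>" 1] zero_le_power2[of s] by simp
    then show "AE s in ?M. norm s \<le> norm (1 + s\<^sup>2)" by simp
  qed (rule meas)
  have zero: "(\<integral>s. indicator B s * (s - c) \<partial>?M) = 0" if B: "B \<in> sets borel" for B
  proof -
    have [measurable]: "B \<in> sets ?M" using B by (simp add: sets_scalar_measure)
    have iB: "integrable ?M (\<lambda>s. indicator B s * s)" "integrable ?M (\<lambda>s. indicator B s * s\<^sup>2)"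
      "integrable ?M (\<lambda>s. indicator B s * c)"
      using integrable_mult_indicator[OF _ int, of B] integrable_mult_indicator[OF _ sq, of B]
        integrable_mult_indicator[OF _ M.integrable_const, of B c] by (simp_all)
    have g: "(\<lambda>s. (\<alpha> + \<beta> * indicator B s)\<^sup>2) \<in> borel_measurable ?M" for \<alpha> \<beta> :: real by measurable
    have ig: "integrable ?M (\<lambda>s. (\<alpha> + \<beta> * indicator B s)\<^sup>2 *\<^sub>R s)" for \<alpha> \<beta> :: real
    proof -
      have "(\<lambda>s. (\<alpha> + \<beta> * indicator B s)\<^sup>2 *\<^sub>R s)
          = (\<lambda>s. \<alpha>\<^sup>2 * s + (2 * \<alpha> * \<beta> + \<beta>\<^sup>2) * (indicator B s * s))"
        by (auto simp: fun_eq_iff power2_eq_square algebra_simps split: split_indicator)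
      then show ?thesis using int iB by simp
    qed
    have "E B u \<in> spectral_domain E (\<lambda>s. s)"
    proof -
      have "integrable (density ?M (\<lambda>s. ennreal ((0 + 1 * indicator B s)\<^sup>2))) (\<lambda>s. s\<^sup>2)"
        using iB(2) measurable_scalar_measure[of "\<lambda>s. s\<^sup>2"] g[of 0 1]
        by (subst integrable_density) (auto simp: power2_eq_square indicator_inter_arith[symmetric] mult.assoc)
      then show ?thesis
        using scalar_measure_combination[OF B, of 0 u 1] by (simp add: spectral_domain_def)
    qed
    then have "inner (c *\<^sub>R u) (E B u) =
        ((\<integral>s. s \<partial>scalar_measure E (u + E B u)) - (\<integral>s. s \<partial>scalar_measure E (u - E B u))) / 4"
      using eig by (simp add: spectral_integral_def)
    also have "(\<integral>s. s \<partial>scalar_measure E (u + E B u)) = (\<integral>s. (1 + 1 * indicator B s)\<^sup>2 *\<^sub>R s \<partial>?M)"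
      using scalar_measure_combination[OF B, of 1 u 1] integral_density[OF meas g[of 1 1]] by simp
    also have "(\<integral>s. s \<partial>scalar_measure E (u - E B u)) = (\<integral>s. (1 + (-1) * indicator B s)\<^sup>2 *\<^sub>R s \<partial>?M)"
      using scalar_measure_combination[OF B, of 1 u "-1"] integral_density[OF meas g[of 1 "-1"]] by simp
    also have "(\<integral>s. (1 + 1 * indicator B s)\<^sup>2 *\<^sub>R s \<partial>?M) - (\<integral>s. (1 + (-1) * indicator B s)\<^sup>2 *\<^sub>R s \<partial>?M)
        = (\<integral>s. (1 + 1 * indicator B s)\<^sup>2 *\<^sub>R s - (1 + (-1) * indicator B s)\<^sup>2 *\<^sub>R s \<partial>?M)"
      by (rule Bochner_Integration.integral_diff[symmetric]; rule ig)
    also have "\<dots> = (\<integral>s. 4 * (indicator B s * s) \<partial>?M)"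
      by (rule Bochner_Integration.integral_cong) (auto simp: power2_eq_square split: split_indicator)
    also have "\<dots> / 4 = (\<integral>s. indicator B s * s \<partial>?M)" by simp
    also have "inner (c *\<^sub>R u) (E B u) = c * measure ?M B"
    proof -
      have "emeasure ?M B = ennreal (inner (E B u) u)" by (rule emeasure_scalar_measure[OF B])
      then have "measure ?M B = inner (E B u) u"
        using inner_orth_proj_self[OF pvm_proj[OF B], of u] by (simp add: measure_def)
      then show ?thesis by (simp add: inner_commute)
    qed
    finally have "(\<integral>s. indicator B s * s \<partial>?M) = (\<integral>s. indicator B s * c \<partial>?M)"
      by (simp add: mult.commute[of c])
    then show ?thesis using iB by (simp add: right_diff_distrib)
  qed
  have null: "E B u = 0" if B: "B \<in> sets borel" and pos: "(\<forall>s\<in>B. s > c) \<or> (\<forall>s\<in>B. s < c)" for B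
  proof -
    have [measurable]: "B \<in> sets ?M" using B by (simp add: sets_scalar_measure)
    have iB: "integrable ?M (\<lambda>s. indicator B s * (s - c))"
      using integrable_mult_indicator[of B ?M "\<lambda>s. s - c"] int by simp
    have "AE s in ?M. indicator B s * (s - c) = 0"
    proof (cases "\<forall>s\<in>B. s > c")
      case True
      then show ?thesis using zero[OF B] iB
        by (subst (asm) integral_nonneg_eq_0_iff_AE) (auto split: split_indicator intro!: AE_I2)
    next
      case False
      then have "\<forall>s\<in>B. s < c" using pos by blast
      then have "AE s in ?M. - (indicator B s * (s - c)) = 0" using zero[OF B] iB
        by (subst integral_nonneg_eq_0_iff_AE[symmetric]) (auto split: split_indicator intro!: AE_I2)
      then show ?thesis by simp
    qed
    then have "AE s in ?M. s \<notin> B"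
      by eventually_elim (use pos in \<open>auto split: split_indicator_asm\<close>)
    then have "emeasure ?M B = 0" by (subst (asm) AE_iff_measurable[of B]) (auto simp: space_scalar_measure)
    then have "inner (E B u) u = 0"
      using inner_orth_proj_self[OF pvm_proj[OF B], of u] emeasure_scalar_measure[OF B, of u] by simp
    then show ?thesis using inner_orth_proj_self[OF pvm_proj[OF B], of u] by simp
  qed
  have "{c} \<union> {..<c} \<union> {c<..} = (UNIV :: real set)" by auto
  then have "u = E ({c} \<union> {..<c} \<union> {c<..}) u" by (simp add: pvm_UNIV)
  also have "\<dots> = E ({c} \<union> {..<c}) u + E {c<..} u" by (rule pvm_Un) auto
  also have "E ({c} \<union> {..<c}) u = E {c} u + E {..<c} u" by (rule pvm_Un) auto
  also have "E {c} u + E {..<c} u + E {c<..} u = E {c} u" using null[of "{..<c}"] null[of "{c<..}"] by simp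
  finally show ?thesis ..
qed

end


section \<open>Functional calculus of a diagonal operator\<close>

context spectral_resolution
begin

definition diagonal_op :: "(nat \<Rightarrow> real) \<Rightarrow> 'h \<Rightarrow> 'h" where
  "diagonal_op c u = (\<Sum>n. c n *\<^sub>R E n u)"

context
  fixes c :: "nat \<Rightarrow> real" and M :: real
  assumes bounded: "\<And>n. \<bar>c n\<bar> \<le> M"
begin

lemma E_diagonal_op: "E n (diagonal_op c u) = c n *\<^sub>R E n u"
  unfolding diagonal_op_def
proof (intro E_suminf diagonal_summable)
  show "summable (\<lambda>n. (c n)\<^sup>2 * (norm (E n u))\<^sup>2)"
  proof (rule summable_comparison_test')
    show "summable (\<lambda>n. M\<^sup>2 * (norm (E n u))\<^sup>2)"
      by (rule summable_mult[OF sums_summable[OF norm_sums]])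
    show "norm ((c n)\<^sup>2 * (norm (E n u))\<^sup>2) \<le> M\<^sup>2 * (norm (E n u))\<^sup>2" for n
      using power_mono[OF bounded[of n], of 2] by (simp add: mult_right_mono)
  qed
qed

lemma diagonal_graph_eq_op: "(u, v) \<in> diagonal_graph E c \<longleftrightarrow> v = diagonal_op c u"
  using E_diagonal_op E_eqI[of v "diagonal_op c u"] by (auto simp: mem_diagonal_graph)

lemma diagonal_op_sums: "(\<lambda>n. c n * inner (E n u) (E n w)) sums inner (diagonal_op c u) w"
  using inner_sums[of "diagonal_op c u" w] by (simp add: E_diagonal_op)

lemma diagonal_op_sym: "inner (diagonal_op c u) w = inner u (diagonal_op c w)"
  using diagonal_op_sums[of u w] diagonal_op_sums[of w u]
  by (simp add: sums_iff inner_commute)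

lemma norm_diagonal_op_le: "norm (diagonal_op c u) \<le> M * norm u"
proof (rule power2_le_imp_le)
  have M: "0 \<le> M" using bounded[of 0] by linarith
  then show "0 \<le> M * norm u" by simp
  have "(norm (E n (diagonal_op c u)))\<^sup>2 \<le> M\<^sup>2 * (norm (E n u))\<^sup>2" for n
    using power_mono[OF bounded[of n], of 2] by (simp add: E_diagonal_op power_mult_distrib mult_right_mono)
  then have "(norm (diagonal_op c u))\<^sup>2 \<le> M\<^sup>2 * (norm u)\<^sup>2"
    by (rule sums_le[OF _ norm_sums sums_mult[OF norm_sums]])
  then show "(norm (diagonal_op c u))\<^sup>2 \<le> (M * norm u)\<^sup>2"
    by (simp add: power_mult_distrib)
qed

lemma bounded_linear_diagonal_op: "bounded_linear (diagonal_op c)"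
proof (rule bounded_linear_intro)
  show "diagonal_op c (u + v) = diagonal_op c u + diagonal_op c v" for u v
    by (rule E_eqI) (simp add: E_diagonal_op scaleR_add_right)
  show "diagonal_op c (r *\<^sub>R u) = r *\<^sub>R diagonal_op c u" for r u
    by (rule E_eqI) (simp add: E_diagonal_op)
  show "norm (diagonal_op c u) \<le> norm u * M" for u
    using norm_diagonal_op_le[of u] by (simp add: mult.commute)
qed

end

text \<open>
  The projection onto the closed sum of the eigenspaces with eigenvalue in \<open>B\<close>, that is, the
  spectral measure of \<open>\<Sum>n. a n E n\<close>.
\<close>

definition specproj :: "(nat \<Rightarrow> real) \<Rightarrow> real set \<Rightarrow> 'h \<Rightarrow> 'h" where
  "specproj a B = diagonal_op (\<lambda>n. indicator B (a n))"

lemma indicator_bounded: "\<bar>indicator B (a n) :: real\<bar> \<le> 1"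
  by (auto split: split_indicator)

lemma E_specproj: "E n (specproj a B u) = indicator B (a n) *\<^sub>R E n u"
  unfolding specproj_def by (rule E_diagonal_op[OF indicator_bounded])

lemma is_orth_proj_specproj: "is_orth_proj (specproj a B)"
proof (rule is_orth_projI)
  show "inner (specproj a B x) y = inner x (specproj a B y)" for x y
    unfolding specproj_def by (rule diagonal_op_sym[OF indicator_bounded])
qed (rule E_eqI, simp add: E_specproj scaleR_add_right indicator_inter_arith[symmetric] mult.commute)+

text \<open>
  For countable additivity, the vectors \<open>specproj a (A k) u\<close> are pairwise orthogonal with bounded
  square sums, so their series converges; its sum is then recognized from its components.
\<close>

lemma projection_valued_measure_specproj: "projection_valued_measure (specproj a)"
  unfolding projection_valued_measure_def
proof (intro conjI ballI allI impI)
  show "specproj a UNIV = id" by (rule ext, rule E_eqI) (simp add: E_specproj)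
  fix A :: "nat \<Rightarrow> real set" and u
  assume dis: "disjoint_family A"
  let ?x = "\<lambda>k. specproj a (A k) u"
  have at_most_one: "(\<lambda>k. indicator (A k) s) sums (indicator (\<Union>k. A k) s :: real)" for s
  proof (cases "\<exists>k. s \<in> A k")
    case True
    then obtain k where k: "s \<in> A k" by blast
    then have "indicator (A j) s = (if j = k then 1 else 0 :: real)" for j
      using dis by (auto simp: disjoint_family_on_def split: split_indicator)
    then show ?thesis using sums_single[of k "\<lambda>_. 1::real"] k by (auto simp: indicator_def)
  qed (auto simp: indicator_def)
  have orth: "orthogonal (?x k) (?x j)" if "k \<noteq> j" for k j
  proof -
    have "indicator (A k) (a n) * indicator (A j) (a n) = (0 :: real)" for n
      using dis that by (auto simp: disjoint_family_on_def split: split_indicator)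
    then have "E n (specproj a (A k) (?x j)) = E n 0" for n by (simp add: E_specproj)
    then have "specproj a (A k) (?x j) = 0" by (rule E_eqI)
    then show ?thesis
      by (simp add: orthogonal_def is_orth_projD(3)[OF is_orth_proj_specproj])
  qed
  have bd: "(\<Sum>k<n. (norm (?x k))\<^sup>2) \<le> (norm u)\<^sup>2" for n
  proof -
    have "sum ?x {..<n} = specproj a (\<Union>k<n. A k) u"
    proof (rule E_eqI)
      fix m
      have "(\<Sum>k<n. indicator (A k) (a m)) = (indicator (\<Union>k<n. A k) (a m) :: real)"
        using dis by (subst indicator_UN_disjoint) (auto simp: disjoint_family_on_def)
      then show "E m (sum ?x {..<n}) = E m (specproj a (\<Union>k<n. A k) u)"
        by (simp add: E_sum E_specproj scaleR_sum_left[symmetric])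
    qed
    moreover have "(norm (sum ?x {..<n}))\<^sup>2 = (\<Sum>k<n. (norm (?x k))\<^sup>2)"
      by (intro norm_sum_Pythagorean) (auto simp: pairwise_def orth)
    ultimately show ?thesis
      using norm_orth_proj_le[OF is_orth_proj_specproj] by (metis power_mono norm_ge_zero)
  qed
  have "summable (\<lambda>k. (norm (?x k))\<^sup>2)"
    by (rule summableI_nonneg_bounded[OF _ bd]) simp
  from summable_orthogonal[OF orth this] have sm: "summable ?x" by simp
  have "suminf ?x = specproj a (\<Union>k. A k) u"
  proof (rule E_eqI)
    fix m
    have "(\<lambda>k. E m (?x k)) sums E m (suminf ?x)"
      by (rule bounded_linear.sums[OF linear_E summable_sums[OF sm]])
    moreover have "(\<lambda>k. E m (?x k)) sums (indicator (\<Union>k. A k) (a m) *\<^sub>R E m u)"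
      unfolding E_specproj by (rule sums_scaleR_left[OF at_most_one])
    ultimately show "E m (suminf ?x) = E m (specproj a (\<Union>k. A k) u)"
      unfolding E_specproj by (rule sums_unique2)
  qed
  then show "?x sums specproj a (\<Union>k. A k) u" using summable_sums[OF sm] by simp
qed (rule is_orth_proj_specproj)

text \<open>
  Mass \<open>\<parallel>E n u\<parallel>\<^sup>2\<close> sits at \<open>a n\<close>.  The image measure takes care of coincidences among the \<open>a n\<close>
  and turns integrals into series over \<open>n\<close>.
\<close>

lemma scalar_measure_specproj:
  assumes F: "\<And>B. B \<in> sets borel \<Longrightarrow> F B = specproj a B"
  shows "scalar_measure F u = distr (density (count_space UNIV) (\<lambda>n. ennreal ((norm (E n u))\<^sup>2))) borel a"
    (is "_ = ?M")
proof -
  have "ennreal (inner (F B u) u) = emeasure ?M B" if "B \<in> sigma_sets UNIV (sets borel)" for B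
  proof -
    have B: "B \<in> sets borel" using that by (simp add: sets.sigma_sets_eq[of borel, simplified])
    have "emeasure ?M B = (\<integral>\<^sup>+n. ennreal ((norm (E n u))\<^sup>2) * indicator (a -` B) n \<partial>count_space UNIV)"
      using B by (simp add: emeasure_distr emeasure_density)
    also have "\<dots> = (\<Sum>n. ennreal ((norm (E n u))\<^sup>2) * indicator (a -` B) n)"
      by (rule nn_integral_count_space_nat)
    also have "\<dots> = (\<Sum>n. ennreal (indicator B (a n) * inner (E n u) (E n u)))"
      by (intro suminf_cong) (auto simp: power2_norm_eq_inner split: split_indicator)
    also have "\<dots> = ennreal (inner (F B u) u)"
      unfolding F[OF B] specproj_def
      by (rule suminf_ennreal_eq[OF _ diagonal_op_sums[OF indicator_bounded]]) (simp split: split_indicator)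
    finally show ?thesis ..
  qed
  then have "scalar_measure F u = measure_of UNIV (sets borel) (emeasure ?M)"
    unfolding scalar_measure_def by (intro measure_of_eq) auto
  also have "\<dots> = ?M" using measure_of_of_measure[of ?M] by simp
  finally show ?thesis .
qed

text \<open>
  The polarized integrals are the series \<open>\<Sum>n. \<phi> (a n) \<langle>E n u, E n w\<rangle>\<close>.  Since every \<open>E m x\<close> lies in
  the domain, they determine all components of \<open>v\<close>.
\<close>

lemma spectral_integral_specproj:
  assumes F: "\<And>B. B \<in> sets borel \<Longrightarrow> F B = specproj a B"
    and \<phi>: "\<phi> \<in> borel_measurable borel"
  shows "spectral_integral F \<phi> = diagonal_graph E (\<lambda>n. \<phi> (a n))"
proof -
  have sm: "scalar_measure F u = distr (density (count_space UNIV) (\<lambda>n. ennreal ((norm (E n u))\<^sup>2))) borel a" for u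
    by (rule scalar_measure_specproj[OF F])
  have int: "integrable (scalar_measure F u) \<psi> \<longleftrightarrow> summable (\<lambda>n. (norm (E n u))\<^sup>2 * \<bar>\<psi> (a n)\<bar>)"
    if "\<psi> \<in> borel_measurable borel" for \<psi> :: "real \<Rightarrow> real" and u
    using that unfolding sm
    by (subst integrable_distr_eq) (auto simp: integrable_density integrable_count_space_nat_iff abs_mult)
  have intg: "(\<integral>s. \<psi> s \<partial>scalar_measure F u) = (\<Sum>n. (norm (E n u))\<^sup>2 * \<psi> (a n))"
    if "\<psi> \<in> borel_measurable borel" "summable (\<lambda>n. (norm (E n u))\<^sup>2 * \<bar>\<psi> (a n)\<bar>)"
    for \<psi> :: "real \<Rightarrow> real" and u
    using that unfolding sm
    by (subst integral_distr) (auto simp: integral_density integral_count_space_nat integrable_count_space_nat_iff abs_mult)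
  have dom: "u \<in> spectral_domain F \<phi> \<longleftrightarrow> summable (\<lambda>n. (\<phi> (a n))\<^sup>2 * (norm (E n u))\<^sup>2)" for u
    using \<phi> by (simp add: spectral_domain_def int mult.commute)
  have dom': "u \<in> spectral_domain F \<phi> \<longleftrightarrow> u \<in> Domain (diagonal_graph E (\<lambda>n. \<phi> (a n)))" for u
    by (simp add: dom Domain_diagonal_graph)
  have sub: "u + w \<in> spectral_domain F \<phi>" "u - w \<in> spectral_domain F \<phi>"
    if uw: "u \<in> spectral_domain F \<phi>" "w \<in> spectral_domain F \<phi>" for u w
  proof -
    obtain x y where xy: "(u, x) \<in> diagonal_graph E (\<lambda>n. \<phi> (a n))" "(w, y) \<in> diagonal_graph E (\<lambda>n. \<phi> (a n))"
      using uw unfolding dom' by blast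
    then have "(u + w, x + y) \<in> diagonal_graph E (\<lambda>n. \<phi> (a n))" "(u - w, x - y) \<in> diagonal_graph E (\<lambda>n. \<phi> (a n))"
      by (auto simp: mem_diagonal_graph algebra_simps)
    then show "u + w \<in> spectral_domain F \<phi>" "u - w \<in> spectral_domain F \<phi>" unfolding dom' by blast+
  qed
  have s1: "summable (\<lambda>n. (norm (E n u))\<^sup>2 * \<bar>\<phi> (a n)\<bar>)" if "u \<in> spectral_domain F \<phi>" for u
  proof (rule summable_comparison_test')
    show "summable (\<lambda>n. (norm (E n u))\<^sup>2 + (\<phi> (a n))\<^sup>2 * (norm (E n u))\<^sup>2)"
      using that sums_summable[OF norm_sums[of u]] by (intro summable_add) (simp_all add: dom)
    have "\<bar>r\<bar> \<le> 1 + r\<^sup>2" for r :: real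
      using sum_squares_bound[of "\<bar>r\<bar>" 1] zero_le_power2[of r] by simp
    from mult_left_mono[OF this, of "(norm (E n u))\<^sup>2" for n]
    show "norm ((norm (E n u))\<^sup>2 * \<bar>\<phi> (a n)\<bar>) \<le> (norm (E n u))\<^sup>2 + (\<phi> (a n))\<^sup>2 * (norm (E n u))\<^sup>2" for n
      by (simp add: abs_mult algebra_simps)
  qed
  have polar: "(\<lambda>n. \<phi> (a n) * inner (E n u) (E n w)) sums
      (((\<integral>s. \<phi> s \<partial>scalar_measure F (u + w)) - (\<integral>s. \<phi> s \<partial>scalar_measure F (u - w))) / 4)"
    if "u \<in> spectral_domain F \<phi>" "w \<in> spectral_domain F \<phi>" for u w
  proof -
    have s: "(\<lambda>n. (norm (E n z))\<^sup>2 * \<phi> (a n)) sums (\<integral>s. \<phi> s \<partial>scalar_measure F z)" if "z \<in> spectral_domain F \<phi>" for z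
    proof -
      have "summable (\<lambda>n. (norm (E n z))\<^sup>2 * \<phi> (a n))"
        using s1[OF that] by (intro summable_rabs_cancel[of "\<lambda>n. (norm (E n z))\<^sup>2 * \<phi> (a n)"]) (simp add: abs_mult)
      then show ?thesis unfolding intg[OF \<phi> s1[OF that]] by (rule summable_sums)
    qed
    have "(norm (x + y))\<^sup>2 * r - (norm (x - y))\<^sup>2 * r = r * inner x y * 4" for x y :: 'h and r :: real
      by (simp add: power2_norm_eq_inner inner_add inner_diff inner_commute algebra_simps)
    then have "((norm (E n (u + w)))\<^sup>2 * \<phi> (a n) - (norm (E n (u - w)))\<^sup>2 * \<phi> (a n)) / 4
        = \<phi> (a n) * inner (E n u) (E n w)" for n by simp
    then show ?thesis
      using sums_divide[OF sums_diff[OF s s], of "u + w" "u - w" 4] sub[OF that] by simp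
  qed
  have "(u, v) \<in> spectral_integral F \<phi> \<longleftrightarrow> (u, v) \<in> diagonal_graph E (\<lambda>n. \<phi> (a n))" for u v
  proof
    assume uv: "(u, v) \<in> spectral_integral F \<phi>"
    then have u: "u \<in> spectral_domain F \<phi>" by (simp add: spectral_integral_def)
    show "(u, v) \<in> diagonal_graph E (\<lambda>n. \<phi> (a n))"
      unfolding mem_diagonal_graph
    proof
      fix m
      have "inner (E m v - \<phi> (a m) *\<^sub>R E m u) x = 0" for x
      proof -
        have w: "E m x \<in> spectral_domain F \<phi>"
          unfolding dom' using diagonal_graph_E by blast
        have "(\<lambda>n. \<phi> (a n) * inner (E n u) (E n (E m x))) sums inner v (E m x)"
        proof -
          have "inner v (E m x) = ((\<integral>s. \<phi> s \<partial>scalar_measure F (u + E m x)) - (\<integral>s. \<phi> s \<partial>scalar_measure F (u - E m x))) / 4"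
            using uv w unfolding spectral_integral_def by blast
          then show ?thesis using polar[OF u w] by (simp only:)
        qed
        moreover have "(\<lambda>n. \<phi> (a n) * inner (E n u) (E n (E m x))) =
            (\<lambda>n. if n = m then \<phi> (a m) * inner (E m u) (E m x) else 0)"
          by (auto simp: E_E fun_eq_iff)
        ultimately have "inner v (E m x) = \<phi> (a m) * inner (E m u) (E m x)"
          using sums_single[of m "\<lambda>_. \<phi> (a m) * inner (E m u) (E m x)"] by (auto intro: sums_unique2)
        then show ?thesis by (simp add: inner_diff_left E_sym[of m v] inner_E_both)
      qed
      from this[of "E m v - \<phi> (a m) *\<^sub>R E m u"] show "E m v = \<phi> (a m) *\<^sub>R E m u" by simp
    qed
  next
    assume uv: "(u, v) \<in> diagonal_graph E (\<lambda>n. \<phi> (a n))"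
    then have u: "u \<in> spectral_domain F \<phi>" unfolding dom' by blast
    have "inner v w = ((\<integral>s. \<phi> s \<partial>scalar_measure F (u + w)) - (\<integral>s. \<phi> s \<partial>scalar_measure F (u - w))) / 4"
      if "w \<in> spectral_domain F \<phi>" for w
      using sums_unique2[OF inner_sums[of v w]] polar[OF u that] uv by (simp add: mem_diagonal_graph)
    then show "(u, v) \<in> spectral_integral F \<phi>" using u by (simp add: spectral_integral_def)
  qed
  then show ?thesis by auto
qed

lemma spectral_measure_diagonal: "is_spectral_measure (diagonal_graph E a) (specproj a)"
  by (simp add: is_spectral_measure_def projection_valued_measure_specproj
      spectral_integral_specproj[of "specproj a" a "\<lambda>s. s"])

text \<open>
  Every spectral measure \<open>F\<close> of the operator fixes the eigenvectors by \<open>F {a n}\<close>, hence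
  \<open>F B\<close> keeps \<open>E n u\<close> when \<open>a n \<in> B\<close> and kills it otherwise.
\<close>

lemma spectral_measure_diagonal_unique:
  assumes F: "is_spectral_measure (diagonal_graph E a) F" and B: "B \<in> sets borel"
  shows "F B = specproj a B"
proof (rule ext)
  fix u
  have pvm: "projection_valued_measure F" and SI: "spectral_integral F (\<lambda>s. s) = diagonal_graph E a"
    using F by (auto simp: is_spectral_measure_def)
  have eig: "F {a n} (E n u) = E n u" for n
    by (rule pvm_eigenvector[OF pvm]) (simp add: SI diagonal_graph_E)
  have FE: "F B (E n u) = indicator B (a n) *\<^sub>R E n u" for n
  proof -
    have "F B (E n u) = F B (F {a n} (E n u))" by (simp only: eig)
    also have "\<dots> = F (B \<inter> {a n}) (E n u)" using B by (simp add: pvm_Int[OF pvm])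
    also have "\<dots> = indicator B (a n) *\<^sub>R E n u"
      by (cases "a n \<in> B") (simp_all add: eig pvm_empty[OF pvm])
    finally show ?thesis .
  qed
  have "(\<lambda>n. F B (E n u)) sums F B u"
    by (rule bounded_linear.sums[OF is_orth_projD(1)[OF pvm_proj[OF pvm B]] complete])
  then show "F B u = specproj a B u"
    by (simp add: FE specproj_def diagonal_op_def sums_iff)
qed

theorem functional_calculus_diagonal:
  assumes \<phi>: "\<phi> \<in> borel_measurable borel" and bounded: "\<And>n. \<bar>\<phi> (a n)\<bar> \<le> M"
  shows "functional_calculus (diagonal_graph E a) \<phi> = diagonal_op (\<lambda>n. \<phi> (a n))"
proof (rule ext)
  fix u
  have *: "(u, v) \<in> spectral_integral F \<phi> \<longleftrightarrow> v = diagonal_op (\<lambda>n. \<phi> (a n)) u"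
    if "is_spectral_measure (diagonal_graph E a) F" for F v
    using spectral_integral_specproj[OF spectral_measure_diagonal_unique[OF that] \<phi>]
      diagonal_graph_eq_op[OF bounded] by simp
  show "functional_calculus (diagonal_graph E a) \<phi> u = diagonal_op (\<lambda>n. \<phi> (a n)) u"
    unfolding functional_calculus_def
    by (rule the_equality) (use * spectral_measure_diagonal in blast)+
qed

end


section \<open>Compactness\<close>

lemma compact_cube:
  fixes G :: "'h::real_normed_vector set"
  assumes "finite G"
  shows "compact {\<Sum>g\<in>G. c g *\<^sub>R g | c. \<forall>g\<in>G. \<bar>c g\<bar> \<le> 1}"
  using assms
proof (induction G rule: finite_induct)
  case empty
  then show ?case by simp
next
  case (insert h G)
  let ?K = "{\<Sum>g\<in>G. c g *\<^sub>R g | c. \<forall>g\<in>G. \<bar>c g\<bar> \<le> 1}"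
  have "{\<Sum>g\<in>insert h G. c g *\<^sub>R g | c. \<forall>g\<in>insert h G. \<bar>c g\<bar> \<le> 1}
      = (\<lambda>(r, x). r *\<^sub>R h + x) ` ({-1..1} \<times> ?K)" (is "?L = ?R")
  proof
    show "?L \<subseteq> ?R" using insert.hyps by (auto simp: image_iff abs_le_iff)
    show "?R \<subseteq> ?L"
    proof clarify
      fix r :: real and c :: "'h \<Rightarrow> real"
      assume "r \<in> {-1..1}" "\<forall>g\<in>G. \<bar>c g\<bar> \<le> 1"
      moreover have "(\<Sum>g\<in>G. (c(h := r)) g *\<^sub>R g) = (\<Sum>g\<in>G. c g *\<^sub>R g)"
        using insert.hyps by (intro sum.cong) auto
      ultimately show "\<exists>c'. r *\<^sub>R h + (\<Sum>g\<in>G. c g *\<^sub>R g) = (\<Sum>g\<in>insert h G. c' g *\<^sub>R g)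
          \<and> (\<forall>g\<in>insert h G. \<bar>c' g\<bar> \<le> 1)"
        using insert.hyps by (intro exI[of _ "c(h := r)"]) (auto simp: abs_le_iff)
    qed
  qed
  also have "compact \<dots>"
    by (intro compact_continuous_image compact_Times insert.IH compact_Icc)
       (auto simp: case_prod_unfold intro!: continuous_intros)
  finally show ?case .
qed

lemma compact_closure_approx:
  fixes S :: "'h::complete_space set"
  assumes approx: "\<And>\<epsilon>. \<epsilon> > 0 \<Longrightarrow> \<exists>K. compact K \<and> (\<forall>x\<in>S. \<exists>y\<in>K. dist x y \<le> \<epsilon>)"
  shows "compact (closure S)"
  unfolding compact_eq_totally_bounded complete_eq_closed
proof (intro conjI allI impI)
  show "closed (closure S)" by simp
  fix \<epsilon> :: real assume "\<epsilon> > 0"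
  then obtain K where K: "compact K" "\<And>x. x \<in> S \<Longrightarrow> \<exists>y\<in>K. dist x y \<le> \<epsilon> / 4"
    using approx[of "\<epsilon> / 4"] by auto
  obtain k where k: "finite k" "K \<subseteq> (\<Union>y\<in>k. ball y (\<epsilon> / 4))"
    using K(1) \<open>\<epsilon> > 0\<close> unfolding compact_eq_totally_bounded by (meson divide_pos_pos zero_less_numeral)
  have "closure S \<subseteq> (\<Union>y\<in>k. ball y \<epsilon>)"
  proof
    fix x assume "x \<in> closure S"
    then obtain s where s: "s \<in> S" "dist s x < \<epsilon> / 4"
      using \<open>\<epsilon> > 0\<close> unfolding closure_approachable by (meson divide_pos_pos zero_less_numeral)
    obtain z where z: "z \<in> K" "dist s z \<le> \<epsilon> / 4" using K(2)[OF s(1)] by blast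
    then obtain y where y: "y \<in> k" "dist y z < \<epsilon> / 4" using k(2) by auto
    have "dist y x \<le> dist y z + dist z s + dist s x"
      by (meson dist_triangle dist_triangle_le order.trans add_mono order_refl)
    also have "\<dots> < \<epsilon>" using s z y \<open>\<epsilon> > 0\<close> by (simp add: dist_commute)
    finally show "x \<in> (\<Union>y\<in>k. ball y \<epsilon>)" using y by auto
  qed
  then show "\<exists>k. finite k \<and> closure S \<subseteq> (\<Union>x\<in>k. ball x \<epsilon>)" using k(1) by blast
qed

text \<open>
  A resolution with finite-dimensional blocks; the cylinder functions of length \<open>n\<close> will span
  all blocks below \<open>n\<close>.
\<close>

locale finite_rank_resolution = spectral_resolution +
  fixes G :: "nat \<Rightarrow> 'a set"
  assumes finite_G: "finite (G n)" and orthonormal_G: "orthonormal (G n)"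
    and range_E: "k < n \<Longrightarrow> range (E k) \<subseteq> span (G n)"
begin

text \<open>
  Cutting the series off at \<open>n\<close> changes the operator by at most \<open>sup {\<bar>c k\<bar> | k \<ge> n}\<close> in norm, and the
  truncated operator maps the unit ball into a compact cube over the basis \<open>G n\<close>.
\<close>

lemma compact_operator_diagonal_op:
  assumes c1: "\<And>n. \<bar>c n\<bar> \<le> 1" and c0: "c \<longlonglongrightarrow> 0"
  shows "compact_operator (diagonal_op c)"
  unfolding compact_operator_def
proof
  show "linear (diagonal_op c)"
    by (rule bounded_linear.linear[OF bounded_linear_diagonal_op[OF c1]])
  show "compact (closure (diagonal_op c ` cball 0 1))"
  proof (rule compact_closure_approx)
    fix \<epsilon> :: real assume "\<epsilon> > 0"
    then obtain n where n: "\<And>k. k \<ge> n \<Longrightarrow> \<bar>c k\<bar> < \<epsilon>"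
      using LIMSEQ_D[OF c0 \<open>\<epsilon> > 0\<close>] by auto
    let ?lo = "\<lambda>k. if k < n then c k else 0" and ?hi = "\<lambda>k. if k < n then 0 else c k"
    let ?K = "{\<Sum>g\<in>G n. c g *\<^sub>R g | c. \<forall>g\<in>G n. \<bar>c g\<bar> \<le> 1}"
    have lo1: "\<bar>?lo k\<bar> \<le> 1" and hi: "\<bar>?hi k\<bar> \<le> \<epsilon>" for k
      using c1[of k] n[of k] \<open>\<epsilon> > 0\<close> by (auto simp: not_less)
    have "\<exists>y\<in>?K. dist (diagonal_op c u) y \<le> \<epsilon>" if u: "norm u \<le> 1" for u
    proof
      let ?y = "diagonal_op ?lo u"
      have "?y = (\<Sum>k<n. ?lo k *\<^sub>R E k u)"
        unfolding diagonal_op_def by (rule suminf_finite) auto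
      also have "\<dots> \<in> span (G n)"
        using range_E by (intro span_sum span_scale) blast
      finally have "?y \<in> span (G n)" .
      then have y: "?y = (\<Sum>g\<in>G n. inner ?y g *\<^sub>R g)"
        using fourier_span[OF finite_G orthonormal_G] by (metis fourier_def)
      have "norm ?y \<le> 1" using norm_diagonal_op_le[where c="?lo" and u=u, OF lo1] u by simp
      moreover have "norm g = 1" if "g \<in> G n" for g using that orthonormal_G by (auto simp: orthonormal_def)
      ultimately have "\<bar>inner ?y g\<bar> \<le> 1" if "g \<in> G n" for g
        using Cauchy_Schwarz_ineq2[of ?y g] that by simp
      then show "?y \<in> ?K" using y by (intro CollectI exI[of _ "inner ?y"]) simp
      have "diagonal_op c u - ?y = diagonal_op ?hi u"
        by (rule E_eqI) (simp add: E_diagonal_op[OF c1] E_diagonal_op[OF lo1] E_diagonal_op[OF hi])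
      also have "norm \<dots> \<le> \<epsilon> * norm u" by (rule norm_diagonal_op_le[OF hi])
      also have "\<dots> \<le> \<epsilon>" using u \<open>\<epsilon> > 0\<close> by (simp add: mult_left_le)
      finally show "dist (diagonal_op c u) ?y \<le> \<epsilon>" by (simp add: dist_norm)
    qed
    then show "\<exists>K. compact K \<and> (\<forall>x\<in>diagonal_op c ` cball 0 1. \<exists>y\<in>K. dist x y \<le> \<epsilon>)"
      by (intro exI[of _ ?K] conjI compact_cube finite_G) auto
  qed
qed


section \<open>Trace class\<close>

lemma finite_orthonormal_range:
  "\<exists>B. finite B \<and> orthonormal B \<and> span B = range (E n)"
proof -
  have "E n ` span (G (Suc n)) = range (E n)"
  proof
    show "range (E n) \<subseteq> E n ` span (G (Suc n))"
      using range_E[of n "Suc n"] by (smt (verit, best) E_E image_iff lessI range_subsetD subsetI rangeE)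
  qed auto
  then have "range (E n) = span (E n ` G (Suc n))"
    by (simp add: linear_span_image[OF bounded_linear.linear[OF linear_E]])
  moreover obtain C where C: "finite C" "span C = span (E n ` G (Suc n))" "pairwise orthogonal C"
    using basis_orthogonal[of "E n ` G (Suc n)"] finite_G by blast
  let ?B = "(\<lambda>x. inverse (norm x) *\<^sub>R x) ` (C - {0})"
  have "span ?B = span (C - {0})"
    by (rule span_image_scale) (use C in auto)
  moreover have "span (C - {0}) = span C"
    by (metis span_delete_0)
  moreover have "orthonormal ?B"
    using C(3) by (auto simp: orthonormal_def pairwise_def orthogonal_def)
  ultimately show ?thesis using C by (intro exI[of _ ?B]) auto
qed

lemma orthonormal_basis_exists: "\<exists>B :: 'a set. orthonormal_basis B"
proof -
  obtain B where B: "\<And>n. orthonormal (B n)" "\<And>n. span (B n) = range (E n)"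
    using finite_orthonormal_range by metis
  have sub: "e \<in> range (E n)" if "e \<in> B n" for e n
    using that B(2)[of n] span_base by blast
  have "orthogonal e f" if "e \<in> B m" "f \<in> B n" "e \<noteq> f" for e f m n
  proof (cases "m = n")
    case True then show ?thesis using B(1)[of n] that by (auto simp: orthonormal_def pairwise_def)
  next
    case False then show ?thesis using sub[OF that(1)] sub[OF that(2)] by (auto simp: orthogonal_def orthogonal_E)
  qed
  moreover have "norm e = 1" if "e \<in> B n" for e n using that B(1)[of n] by (auto simp: orthonormal_def)
  moreover have "closure (span (\<Union>n. B n)) = UNIV"
  proof -
    have "range (E n) \<subseteq> span (\<Union>n. B n)" for n
      unfolding B(2)[symmetric] by (intro span_mono) auto
    then have "span (\<Union>n. range (E n)) \<subseteq> span (\<Union>n. B n)"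
      by (intro span_minimal subspace_span) auto
    from closure_mono[OF this] show ?thesis
      using orthogonal_direct_sum_E by (auto simp: orthogonal_direct_sum_def)
  qed
  ultimately have "orthonormal_basis (\<Union>n. B n)"
    unfolding orthonormal_basis_def pairwise_def by blast
  then show ?thesis ..
qed

text \<open>
  Summing \<open>\<langle>T e, e\<rangle> = \<Sum>n. c n \<parallel>E n e\<parallel>\<^sup>2\<close> over any orthonormal basis and exchanging the sums gives
  \<open>\<Sum>n. c n d n\<close>, where \<open>d n\<close> is the rank of \<open>E n\<close>.

  For the forward direction the absolute value \<open>S\<close> has to be identified: on \<open>range (E n)\<close> the vector
  \<open>y = S x - c n x\<close> satisfies \<open>S y = - c n y\<close>, which positivity of \<open>S\<close> only allows for \<open>y = 0\<close>.
\<close>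

theorem trace_class_diagonal_op:
  assumes c: "\<And>n. 0 < c n" "\<And>n. c n \<le> 1"
    and dim: "\<And>B n. orthonormal_basis B \<Longrightarrow> ((\<lambda>e. (norm (E n e))\<^sup>2) has_sum d n) B"
  shows "trace_class (diagonal_op c) \<longleftrightarrow> summable (\<lambda>n. c n * d n)"
proof -
  let ?T = "diagonal_op c"
  have c1: "\<bar>c n\<bar> \<le> 1" for n using c[of n] by simp
  have adj: "adjoint ?T = ?T"
    by (rule adjoint_unique) (simp add: diagonal_op_sym[OF c1])
  have Tsum: "(\<lambda>n. c n * (norm (E n e))\<^sup>2) sums inner (?T e) e" for e
    using diagonal_op_sums[where c=c and u=e and w=e, OF c1] by (simp add: power2_norm_eq_inner)
  have Tpos: "0 \<le> inner (?T e) e" for e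
    using c(1) Tsum[of e] by (intro sums_le[OF _ sums_zero Tsum]) (simp add: less_imp_le)
  obtain B0 :: "'a set" where B0: "orthonormal_basis B0" using orthonormal_basis_exists by blast
  have d0: "0 \<le> d n" for n by (rule has_sum_nonneg[OF dim[OF B0]]) simp
  show ?thesis
  proof
    assume "trace_class ?T"
    then obtain S B where S: "positive_operator S" "S \<circ> S = ?T \<circ> ?T"
      and B: "orthonormal_basis B" and sm: "(\<lambda>e. inner (S e) e) summable_on B"
      unfolding trace_class_def adj by blast
    have lin: "bounded_linear S" using S by (simp add: positive_operator_def)
    have SE: "S (E n u) = c n *\<^sub>R E n u" for n u
    proof -
      let ?x = "E n u" and ?y = "S (E n u) - c n *\<^sub>R E n u"
      have TE: "?T ?x = c n *\<^sub>R ?x"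
        using diagonal_graph_E[of n u "c n *\<^sub>R ?x" c] diagonal_graph_eq_op[where c=c, OF c1] by simp
      have "S (S ?x) = ?T (?T ?x)" using fun_cong[OF S(2), of ?x] by simp
      also have "\<dots> = c n *\<^sub>R c n *\<^sub>R ?x"
        by (simp only: TE linear_simps(5)[OF bounded_linear_diagonal_op[where c=c, OF c1]])
      finally have SS: "S (S ?x) = c n *\<^sub>R c n *\<^sub>R ?x" .
      have "S ?y = S (S ?x) - c n *\<^sub>R S ?x"
        by (simp only: linear_simps(2,5)[OF lin])
      \<comment> \<open>That is, \<open>(S + c n) (S - c n) = 0\<close> on the range of \<open>E n\<close>.\<close>
      then have "S ?y = - c n *\<^sub>R ?y"
        unfolding SS by (simp add: scaleR_diff_right)
      then have "inner (S ?y) ?y = - c n * (norm ?y)\<^sup>2" by (simp add: power2_norm_eq_inner)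
      moreover have "0 \<le> inner (S ?y) ?y" using S(1) unfolding positive_operator_def by blast
      ultimately have "c n * (norm ?y)\<^sup>2 \<le> 0" by simp
      then have "?y = 0" using c(1)[of n] by (simp add: mult_le_0_iff)
      then show ?thesis by simp
    qed
    have "S u = ?T u" for u
      using bounded_linear.sums[OF lin complete[of u]] by (simp add: SE diagonal_op_def sums_iff)
    then have hs: "((\<lambda>e. inner (?T e) e) has_sum infsum (\<lambda>e. inner (?T e) e) B) B"
      using sm by simp
    show "summable (\<lambda>n. c n * d n)"
    proof (rule summableI_nonneg_bounded)
      show "0 \<le> c n * d n" for n using c(1)[of n] d0[of n] by simp
      show "(\<Sum>n<m. c n * d n) \<le> infsum (\<lambda>e. inner (?T e) e) B" for m
      proof (rule has_sum_mono[OF _ hs])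
        show "((\<lambda>e. \<Sum>n<m. c n * (norm (E n e))\<^sup>2) has_sum (\<Sum>n<m. c n * d n)) B"
          by (intro has_sum_finite_sum has_sum_cmult_right dim B) simp
        show "(\<Sum>n<m. c n * (norm (E n e))\<^sup>2) \<le> inner (?T e) e" for e
          using sum_le_suminf[OF sums_summable[OF Tsum[of e]], of "{..<m}"] c(1) sums_unique[OF Tsum[of e]]
          by (simp add: less_imp_le)
      qed
    qed
  next
    assume sm: "summable (\<lambda>n. c n * d n)"
    have "(\<Sum>e\<in>F. inner (?T e) e) \<le> (\<Sum>n. c n * d n)" if F: "finite F" "F \<subseteq> B0" for F
    proof (rule sums_le[OF _ _ summable_sums[OF sm]])
      show "(\<lambda>n. \<Sum>e\<in>F. c n * (norm (E n e))\<^sup>2) sums (\<Sum>e\<in>F. inner (?T e) e)"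
        by (intro sums_sum Tsum)
      have "(\<Sum>e\<in>F. (norm (E n e))\<^sup>2) \<le> d n" for n
        by (rule finite_sum_le_has_sum[OF dim[OF B0] F]) simp
      then show "(\<Sum>e\<in>F. c n * (norm (E n e))\<^sup>2) \<le> c n * d n" for n
        using c(1)[of n] by (simp add: sum_distrib_left[symmetric])
    qed
    then have "(\<lambda>e. inner (?T e) e) summable_on B0"
      using Tpos by (intro nonneg_bounded_partial_sums_imp_summable_on[where C="\<Sum>n. c n * d n"])
        (auto simp: eventually_finite_subsets_at_top)
    moreover have "positive_operator ?T"
      using Tpos bounded_linear_diagonal_op[OF c1] diagonal_op_sym[OF c1] by (simp add: positive_operator_def)
    ultimately show "trace_class ?T"
      unfolding trace_class_def adj using bounded_linear_diagonal_op[where c=c, OF c1] B0 by blast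
  qed
qed

end


section \<open>Cylinder functions\<close>

lemma l2_rel_refl: "square_integrable f \<Longrightarrow> l2_rel f f"
  by (simp add: l2_rel_def)

lemma inner_abs_l2:
  "square_integrable f \<Longrightarrow> square_integrable g \<Longrightarrow> inner (abs_l2 f) (abs_l2 g) = (\<integral>x. f x * g x \<partial>bernoulli)"
  by (simp add: inner_l2.abs_eq l2_rel_refl)

lemma abs_l2_add: "square_integrable f \<Longrightarrow> square_integrable g \<Longrightarrow> abs_l2 (\<lambda>x. f x + g x) = abs_l2 f + abs_l2 g"
  and abs_l2_diff: "square_integrable f \<Longrightarrow> square_integrable g \<Longrightarrow> abs_l2 (\<lambda>x. f x - g x) = abs_l2 f - abs_l2 g"
  and abs_l2_scale: "square_integrable f \<Longrightarrow> abs_l2 (\<lambda>x. c * f x) = c *\<^sub>R abs_l2 f"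
  by (simp_all add: plus_l2.abs_eq minus_l2.abs_eq scaleR_l2.abs_eq l2_rel_refl)

lemma abs_l2_zero: "abs_l2 (\<lambda>_. 0) = 0"
  by (simp add: zero_l2_def)

definition words :: "nat \<Rightarrow> 'a::finite list set" where
  "words n = {w. length w = n}"

definition cyl :: "'a::finite list \<Rightarrow> 'a l2" where
  "cyl w = abs_l2 (indicator (cylinder w))"

text \<open>
  The factor \<open>N\<^bsup>n/2\<^esup>\<close> normalizes, since a cylinder of length \<open>n\<close> has measure \<open>N\<^bsup>-n\<^esup>\<close>.
\<close>

definition cyl_onb :: "nat \<Rightarrow> 'a::finite l2 set" where
  "cyl_onb n = (\<lambda>w. sqrt (real CARD('a) ^ n) *\<^sub>R cyl w) ` words n"

definition cyl_proj :: "nat \<Rightarrow> 'a::finite l2 \<Rightarrow> 'a l2" where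
  "cyl_proj n = fourier (cyl_onb n)"

lemma finite_words: "finite (words n :: 'a::finite list set)"
  using finite_lists_length_eq[of "UNIV :: 'a set" n] by (simp add: words_def)

lemma card_words: "card (words n :: 'a::finite list set) = CARD('a) ^ n"
  using card_lists_length_eq[of "UNIV :: 'a set" n] by (simp add: words_def)

lemma mem_cylinder: "x \<in> cylinder w \<longleftrightarrow> map x [0..<length w] = w"
  unfolding cylinder_def by (subst list_eq_iff_nth_eq) auto

lemma indicator_cylinder_words:
  assumes "w \<in> words n"
  shows "indicator (cylinder w) x = (if w = map x [0..<n] then 1 else 0)"
  using assms by (auto simp: indicator_def mem_cylinder words_def)

lemma prefix_in_words: "map x [0..<n] \<in> words n"
  by (simp add: words_def)

lemma inner_cyl:
  assumes "v \<in> words n" "w \<in> words n"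
  shows "inner (cyl v) (cyl w :: 'a::finite l2) = (if v = w then 1 / real CARD('a) ^ n else 0)"
proof -
  have "inner (cyl v) (cyl w) = (\<integral>x. indicator (cylinder v) x * indicator (cylinder w) x \<partial>bernoulli)"
    unfolding cyl_def by (rule inner_abs_l2) auto
  also have "\<dots> = (\<integral>x. (if v = w then indicator (cylinder w) x else 0) \<partial>bernoulli)"
    using assms by (intro Bochner_Integration.integral_cong) (auto simp: indicator_cylinder_words)
  also have "\<dots> = (if v = w then 1 / real CARD('a) ^ n else 0)"
    using assms by (simp add: measure_cylinder words_def)
  finally show ?thesis .
qed

lemma inj_on_cyl: "inj_on (\<lambda>w. sqrt (real CARD('a) ^ n) *\<^sub>R cyl w :: 'a l2) (words n :: 'a::finite list set)"
proof (rule inj_onI)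
  fix v w :: "'a list"
  assume vw: "v \<in> words n" "w \<in> words n" and "sqrt (real CARD('a) ^ n) *\<^sub>R cyl v = sqrt (real CARD('a) ^ n) *\<^sub>R cyl w"
  then have "cyl v = cyl w" by simp
  then have "inner (cyl v) (cyl v) = inner (cyl v) (cyl w)" by simp
  then show "v = w" using vw by (simp add: inner_cyl split: if_splits)
qed

lemma finite_cyl_onb: "finite (cyl_onb n)"
  by (simp add: cyl_onb_def finite_words)

lemma card_cyl_onb: "card (cyl_onb n :: 'a::finite l2 set) = CARD('a) ^ n"
  by (simp add: cyl_onb_def card_image inj_on_cyl card_words)

lemma orthonormal_cyl_onb: "orthonormal (cyl_onb n :: 'a::finite l2 set)"
  by (auto simp: orthonormal_def cyl_onb_def pairwise_def orthogonal_def inner_cyl norm_eq_1)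

lemma span_cyl_onb: "span (cyl_onb n) = (cylinder_span n :: 'a::finite l2 set)"
proof -
  have inj: "inj_on cyl (words n :: 'a list set)"
    using inj_on_cyl[where 'a='a, of n] by (auto simp: inj_on_def)
  have "span ((\<lambda>u. sqrt (real CARD('a) ^ n) *\<^sub>R u) ` (cyl ` (words n :: 'a list set))) = span (cyl ` words n)"
    by (rule span_image_scale) (auto simp: finite_words)
  then show ?thesis
    by (simp add: cyl_onb_def cylinder_span_def image_image words_def cyl_def setcompr_eq_image)
qed

lemma orth_proj_cylinder_span: "orth_proj (cylinder_span n) u = cyl_proj n u"
  unfolding span_cyl_onb[symmetric] cyl_proj_def
  by (rule orth_proj_span[OF finite_cyl_onb orthonormal_cyl_onb])

lemma is_orth_proj_cyl_proj: "is_orth_proj (cyl_proj n)"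
  unfolding cyl_proj_def by (rule is_orth_proj_fourier[OF finite_cyl_onb orthonormal_cyl_onb])

lemma range_cyl_proj: "range (cyl_proj n) = cylinder_span n"
  unfolding cyl_proj_def span_cyl_onb[symmetric]
  by (rule range_fourier[OF finite_cyl_onb orthonormal_cyl_onb])

lemma inner_cyl_proj:
  "inner (cyl_proj n u) (v :: 'a::finite l2) = real CARD('a) ^ n * (\<Sum>w\<in>words n. inner u (cyl w) * inner v (cyl w))"
  unfolding cyl_proj_def inner_fourier[OF finite_cyl_onb orthonormal_cyl_onb]
  by (simp add: cyl_onb_def sum.reindex inj_on_cyl sum_distrib_left mult_ac)

lemma cyl_split: "cyl w = (\<Sum>a\<in>UNIV. cyl (w @ [a]) :: 'a::finite l2)"
proof -
  have sum: "abs_l2 (\<lambda>x. \<Sum>a\<in>A. indicator (cylinder (w @ [a])) x) = (\<Sum>a\<in>A. cyl (w @ [a]))"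
    and sq: "square_integrable (\<lambda>x. \<Sum>a\<in>A. indicator (cylinder (w @ [a])) x :: real)" for A :: "'a set"
  proof -
    have "finite A" by simp
    then have "abs_l2 (\<lambda>x. \<Sum>a\<in>A. indicator (cylinder (w @ [a])) x) = (\<Sum>a\<in>A. cyl (w @ [a]))
      \<and> square_integrable (\<lambda>x. \<Sum>a\<in>A. indicator (cylinder (w @ [a])) x :: real)"
      by (induction A rule: finite_induct) (auto simp: abs_l2_zero cyl_def abs_l2_add square_integrable_add)
    then show "abs_l2 (\<lambda>x. \<Sum>a\<in>A. indicator (cylinder (w @ [a])) x) = (\<Sum>a\<in>A. cyl (w @ [a]))"
      "square_integrable (\<lambda>x. \<Sum>a\<in>A. indicator (cylinder (w @ [a])) x :: real)" by auto
  qed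
  have "indicator (cylinder w) x = (\<Sum>a\<in>UNIV. indicator (cylinder (w @ [a])) x :: real)" for x
  proof -
    have "indicator (cylinder (w @ [a])) x = (if a = x (length w) then indicator (cylinder w) x else 0 :: real)" for a
      by (auto simp: indicator_def mem_cylinder)
    then show ?thesis by simp
  qed
  then have ext: "(\<lambda>x. \<Sum>a\<in>UNIV. indicator (cylinder (w @ [a])) x :: real) = indicator (cylinder w)"
    by (intro ext) simp
  show ?thesis using sum[of UNIV] unfolding ext by (simp add: cyl_def)
qed

lemma cylinder_span_Suc: "cylinder_span n \<subseteq> (cylinder_span (Suc n) :: 'a::finite l2 set)"
  unfolding cylinder_span_def
proof (rule span_minimal)
  show "{abs_l2 (indicator (cylinder w)) |w. length w = n}
      \<subseteq> span {abs_l2 (indicator (cylinder w)) :: 'a l2 |w. length w = Suc n}"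
  proof clarify
    fix w :: "'a list"
    show "abs_l2 (indicator (cylinder w)) \<in> span {abs_l2 (indicator (cylinder v)) :: 'a l2 |v. length v = Suc (length w)}"
      unfolding cyl_def[symmetric] cyl_split[of w] by (intro span_sum span_base) auto
  qed
qed (rule subspace_span)

lemma cyl_proj_Suc: "cyl_proj (Suc n) (cyl_proj n u) = cyl_proj n u"
  using cylinder_span_Suc[of n] range_cyl_proj[of n] range_cyl_proj[of "Suc n"]
    is_orth_projD(2)[OF is_orth_proj_cyl_proj, of "Suc n"] by (metis rangeE rangeI subsetD)

lemma sets_bernoulli_cylinder:
  "sets bernoulli = sigma_sets UNIV (insert {} (range (cylinder :: 'a::finite list \<Rightarrow> _)))"
proof
  let ?S = "sigma_sets UNIV (insert {} (range (cylinder :: 'a list \<Rightarrow> _)))"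
  show "?S \<subseteq> sets bernoulli"
    by (intro sets.sigma_sets_subset[of _ bernoulli, unfolded space_bernoulli] insert_subsetI image_subsetI) auto
  interpret S: sigma_algebra UNIV ?S by (rule sigma_algebra_sigma_sets) auto
  have "{x. x i \<in> A} \<in> ?S" for i and A :: "'a set"
  proof -
    have "{x. x i \<in> A} = (\<Union>w\<in>{w \<in> words (Suc i). w ! i \<in> A}. cylinder w)"
    proof (intro set_eqI iffI)
      fix x assume "x \<in> {x. x i \<in> A}"
      then show "x \<in> (\<Union>w\<in>{w \<in> words (Suc i). w ! i \<in> A}. cylinder w)"
        by (intro UN_I[of "map x [0..<Suc i]"]) (auto simp: words_def cylinder_def nth_append simp del: upt_Suc)
    qed (auto simp: words_def cylinder_def)
    also have "\<dots> \<in> ?S"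
      by (intro S.finite_UN finite_subset[OF _ finite_words[of "Suc i"]]) (auto intro: sigma_sets.Basic)
    finally show ?thesis .
  qed
  then have "sigma_sets UNIV {{x. x i \<in> A} |i A. True} \<subseteq> ?S"
    by (intro S.sigma_sets_subset) auto
  then show "sets bernoulli \<subseteq> ?S"
    by (simp add: bernoulli_def sets_PiM_single sets_uniform_count_measure space_uniform_count_measure)
qed

text \<open>
  The cylinders form an intersection-stable generator, so by a Dynkin argument a function with zero
  integral over all cylinders has zero integral over all measurable sets.
\<close>

lemma cylinders_total:
  fixes u :: "'a::finite l2"
  assumes zero: "\<And>w. inner u (cyl w) = 0"
  shows "u = 0"
proof -
  obtain f where f: "square_integrable f" "u = abs_l2 f" using abs_l2_surj by metis
  have int: "integrable bernoulli f"
    using square_integrable_mult[OF f(1) square_integrable_const[of 1]] by simp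
  have stable: "Int_stable (insert {} (range (cylinder :: 'a list \<Rightarrow> _)))"
  proof -
    have "cylinder v \<inter> cylinder w \<in> insert {} (range cylinder)" if "length v \<le> length w" for v w :: "'a list"
    proof (cases "take (length v) w = v")
      case True
      then have "cylinder w \<subseteq> cylinder v"
        using that by (auto simp: cylinder_def) (metis nth_take order_less_le_trans)
      then show ?thesis by (auto simp: Int_absorb1)
    next
      case False
      have "cylinder v \<inter> cylinder w = {}"
      proof (rule ccontr)
        assume "cylinder v \<inter> cylinder w \<noteq> {}"
        then obtain x where "\<forall>k<length v. x k = v ! k" "\<forall>k<length w. x k = w ! k"
          by (auto simp: cylinder_def)
        then have "take (length v) w = v" using that by (intro nth_equalityI) auto
        with False show False ..
      qed
      then show ?thesis by simp
    qed
    then have "cylinder v \<inter> cylinder w \<in> insert {} (range cylinder)" for v w :: "'a list"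
      by (metis Int_commute linorder_linear)
    then show ?thesis by (auto simp: Int_stable_def)
  qed
  have closed: "insert {} (range (cylinder :: 'a list \<Rightarrow> _)) \<subseteq> Pow UNIV" by simp
  have cylz: "set_lebesgue_integral bernoulli (cylinder w) f = 0" for w
    using zero[of w] f by (simp add: cyl_def inner_abs_l2 set_lebesgue_integral_def mult.commute)
  have UNIV: "set_lebesgue_integral bernoulli UNIV f = 0"
    using cylz[of "[]"] by (simp add: cylinder_def)
  have si: "set_integrable bernoulli A f" if "A \<in> sets bernoulli" for A
    unfolding set_integrable_def using int that by (rule integrable_mult_indicator[rotated])
  have "set_lebesgue_integral bernoulli A f = 0" if A: "A \<in> sets bernoulli" for A
    using stable closed A[unfolded sets_bernoulli_cylinder]
  proof (induction rule: sigma_sets_induct_disjoint)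
    case (basic A)
    then show ?case using cylz by (auto simp: set_lebesgue_integral_def)
  next
    case (compl A)
    then have A: "A \<in> sets bernoulli" by (simp add: sets_bernoulli_cylinder)
    have "set_lebesgue_integral bernoulli (A \<union> (UNIV - A)) f =
      set_lebesgue_integral bernoulli A f + set_lebesgue_integral bernoulli (UNIV - A) f"
      using A sets.compl_sets[OF A, unfolded space_bernoulli] by (intro set_integral_Un si) simp_all
    then show ?case using compl UNIV by (simp add: Un_Diff_cancel)
  next
    case (union A)
    then have A: "A i \<in> sets bernoulli" for i by (auto simp: sets_bernoulli_cylinder)
    have "set_lebesgue_integral bernoulli (\<Union>i. A i) f = (\<Sum>i. set_lebesgue_integral bernoulli (A i) f)"
      using union(1) A by (intro lebesgue_integral_countable_add si) (auto simp: disjoint_family_on_def)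
    then show ?case using union by simp
  qed (simp add: set_lebesgue_integral_def)
  then have "AE x in bernoulli. f x = 0" by (intro bernoulli.density_zero int)
  then have "l2_rel f (\<lambda>_. 0)" using f by (simp add: l2_rel_def)
  then show ?thesis unfolding f(2) abs_l2_zero[symmetric]
    using Quotient_rel_abs[OF Quotient_l2] by blast
qed

lemma cyl_proj_total:
  assumes "\<And>n. cyl_proj n u = 0"
  shows "u = (0 :: 'a::finite l2)"
proof (rule cylinders_total)
  fix w :: "'a list"
  have "cyl w \<in> range (cyl_proj (length w))"
    unfolding range_cyl_proj cylinder_span_def cyl_def by (intro span_base) auto
  then have "cyl_proj (length w) (cyl w) = cyl w"
    by (simp add: range_orth_proj[OF is_orth_proj_cyl_proj])
  then show "inner u (cyl w) = 0"
    using is_orth_projD(3)[OF is_orth_proj_cyl_proj, of "length w" u "cyl w"] assms by simp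
qed

text \<open>
  The martingale differences: \<open>P\<^sub>0\<close> at index \<open>0\<close> and \<open>Q\<^sub>k\<close> at index \<open>Suc k\<close>.
\<close>

definition cyl_E :: "nat \<Rightarrow> 'a::finite l2 \<Rightarrow> 'a l2" where
  "cyl_E n = (case n of 0 \<Rightarrow> cyl_proj 0 | Suc k \<Rightarrow> (\<lambda>u. cyl_proj (Suc k) u - cyl_proj k u))"

lemma cyl_E_0: "cyl_E 0 = cyl_proj 0"
  and cyl_E_Suc: "cyl_E (Suc k) u = cyl_proj (Suc k) u - cyl_proj k u"
  by (simp_all add: cyl_E_def)

lemma cylinder_span_mono: "m \<le> n \<Longrightarrow> cylinder_span m \<subseteq> cylinder_span n"
  by (rule lift_Suc_mono_le[of cylinder_span]) (rule cylinder_span_Suc)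

global_interpretation cyl: finite_rank_resolution "cyl_E :: nat \<Rightarrow> 'a::finite l2 \<Rightarrow> 'a l2" cyl_onb
proof -
  interpret spectral_resolution "cyl_E :: nat \<Rightarrow> 'a l2 \<Rightarrow> 'a l2"
    unfolding cyl_E_def
    by (rule spectral_resolution_increasing) (simp_all add: is_orth_proj_cyl_proj cyl_proj_Suc cyl_proj_total)
  have "range (cyl_E k :: 'a l2 \<Rightarrow> 'a l2) \<subseteq> span (cyl_onb n)" if "k < n" for k n
  proof -
    have sub: "subspace (cylinder_span n :: 'a l2 set)" unfolding cylinder_span_def by (rule subspace_span)
    have P: "cyl_proj j u \<in> cylinder_span n" if "j \<le> n" for j and u :: "'a l2"
      using cylinder_span_mono[OF that] range_cyl_proj[of j] by blast
    show ?thesis unfolding span_cyl_onb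
      using that P sub by (cases k) (auto simp: cyl_E_0 cyl_E_Suc intro!: subspace_diff)
  qed
  then show "finite_rank_resolution (cyl_E :: nat \<Rightarrow> 'a l2 \<Rightarrow> 'a l2) cyl_onb"
    by unfold_locales (auto simp: finite_cyl_onb orthonormal_cyl_onb)
qed

lemma cyl_proj_eq_sum: "cyl_proj n u = (\<Sum>k\<le>n. cyl_E k u)"
  by (induction n) (simp_all add: cyl_E_0 cyl_E_Suc)

lemma cyl_E_has_sum:
  assumes B: "orthonormal_basis (B :: 'a::finite l2 set)"
  shows "((\<lambda>e. (norm (cyl_E n e))\<^sup>2) has_sum (case n of 0 \<Rightarrow> 1 | Suc k \<Rightarrow> real CARD('a) ^ Suc k - real CARD('a) ^ k)) B"
proof -
  have P: "((\<lambda>e. (norm (cyl_proj n e))\<^sup>2) has_sum (real CARD('a) ^ n)) B" for n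
    using has_sum_norm_fourier[OF finite_cyl_onb orthonormal_cyl_onb B, of n]
    by (simp add: cyl_proj_def card_cyl_onb)
  show ?thesis
  proof (cases n)
    case 0
    then show ?thesis using P[of 0] by (simp add: cyl_E_0)
  next
    case (Suc k)
    have "(norm (cyl_E (Suc k) e))\<^sup>2 = (norm (cyl_proj (Suc k) e))\<^sup>2 - (norm (cyl_proj k e))\<^sup>2" for e :: "'a l2"
    proof -
      have "orthogonal (cyl_E (Suc k) e) (cyl_proj k e)"
        unfolding cyl_proj_eq_sum orthogonal_def inner_sum_right
        by (intro sum.neutral) (auto simp: cyl.orthogonal_E)
      from norm_add_Pythagorean[OF this] show ?thesis by (simp add: cyl_E_Suc)
    qed
    then show ?thesis using has_sum_add[OF P[of "Suc k"] has_sum_cmult_right[OF P[of k], of "-1"]] Suc by simp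
  qed
qed


section \<open>The energy in terms of the martingale differences\<close>

text \<open>
  The indicator of the relation ``common prefix of length \<open>n\<close>''.  Written as a sum of products over
  words, it is visibly measurable and separates the variables.
\<close>

definition agree :: "nat \<Rightarrow> (nat \<Rightarrow> 'a::finite) \<Rightarrow> (nat \<Rightarrow> 'a) \<Rightarrow> real" where
  "agree n x y = (\<Sum>w\<in>words n. indicator (cylinder w) x * indicator (cylinder w) y)"

lemma agree_eq: "agree n x y = (if \<forall>k<n. x k = y k then 1 else 0)"
proof -
  have "agree n x y = (\<Sum>w\<in>words n. if w = map x [0..<n] then (if w = map y [0..<n] then 1 else 0) else 0)"
    unfolding agree_def by (intro sum.cong) (auto simp: indicator_cylinder_words)
  also have "\<dots> = (if map x [0..<n] = map y [0..<n] then 1 else 0)"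
    by (simp add: sum.delta finite_words prefix_in_words)
  also have "map x [0..<n] = map y [0..<n] \<longleftrightarrow> (\<forall>k<n. x k = y k)" by auto
  finally show ?thesis .
qed

text \<open>
  Expanding the square yields, up to normalization, twice the variance of \<open>f\<close> on the cylinder.
  Nonnegativity is recorded because the values are later added up in \<open>ennreal\<close>.
\<close>

lemma nn_integral_cylinder_variance:
  fixes f :: "(nat \<Rightarrow> 'a::finite) \<Rightarrow> real"
  assumes f: "square_integrable f" and w: "w \<in> words n"
  shows "(\<integral>\<^sup>+x. \<integral>\<^sup>+y. ennreal ((f x - f y)\<^sup>2 * (indicator (cylinder w) x * indicator (cylinder w) y)) \<partial>bernoulli \<partial>bernoulli)
    = ennreal (2 / real CARD('a) ^ n * (\<integral>x. indicator (cylinder w) x * (f x)\<^sup>2 \<partial>bernoulli)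
        - 2 * (inner (abs_l2 f) (cyl w))\<^sup>2)" (is ?eq)
    and "0 \<le> 2 / real CARD('a) ^ n * (\<integral>x. indicator (cylinder w) x * (f x)\<^sup>2 \<partial>bernoulli)
        - 2 * (inner (abs_l2 f) (cyl w))\<^sup>2" (is ?nonneg)
proof -
  let ?i = "indicator (cylinder w) :: _ \<Rightarrow> real"
  define \<mu> m s where "\<mu> = 1 / real CARD('a) ^ n" and "m = inner (abs_l2 f) (cyl w)"
    and "s = (\<integral>x. ?i x * (f x)\<^sup>2 \<partial>bernoulli)"
  note [measurable] = square_integrable_measurable[OF f]
  have f2: "integrable bernoulli (\<lambda>x. (f x)\<^sup>2)" using f by (simp add: square_integrable_def)
  have i2: "integrable bernoulli (\<lambda>x. ?i x * (f x)\<^sup>2)"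
    using integrable_mult_indicator[OF sets_cylinder f2] by simp
  have i1: "integrable bernoulli (\<lambda>x. ?i x * f x)"
    using square_integrable_mult[OF square_integrable_indicator[OF sets_cylinder] f] .
  have i0: "integrable bernoulli ?i" by (simp add: integrable_real_indicator bernoulli.emeasure_eq_measure)
  have I0: "measure bernoulli (cylinder w) = \<mu>" using w by (simp add: measure_cylinder words_def \<mu>_def)
  have I1: "(\<integral>x. ?i x * f x \<partial>bernoulli) = m"
    using f by (simp add: m_def cyl_def inner_abs_l2 mult.commute)
  have inner: "(\<integral>\<^sup>+y. ennreal ((f x - f y)\<^sup>2 * (?i x * ?i y)) \<partial>bernoulli) = ennreal (?i x * (\<mu> * (f x)\<^sup>2 - 2 * m * f x + s))" for x
  proof -
    have eq: "(f x - f y)\<^sup>2 * (?i x * ?i y) = ?i x * ((f x)\<^sup>2 * ?i y - 2 * f x * (?i y * f y) + ?i y * (f y)\<^sup>2)" for y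
      by (simp add: power2_eq_square algebra_simps)
    have "(\<integral>\<^sup>+y. ennreal ((f x - f y)\<^sup>2 * (?i x * ?i y)) \<partial>bernoulli) = ennreal (\<integral>y. (f x - f y)\<^sup>2 * (?i x * ?i y) \<partial>bernoulli)"
    proof (rule nn_integral_eq_integral)
      show "integrable bernoulli (\<lambda>y. (f x - f y)\<^sup>2 * (?i x * ?i y))"
        unfolding eq using i0 i1 i2 by simp
    qed simp
    also have "(\<integral>y. (f x - f y)\<^sup>2 * (?i x * ?i y) \<partial>bernoulli) = ?i x * ((f x)\<^sup>2 * \<mu> - 2 * f x * m + s)"
      unfolding eq using i0 i1 i2 by (simp add: I0 I1 s_def)
    finally show ?thesis by (simp add: mult_ac)
  qed
  have nn: "0 \<le> ?i x * (\<mu> * (f x)\<^sup>2 - 2 * m * f x + s)" for x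
  proof -
    have "0 \<le> (\<integral>y. (f x - f y)\<^sup>2 * ?i y \<partial>bernoulli)" by simp
    also have "(\<integral>y. (f x - f y)\<^sup>2 * ?i y \<partial>bernoulli) = (\<integral>y. (f x)\<^sup>2 * ?i y - 2 * f x * (?i y * f y) + ?i y * (f y)\<^sup>2 \<partial>bernoulli)"
      by (intro Bochner_Integration.integral_cong) (simp_all add: power2_eq_square algebra_simps)
    also have "\<dots> = \<mu> * (f x)\<^sup>2 - 2 * m * f x + s"
      using i0 i1 i2 by (simp add: I0 I1 s_def)
    finally show ?thesis by simp
  qed
  have eq: "?i x * (\<mu> * (f x)\<^sup>2 - 2 * m * f x + s) = \<mu> * (?i x * (f x)\<^sup>2) - 2 * m * (?i x * f x) + s * ?i x" for x
    by (simp add: algebra_simps)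
  have "(\<integral>\<^sup>+x. ennreal (?i x * (\<mu> * (f x)\<^sup>2 - 2 * m * f x + s)) \<partial>bernoulli)
      = ennreal (\<integral>x. ?i x * (\<mu> * (f x)\<^sup>2 - 2 * m * f x + s) \<partial>bernoulli)"
    using i0 i1 i2 nn by (intro nn_integral_eq_integral) (auto simp: eq)
  also have total: "(\<integral>x. ?i x * (\<mu> * (f x)\<^sup>2 - 2 * m * f x + s) \<partial>bernoulli) = \<mu> * s - 2 * m * m + s * \<mu>"
    unfolding eq using i0 i1 i2 by (simp add: I0 I1 s_def)
  finally show ?eq unfolding inner by (simp add: \<mu>_def m_def s_def power2_eq_square mult.assoc)
  have "0 \<le> \<mu> * s - 2 * m * m + s * \<mu>" unfolding total[symmetric] using nn by simp
  then show ?nonneg by (simp add: \<mu>_def m_def s_def power2_eq_square mult.assoc)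
qed

lemma sum_indicator_words: "(\<Sum>w\<in>words n. indicator (cylinder w) x) = (1 :: real)"
proof -
  have "(\<Sum>w\<in>words n. indicator (cylinder w) x) = (\<Sum>w\<in>words n. if w = map x [0..<n] then 1 else 0 :: real)"
    by (intro sum.cong) (auto simp: indicator_cylinder_words)
  then show ?thesis by (simp add: finite_words prefix_in_words)
qed

text \<open>
  Summing the variances over all words of length \<open>n\<close>: the squared integrals over the cylinders add up to
  \<open>N\<^bsup>-n\<^esup> \<parallel>P n u\<parallel>\<^sup>2\<close>, and
  Pythagoras turns \<open>\<parallel>u\<parallel>\<^sup>2 - \<parallel>P n u\<parallel>\<^sup>2\<close> into the square norm of \<open>u - P n u\<close>.
\<close>

lemma nn_integral_agree:
  fixes f :: "(nat \<Rightarrow> 'a::finite) \<Rightarrow> real"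
  assumes f: "square_integrable f"
  shows "(\<integral>\<^sup>+x. \<integral>\<^sup>+y. ennreal ((f x - f y)\<^sup>2 * agree n x y) \<partial>bernoulli \<partial>bernoulli)
    = ennreal (2 / real CARD('a) ^ n * (norm (abs_l2 f - cyl_proj n (abs_l2 f)))\<^sup>2)"
proof -
  let ?i = "\<lambda>w. indicator (cylinder w) :: _ \<Rightarrow> real"
  let ?I = "\<lambda>w. \<integral>\<^sup>+x. \<integral>\<^sup>+y. ennreal ((f x - f y)\<^sup>2 * (?i w x * ?i w y)) \<partial>bernoulli \<partial>bernoulli"
  let ?u = "abs_l2 f"
  note [measurable] = square_integrable_measurable[OF f]
  have f2: "integrable bernoulli (\<lambda>x. (f x)\<^sup>2)" using f by (simp add: square_integrable_def)
  have i2: "integrable bernoulli (\<lambda>x. ?i w x * (f x)\<^sup>2)" for w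
    using integrable_mult_indicator[OF sets_cylinder f2] by simp
  have "(\<integral>\<^sup>+x. \<integral>\<^sup>+y. ennreal ((f x - f y)\<^sup>2 * agree n x y) \<partial>bernoulli \<partial>bernoulli)
    = (\<integral>\<^sup>+x. \<integral>\<^sup>+y. (\<Sum>w\<in>words n. ennreal ((f x - f y)\<^sup>2 * (?i w x * ?i w y))) \<partial>bernoulli \<partial>bernoulli)"
    by (simp add: agree_def sum_distrib_left sum_ennreal)
  also have "\<dots> = (\<integral>\<^sup>+x. (\<Sum>w\<in>words n. \<integral>\<^sup>+y. ennreal ((f x - f y)\<^sup>2 * (?i w x * ?i w y)) \<partial>bernoulli) \<partial>bernoulli)"
    by (intro nn_integral_cong nn_integral_sum) measurable
  also have "\<dots> = (\<Sum>w\<in>words n. ?I w)"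
    by (intro nn_integral_sum) measurable
  also have "\<dots> = (\<Sum>w\<in>words n. ennreal (2 / real CARD('a) ^ n * (\<integral>x. ?i w x * (f x)\<^sup>2 \<partial>bernoulli) - 2 * (inner ?u (cyl w))\<^sup>2))"
    by (intro sum.cong refl nn_integral_cylinder_variance(1) f)
  also have "\<dots> = ennreal (\<Sum>w\<in>words n. 2 / real CARD('a) ^ n * (\<integral>x. ?i w x * (f x)\<^sup>2 \<partial>bernoulli) - 2 * (inner ?u (cyl w))\<^sup>2)"
    by (intro sum_ennreal nn_integral_cylinder_variance(2) f)
  also have "(\<Sum>w\<in>words n. 2 / real CARD('a) ^ n * (\<integral>x. ?i w x * (f x)\<^sup>2 \<partial>bernoulli) - 2 * (inner ?u (cyl w))\<^sup>2)
    = 2 / real CARD('a) ^ n * (\<Sum>w\<in>words n. \<integral>x. ?i w x * (f x)\<^sup>2 \<partial>bernoulli) - 2 * (\<Sum>w\<in>words n. (inner ?u (cyl w))\<^sup>2)"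
    by (simp add: sum_subtractf sum_distrib_left)
  also have "(\<Sum>w\<in>words n. \<integral>x. ?i w x * (f x)\<^sup>2 \<partial>bernoulli) = (\<integral>x. (\<Sum>w\<in>words n. ?i w x * (f x)\<^sup>2) \<partial>bernoulli)"
    by (rule Bochner_Integration.integral_sum[symmetric]) (rule i2)
  also have "\<dots> = (norm ?u)\<^sup>2"
    by (simp add: sum_distrib_right[symmetric] sum_indicator_words norm_l2_abs f)
  also have "2 / real CARD('a) ^ n * (norm ?u)\<^sup>2 - 2 * (\<Sum>w\<in>words n. (inner ?u (cyl w))\<^sup>2)
     = 2 / real CARD('a) ^ n * ((norm ?u)\<^sup>2 - (norm (cyl_proj n ?u))\<^sup>2)"
    using inner_cyl_proj[of n ?u ?u] inner_orth_proj_self[OF is_orth_proj_cyl_proj, of n ?u]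
    by (simp add: power2_eq_square field_simps)
  finally show ?thesis by (simp add: norm_orth_proj_compl is_orth_proj_cyl_proj)
qed


abbreviation dist_delta :: "real \<Rightarrow> (nat \<Rightarrow> 'a::finite) \<Rightarrow> (nat \<Rightarrow> 'a) \<Rightarrow> real" where
  "dist_delta lam x y \<equiv> ultra_dist lam x y powr (ln (real CARD('a)) / ln lam)"

definition kernel_weight :: "real \<Rightarrow> nat \<Rightarrow> real" where
  "kernel_weight N j = (case j of 0 \<Rightarrow> 1 | Suc i \<Rightarrow> N ^ Suc i - N ^ i)"

text \<open>
  The eigenvalue of the Laplacian on the range of \<open>cyl_E n\<close>, so that \<open>Suc k\<close> belongs to \<open>Q\<^sub>k\<close>.
\<close>

definition eigenvalue :: "real \<Rightarrow> nat \<Rightarrow> real" where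
  "eigenvalue N n = (case n of 0 \<Rightarrow> 0 | Suc k \<Rightarrow> 1 + real k * (1 - 1 / N))"

lemma eigenvalue_nonneg: "N \<ge> 1 \<Longrightarrow> 0 \<le> eigenvalue N n"
  by (cases n) (auto simp: eigenvalue_def)

lemma kernel_weight_nonneg: "N \<ge> 1 \<Longrightarrow> 0 \<le> kernel_weight N j"
  by (cases j) (auto simp: kernel_weight_def)

lemma sum_kernel_weight: "(\<Sum>j\<le>k. kernel_weight N j) = N ^ k"
  by (induction k) (auto simp: kernel_weight_def)

lemma sum_kernel_weight_scaled:
  assumes "N \<noteq> 0"
  shows "(\<Sum>j<n. kernel_weight N j / N ^ j) = eigenvalue N n"
proof (cases n)
  case (Suc k)
  have "(\<Sum>j<Suc k. kernel_weight N j / N ^ j) = 1 + real k * (1 - 1 / N)"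
  proof (induction k)
    case (Suc k)
    have "kernel_weight N (Suc k) / N ^ Suc k = 1 - 1 / N"
      using assms by (simp add: kernel_weight_def diff_divide_distrib)
    then show ?case using Suc by (simp add: algebra_simps)
  qed (simp add: kernel_weight_def)
  then show ?thesis by (simp add: Suc eigenvalue_def)
qed (simp add: eigenvalue_def)

lemma inverse_dist_delta:
  fixes x y :: "nat \<Rightarrow> 'a::finite"
  assumes "x \<noteq> y" "lam > 1"
  shows "1 / dist_delta lam x y = real CARD('a) ^ (LEAST k. x k \<noteq> y k)"
proof -
  let ?k = "LEAST k. x k \<noteq> y k" and ?N = "real CARD('a)"
  have N: "?N > 0" by simp
  have "dist_delta lam x y = exp (- (real ?k * ln ?N))"
    using assms by (simp add: ultra_dist_def powr_def)
  then have "1 / dist_delta lam x y = exp (real ?k * ln ?N)"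
    by (simp only: exp_minus inverse_eq_divide divide_divide_eq_right mult_1)
  also have "\<dots> = ?N ^ ?k" using N by (simp add: exp_of_nat_mult)
  finally show ?thesis .
qed

text \<open>
  For \<open>x \<noteq> y\<close> the value \<open>d(x,y)\<^bsup>-\<delta>\<^esup>\<close> is \<open>N\<^sup>k\<close>, where \<open>k\<close> is the length of the longest
  common prefix; telescoping \<open>N\<^sup>k\<close> writes the kernel as a combination of the indicators
  of the relations that \<open>x\<close> and \<open>y\<close> have a common prefix of length \<open>j\<close>.
\<close>

lemma inverse_dist_delta_sums:
  fixes x y :: "nat \<Rightarrow> 'a::finite"
  assumes "x \<noteq> y" "lam > 1"
  shows "(\<lambda>j. kernel_weight (real CARD('a)) j * agree j x y) sums (1 / dist_delta lam x y)"
proof -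
  let ?k = "LEAST k. x k \<noteq> y k" and ?N = "real CARD('a)"
  have "\<exists>k. x k \<noteq> y k" using assms by auto
  then have k: "x ?k \<noteq> y ?k" by (rule LeastI_ex)
  have "(\<forall>k<j. x k = y k) \<longleftrightarrow> j \<le> ?k" for j
    using k not_less_Least[of _ "\<lambda>k. x k \<noteq> y k"] by (meson le_less_trans not_le order_less_le_trans)
  then have "agree j x y = (if j \<le> ?k then 1 else 0)" for j by (simp add: agree_eq)
  then have "(\<lambda>j. kernel_weight ?N j * agree j x y) = (\<lambda>j. if j \<in> {..?k} then kernel_weight ?N j else 0)"
    by auto
  moreover have "(\<lambda>j. if j \<in> {..?k} then kernel_weight ?N j else 0) sums (\<Sum>j\<in>{..?k}. kernel_weight ?N j)"
    by (rule sums_If_finite_set) simp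
  ultimately show ?thesis by (simp add: sum_kernel_weight inverse_dist_delta[OF assms])
qed

lemma suminf_swap_ennreal: "(\<Sum>i. \<Sum>j. f i j :: ennreal) = (\<Sum>j. \<Sum>i. f i j)"
proof -
  have "(\<Sum>i. \<Sum>j. f i j) = (\<integral>\<^sup>+i. (\<Sum>j. f i j) \<partial>count_space UNIV)"
    by (rule nn_integral_count_space_nat[symmetric])
  also have "\<dots> = (\<Sum>j. \<integral>\<^sup>+i. f i j \<partial>count_space UNIV)"
    by (rule nn_integral_suminf) simp
  finally show ?thesis by (simp add: nn_integral_count_space_nat)
qed

lemma energy_integrand:
  fixes x y :: "nat \<Rightarrow> 'a::finite"
  assumes "lam > 1"
  shows "ennreal (\<bar>f x - f y\<bar>\<^sup>2 / dist_delta lam x y) * indicator (-{x}) y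
    = (\<Sum>j. ennreal (kernel_weight (real CARD('a)) j) * ennreal ((f x - f y)\<^sup>2 * agree j x y))"
proof (cases "x = y")
  case False
  let ?N = "real CARD('a)"
  have N: "?N \<ge> 1" by (simp add: Suc_leI)
  have ag: "0 \<le> agree j x y" for j by (simp add: agree_eq)
  have "(\<lambda>j. (f x - f y)\<^sup>2 * (kernel_weight ?N j * agree j x y)) sums ((f x - f y)\<^sup>2 * (1 / dist_delta lam x y))"
    by (rule sums_mult[OF inverse_dist_delta_sums[OF False assms]])
  then have "(\<Sum>j. ennreal ((f x - f y)\<^sup>2 * (kernel_weight ?N j * agree j x y))) = ennreal ((f x - f y)\<^sup>2 * (1 / dist_delta lam x y))"
    by (rule suminf_ennreal_eq[rotated]) (simp add: kernel_weight_nonneg[OF N] ag)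
  moreover have "ennreal (kernel_weight ?N j) * ennreal ((f x - f y)\<^sup>2 * agree j x y)
      = ennreal ((f x - f y)\<^sup>2 * (kernel_weight ?N j * agree j x y))" for j
    by (simp add: ennreal_mult[symmetric] kernel_weight_nonneg[OF N] ag mult_ac)
  ultimately show ?thesis using False by simp
qed simp

lemma norm_tail_sums:
  "(\<lambda>n. if j < n then (norm (cyl_E n u))\<^sup>2 else 0) sums (norm (u - cyl_proj j u))\<^sup>2"
proof -
  have "cyl_E n (u - cyl_proj j u) = (if j < n then cyl_E n u else 0)" for n
    by (auto simp: cyl_proj_eq_sum cyl.E_sum cyl.E_E sum.delta not_less)
  then have "(\<lambda>n. (norm (cyl_E n (u - cyl_proj j u)))\<^sup>2) = (\<lambda>n. if j < n then (norm (cyl_E n u))\<^sup>2 else 0)"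
    by auto
  then show ?thesis using cyl.norm_sums[of "u - cyl_proj j u"] by simp
qed

text \<open>
  Integrating the expansion of the kernel term by term gives a sum over \<open>j\<close> of weighted tails
  \<open>\<parallel>u - P j u\<parallel>\<^sup>2\<close>; each \<open>E n u\<close> occurs in the tails with \<open>j < n\<close>, whose weights add up to the
  eigenvalue.  The factor \<open>2\<close> makes up for the \<open>1/2\<close> that belongs to the form but not to the energy.
\<close>

theorem dirichlet_energy_eq:
  fixes u :: "'a::finite l2"
  assumes lam: "lam > 1"
  shows "dirichlet_energy lam u = (\<Sum>n. ennreal (2 * eigenvalue (real CARD('a)) n * (norm (cyl_E n u))\<^sup>2))"
proof -
  let ?N = "real CARD('a)"
  have N: "?N \<ge> 1" by (simp add: Suc_leI)
  obtain f where f: "square_integrable f" "u = abs_l2 f" using abs_l2_surj by metis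
  note [measurable] = square_integrable_measurable[OF f(1)]
  have "dirichlet_energy lam u = (\<integral>\<^sup>+x. \<integral>\<^sup>+y. (\<Sum>j. ennreal (kernel_weight ?N j) * ennreal ((f x - f y)\<^sup>2 * agree j x y)) \<partial>bernoulli \<partial>bernoulli)"
    unfolding f(2) dirichlet_energy.abs_eq[OF l2_rel_refl[OF f(1)]] energy_integrand[OF lam] ..
  also have "\<dots> = (\<integral>\<^sup>+x. (\<Sum>j. ennreal (kernel_weight ?N j) * \<integral>\<^sup>+y. ennreal ((f x - f y)\<^sup>2 * agree j x y) \<partial>bernoulli) \<partial>bernoulli)"
    unfolding agree_def by (intro nn_integral_cong, subst nn_integral_suminf, measurable) (simp add: nn_integral_cmult)
  also have "\<dots> = (\<Sum>j. ennreal (kernel_weight ?N j) * (\<integral>\<^sup>+x. \<integral>\<^sup>+y. ennreal ((f x - f y)\<^sup>2 * agree j x y) \<partial>bernoulli \<partial>bernoulli))"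
    unfolding agree_def by (subst nn_integral_suminf, measurable) (simp add: nn_integral_cmult)
  also have "\<dots> = (\<Sum>j. \<Sum>n. ennreal (2 * (kernel_weight ?N j / ?N ^ j) * (if j < n then (norm (cyl_E n u))\<^sup>2 else 0)))"
  proof (rule suminf_cong)
    fix j
    have w: "0 \<le> kernel_weight ?N j / ?N ^ j" using kernel_weight_nonneg[OF N] by simp
    have "(\<Sum>n. ennreal (2 * (kernel_weight ?N j / ?N ^ j) * (if j < n then (norm (cyl_E n u))\<^sup>2 else 0)))
        = ennreal (2 * (kernel_weight ?N j / ?N ^ j) * (norm (u - cyl_proj j u))\<^sup>2)"
    proof (intro suminf_ennreal_eq sums_mult norm_tail_sums)
      show "0 \<le> 2 * (kernel_weight ?N j / ?N ^ j) * (if j < n then (norm (cyl_E n u))\<^sup>2 else 0)" for n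
        by (rule mult_nonneg_nonneg) (use w in simp_all)
    qed
    also have "\<dots> = ennreal (kernel_weight ?N j) * ennreal (2 / ?N ^ j * (norm (u - cyl_proj j u))\<^sup>2)"
      by (simp add: ennreal_mult[symmetric] kernel_weight_nonneg[OF N] mult_ac)
    finally show "ennreal (kernel_weight ?N j) * (\<integral>\<^sup>+x. \<integral>\<^sup>+y. ennreal ((f x - f y)\<^sup>2 * agree j x y) \<partial>bernoulli \<partial>bernoulli)
       = (\<Sum>n. ennreal (2 * (kernel_weight ?N j / ?N ^ j) * (if j < n then (norm (cyl_E n u))\<^sup>2 else 0)))"
      by (simp add: nn_integral_agree f)
  qed
  also have "\<dots> = (\<Sum>n. \<Sum>j. ennreal (2 * (kernel_weight ?N j / ?N ^ j) * (if j < n then (norm (cyl_E n u))\<^sup>2 else 0)))"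
    by (rule suminf_swap_ennreal)
  also have "\<dots> = (\<Sum>n. ennreal (2 * eigenvalue ?N n * (norm (cyl_E n u))\<^sup>2))"
  proof (rule suminf_cong, rule suminf_ennreal_eq)
    fix n
    show "0 \<le> 2 * (kernel_weight ?N j / ?N ^ j) * (if j < n then (norm (cyl_E n u))\<^sup>2 else 0)" for j
      using kernel_weight_nonneg[OF N] by simp
    have "(\<lambda>j. if j \<in> {..<n} then 2 * (kernel_weight ?N j / ?N ^ j) * (norm (cyl_E n u))\<^sup>2 else 0)
        sums (\<Sum>j\<in>{..<n}. 2 * (kernel_weight ?N j / ?N ^ j) * (norm (cyl_E n u))\<^sup>2)"
      by (rule sums_If_finite_set) simp
    also have "(\<Sum>j\<in>{..<n}. 2 * (kernel_weight ?N j / ?N ^ j) * (norm (cyl_E n u))\<^sup>2)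
        = 2 * eigenvalue ?N n * (norm (cyl_E n u))\<^sup>2"
      by (simp only: sum_distrib_left[symmetric] sum_distrib_right[symmetric], subst sum_kernel_weight_scaled) auto
    also have "(\<lambda>j. if j \<in> {..<n} then 2 * (kernel_weight ?N j / ?N ^ j) * (norm (cyl_E n u))\<^sup>2 else 0)
        = (\<lambda>j. 2 * (kernel_weight ?N j / ?N ^ j) * (if j < n then (norm (cyl_E n u))\<^sup>2 else 0))" by auto
    finally show "(\<lambda>j. 2 * (kernel_weight ?N j / ?N ^ j) * (if j < n then (norm (cyl_E n u))\<^sup>2 else 0)) sums
        (2 * eigenvalue ?N n * (norm (cyl_E n u))\<^sup>2)" .
  qed
  finally show ?thesis .
qed

lemma dirichlet_domain_iff:
  fixes u :: "'a::finite l2"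
  assumes lam: "lam > 1"
  shows "u \<in> dirichlet_domain lam \<longleftrightarrow> summable (\<lambda>n. eigenvalue (real CARD('a)) n * (norm (cyl_E n u))\<^sup>2)"
proof -
  let ?N = "real CARD('a)" and ?s = "\<lambda>n. 2 * eigenvalue (real CARD('a)) n * (norm (cyl_E n u))\<^sup>2"
  have N: "?N \<ge> 1" by (simp add: Suc_leI)
  have nn: "0 \<le> ?s n" for n using eigenvalue_nonneg[OF N] by simp
  have "summable ?s \<longleftrightarrow> (\<Sum>n. ennreal (?s n)) \<noteq> \<infinity>"
  proof
    assume "summable ?s"
    from suminf_ennreal2[OF nn this] show "(\<Sum>n. ennreal (?s n)) \<noteq> \<infinity>" by simp
  next
    assume "(\<Sum>n. ennreal (?s n)) \<noteq> \<infinity>"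
    then show "summable ?s" using nn by (intro summable_suminf_not_top) auto
  qed
  moreover have "summable ?s \<longleftrightarrow> summable (\<lambda>n. eigenvalue ?N n * (norm (cyl_E n u))\<^sup>2)"
    by (simp add: mult.assoc summable_cmult_iff)
  ultimately show ?thesis
    by (simp add: dirichlet_domain_def dirichlet_energy_eq[OF lam] less_top)
qed

lemma dirichlet_energy_sums:
  fixes u :: "'a::finite l2"
  assumes lam: "lam > 1" and u: "u \<in> dirichlet_domain lam"
  shows "(\<lambda>n. 2 * (eigenvalue (real CARD('a)) n * (norm (cyl_E n u))\<^sup>2)) sums enn2real (dirichlet_energy lam u)"
proof -
  let ?s = "\<lambda>n. eigenvalue (real CARD('a)) n * (norm (cyl_E n u))\<^sup>2"
  have N: "real CARD('a) \<ge> 1" by (simp add: Suc_leI)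
  have nn: "0 \<le> 2 * ?s n" for n using eigenvalue_nonneg[OF N] by simp
  have sm: "summable (\<lambda>n. 2 * ?s n)" using u by (intro summable_mult) (simp add: dirichlet_domain_iff[OF lam])
  have "dirichlet_energy lam u = ennreal (\<Sum>n. 2 * ?s n)"
    unfolding dirichlet_energy_eq[OF lam] mult.assoc using sm nn by (rule suminf_ennreal2[rotated])
  then show ?thesis using summable_sums[OF sm] suminf_nonneg[OF sm nn] by simp
qed

lemma dirichlet_domain_add_diff:
  fixes u v :: "'a::finite l2"
  assumes lam: "lam > 1" and "u \<in> dirichlet_domain lam" "v \<in> dirichlet_domain lam"
  shows "u + v \<in> dirichlet_domain lam" "u - v \<in> dirichlet_domain lam"
proof -
  let ?a = "eigenvalue (real CARD('a))"
  have N: "real CARD('a) \<ge> 1" by (simp add: Suc_leI)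
  have sm: "summable (\<lambda>n. 2 * (?a n * (norm (cyl_E n u))\<^sup>2) + 2 * (?a n * (norm (cyl_E n v))\<^sup>2))"
    using assms by (intro summable_add summable_mult) (simp_all add: dirichlet_domain_iff)
  have le: "(norm (x + y))\<^sup>2 \<le> 2 * (norm x)\<^sup>2 + 2 * (norm y)\<^sup>2" "(norm (x - y))\<^sup>2 \<le> 2 * (norm x)\<^sup>2 + 2 * (norm y)\<^sup>2"
    for x y :: "'a l2"
    using zero_le_power2[of "norm (x - y)"] zero_le_power2[of "norm (x + y)"]
    by (simp_all only: power2_norm_eq_inner inner_add inner_diff inner_commute[of y x])
  have "norm (?a n * (norm (cyl_E n (u + v)))\<^sup>2) \<le> 2 * (?a n * (norm (cyl_E n u))\<^sup>2) + 2 * (?a n * (norm (cyl_E n v))\<^sup>2)"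
    "norm (?a n * (norm (cyl_E n (u - v)))\<^sup>2) \<le> 2 * (?a n * (norm (cyl_E n u))\<^sup>2) + 2 * (?a n * (norm (cyl_E n v))\<^sup>2)" for n
    using mult_left_mono[OF le(1)[of "cyl_E n u" "cyl_E n v"] eigenvalue_nonneg[OF N, of n]]
      mult_left_mono[OF le(2)[of "cyl_E n u" "cyl_E n v"] eigenvalue_nonneg[OF N, of n]]
      eigenvalue_nonneg[OF N, of n]
    by (simp_all add: algebra_simps)
  then show "u + v \<in> dirichlet_domain lam" "u - v \<in> dirichlet_domain lam"
    unfolding dirichlet_domain_iff[OF lam] by (auto intro: summable_comparison_test'[OF sm])
qed


section \<open>The form and the Laplacian\<close>

definition energy_density :: "real \<Rightarrow> ((nat \<Rightarrow> 'a::finite) \<Rightarrow> real) \<Rightarrow> (nat \<Rightarrow> 'a) \<Rightarrow> (nat \<Rightarrow> 'a) \<Rightarrow> real" where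
  "energy_density lam f x y = indicator (-{x}) y * ((f x - f y)\<^sup>2 / dist_delta lam x y)"

lemma energy_density_nonneg: "0 \<le> energy_density lam f x y"
  by (simp add: energy_density_def)

lemma energy_density_measurable:
  fixes f :: "(nat \<Rightarrow> 'a::finite) \<Rightarrow> real"
  assumes [measurable]: "f \<in> borel_measurable bernoulli"
  shows "(\<lambda>p. energy_density lam f (fst p) (snd p)) \<in> borel_measurable (bernoulli \<Otimes>\<^sub>M bernoulli)"
proof -
  have "(\<lambda>p. (if fst p = snd p then 0 else 1) * ((f (fst p) - f (snd p))\<^sup>2 / dist_delta lam (fst p) (snd p)))
      \<in> borel_measurable (bernoulli \<Otimes>\<^sub>M bernoulli)" by measurable
  moreover have "(\<lambda>p. energy_density lam f (fst p) (snd p)) =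
     (\<lambda>p. (if fst p = snd p then 0 else 1) * ((f (fst p) - f (snd p))\<^sup>2 / dist_delta lam (fst p) (snd p)))"
    by (auto simp: energy_density_def fun_eq_iff indicator_def)
  ultimately show ?thesis by (simp only:)
qed

lemma dirichlet_energy_density:
  fixes f :: "(nat \<Rightarrow> 'a::finite) \<Rightarrow> real"
  assumes "square_integrable f"
  shows "dirichlet_energy lam (abs_l2 f) = (\<integral>\<^sup>+x. \<integral>\<^sup>+y. ennreal (energy_density lam f x y) \<partial>bernoulli \<partial>bernoulli)"
  unfolding dirichlet_energy.abs_eq[OF l2_rel_refl[OF assms]] energy_density_def
  by (intro nn_integral_cong) (auto split: split_indicator)

text \<open>
  The form is an iterated Bochner integral of products.  To polarize it one has to know that for the squares
  the inner integrals converge almost everywhere and are integrable in the outer variable.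
\<close>

lemma energy_density_integral:
  fixes f :: "(nat \<Rightarrow> 'a::finite) \<Rightarrow> real"
  assumes f: "square_integrable f" and fin: "dirichlet_energy lam (abs_l2 f) < \<infinity>"
  shows "AE x in bernoulli. integrable bernoulli (energy_density lam f x)"
    and "integrable bernoulli (\<lambda>x. \<integral>y. energy_density lam f x y \<partial>bernoulli)"
    and "(\<integral>x. \<integral>y. energy_density lam f x y \<partial>bernoulli \<partial>bernoulli) = enn2real (dirichlet_energy lam (abs_l2 f))"
proof -
  let ?h = "energy_density lam f"
  have m: "(\<lambda>(x, y). ?h x y) \<in> borel_measurable (bernoulli \<Otimes>\<^sub>M bernoulli)"
    using energy_density_measurable[of f lam] f by (simp add: square_integrable_def case_prod_unfold)
  have mx [measurable]: "?h x \<in> borel_measurable bernoulli" for x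
    using measurable_Pair2[OF m, of x] by simp
  have me [measurable]: "(\<lambda>x. \<integral>\<^sup>+y. ennreal (?h x y) \<partial>bernoulli) \<in> borel_measurable bernoulli"
    using m by (intro bernoulli.borel_measurable_nn_integral) (simp add: case_prod_unfold)
  have mi [measurable]: "(\<lambda>x. \<integral>y. ?h x y \<partial>bernoulli) \<in> borel_measurable bernoulli"
    using m by (intro bernoulli.borel_measurable_lebesgue_integral)
  have fin': "(\<integral>\<^sup>+x. \<integral>\<^sup>+y. ennreal (?h x y) \<partial>bernoulli \<partial>bernoulli) \<noteq> \<infinity>"
    using fin by (simp add: dirichlet_energy_density[OF f])
  then have "AE x in bernoulli. (\<integral>\<^sup>+y. ennreal (?h x y) \<partial>bernoulli) \<noteq> \<infinity>"
    by (intro nn_integral_PInf_AE me)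
  then show AE: "AE x in bernoulli. integrable bernoulli (?h x)"
    by eventually_elim (auto simp: integrable_iff_bounded energy_density_nonneg less_top)
  have eq: "(\<integral>\<^sup>+x. ennreal (\<integral>y. ?h x y \<partial>bernoulli) \<partial>bernoulli) = dirichlet_energy lam (abs_l2 f)"
    unfolding dirichlet_energy_density[OF f]
    by (rule nn_integral_cong_AE, rule AE_mp[OF AE])
       (auto intro!: AE_I2 nn_integral_eq_integral[symmetric] simp: energy_density_nonneg)
  have nn: "0 \<le> (\<integral>y. ?h x y \<partial>bernoulli)" for x
    by (simp add: energy_density_nonneg)
  show "integrable bernoulli (\<lambda>x. \<integral>y. ?h x y \<partial>bernoulli)"
    unfolding integrable_iff_bounded using mi eq nn fin by simp
  show "(\<integral>x. \<integral>y. ?h x y \<partial>bernoulli \<partial>bernoulli) = enn2real (dirichlet_energy lam (abs_l2 f))"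
    using nn by (subst integral_eq_nn_integral) (auto simp: eq)
qed

lemma dirichlet_form_polarization:
  fixes u v :: "'a::finite l2"
  assumes lam: "lam > 1" and u: "u \<in> dirichlet_domain lam" and v: "v \<in> dirichlet_domain lam"
  shows "dirichlet_form lam u v =
    (enn2real (dirichlet_energy lam (u + v)) - enn2real (dirichlet_energy lam (u - v))) / 8"
proof -
  obtain f where f: "square_integrable f" "u = abs_l2 f" using abs_l2_surj by metis
  obtain g where g: "square_integrable g" "v = abs_l2 g" using abs_l2_surj by metis
  note [measurable] = square_integrable_measurable[OF f(1)] square_integrable_measurable[OF g(1)]
  let ?p = "\<lambda>x. f x + g x" and ?m = "\<lambda>x. f x - g x"
  have sp: "square_integrable ?p" and sm: "square_integrable ?m" using f g by auto
  have up: "u + v = abs_l2 ?p" and um: "u - v = abs_l2 ?m" using f g by (simp_all add: abs_l2_add abs_l2_diff)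
  have finp: "dirichlet_energy lam (abs_l2 ?p) < \<infinity>" and finm: "dirichlet_energy lam (abs_l2 ?m) < \<infinity>"
    using dirichlet_domain_add_diff[OF lam u v] by (simp_all add: up um dirichlet_domain_def)
  note P = energy_density_integral[OF sp finp] and M = energy_density_integral[OF sm finm]
  let ?k = "\<lambda>x y. indicator (-{x}) y *\<^sub>R ((f x - f y) * (g x - g y) / dist_delta lam x y)"
  have k: "?k x y = (energy_density lam ?p x y - energy_density lam ?m x y) / 4" for x y
  proof (cases "y = x")
    case False
    have "(f x - f y) * (g x - g y) = ((?p x - ?p y)\<^sup>2 - (?m x - ?m y)\<^sup>2) / 4"
      by (simp add: power2_eq_square field_simps)
    then show ?thesis using False by (simp add: energy_density_def diff_divide_distrib)
  qed (simp add: energy_density_def)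
  have mk: "(\<lambda>(x, y). ?k x y) \<in> borel_measurable (bernoulli \<Otimes>\<^sub>M bernoulli)"
    unfolding k using energy_density_measurable[of ?p lam] energy_density_measurable[of ?m lam]
    by (simp add: case_prod_unfold)
  have "(\<integral>x. (\<integral>y. ?k x y \<partial>bernoulli) \<partial>bernoulli) =
      (\<integral>x. ((\<integral>y. energy_density lam ?p x y \<partial>bernoulli) - (\<integral>y. energy_density lam ?m x y \<partial>bernoulli)) / 4 \<partial>bernoulli)"
  proof (rule integral_cong_AE)
    show "(\<lambda>x. \<integral>y. ?k x y \<partial>bernoulli) \<in> borel_measurable bernoulli"
      using mk by (rule bernoulli.borel_measurable_lebesgue_integral)
    show "(\<lambda>x. ((\<integral>y. energy_density lam ?p x y \<partial>bernoulli) - (\<integral>y. energy_density lam ?m x y \<partial>bernoulli)) / 4) \<in> borel_measurable bernoulli"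
      using borel_measurable_integrable[OF P(2)] borel_measurable_integrable[OF M(2)] by measurable
    show "AE x in bernoulli. (\<integral>y. ?k x y \<partial>bernoulli) =
        ((\<integral>y. energy_density lam ?p x y \<partial>bernoulli) - (\<integral>y. energy_density lam ?m x y \<partial>bernoulli)) / 4"
      unfolding k using P(1) M(1) by eventually_elim simp
  qed
  also have "\<dots> = (enn2real (dirichlet_energy lam (abs_l2 ?p)) - enn2real (dirichlet_energy lam (abs_l2 ?m))) / 4"
    using P M by simp
  finally have *: "(\<integral>x. (\<integral>y. ?k x y \<partial>bernoulli) \<partial>bernoulli) =
    (enn2real (dirichlet_energy lam (abs_l2 ?p)) - enn2real (dirichlet_energy lam (abs_l2 ?m))) / 4" .
  have "dirichlet_form lam u v = 1 / 2 * (\<integral>x. (\<integral>y. ?k x y \<partial>bernoulli) \<partial>bernoulli)"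
    unfolding f(2) g(2) dirichlet_form.abs_eq[OF l2_rel_refl[OF f(1)] l2_rel_refl[OF g(1)]]
      set_lebesgue_integral_def ..
  \<comment> \<open>The denominator \<open>8\<close>: a factor \<open>4\<close> from polarization and a factor \<open>2\<close> from the form.\<close>
  then show ?thesis unfolding * up um by simp
qed

lemma dirichlet_form_sums:
  fixes u v :: "'a::finite l2"
  assumes lam: "lam > 1" and u: "u \<in> dirichlet_domain lam" and v: "v \<in> dirichlet_domain lam"
  shows "(\<lambda>n. eigenvalue (real CARD('a)) n * inner (cyl_E n u) (cyl_E n v)) sums dirichlet_form lam u v"
proof -
  let ?a = "eigenvalue (real CARD('a))"
  note uv = dirichlet_domain_add_diff[OF lam u v]
  have "(norm (x + y))\<^sup>2 - (norm (x - y))\<^sup>2 = 4 * inner x y" for x y :: "'a l2"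
    by (simp add: power2_norm_eq_inner inner_add inner_diff inner_commute)
  then have "2 * (?a n * (norm (cyl_E n (u + v)))\<^sup>2) - 2 * (?a n * (norm (cyl_E n (u - v)))\<^sup>2)
      = 8 * (?a n * inner (cyl_E n u) (cyl_E n v))" for n
    by (simp add: right_diff_distrib[symmetric])
  then show ?thesis
    using sums_divide[OF sums_diff[OF dirichlet_energy_sums[OF lam uv(1)] dirichlet_energy_sums[OF lam uv(2)]], of 8]
    by (simp add: dirichlet_form_polarization[OF lam u v])
qed

text \<open>
  The weak equation \<open>\<E>(u, g) = \<langle>v, g\<rangle>\<close>, tested with \<open>g = E n x\<close>, is the equation of the \<open>n\<close>-th
  components; conversely the component equations imply finite energy of \<open>u\<close>, because
  \<open>a n \<parallel>E n u\<parallel>\<^sup>2 = \<langle>E n v, E n u\<rangle>\<close>, and they sum up to the weak equation.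
\<close>

theorem laplacian_diagonal:
  fixes lam :: real
  assumes lam: "lam > 1"
  shows "laplacian lam = diagonal_graph (cyl_E :: nat \<Rightarrow> 'a::finite l2 \<Rightarrow> 'a l2) (eigenvalue (real CARD('a)))"
proof -
  let ?a = "eigenvalue (real CARD('a))"
  have lap: "(u, v) \<in> laplacian lam \<longleftrightarrow>
      u \<in> dirichlet_domain lam \<and> (\<forall>g\<in>dirichlet_domain lam. dirichlet_form lam u g = inner v g)" for u v :: "'a l2"
  proof -
    have "(u, v) \<in> laplacian lam \<longleftrightarrow> (u + v, u) \<in> resolvent lam"
      by (force simp: laplacian_def)
    then show ?thesis by (auto simp: resolvent_def inner_add_left)
  qed
  have "(u, v) \<in> laplacian lam \<longleftrightarrow> (u, v) \<in> diagonal_graph cyl_E ?a" for u v :: "'a l2"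
  proof
    assume uv: "(u, v) \<in> laplacian lam"
    then have u: "u \<in> dirichlet_domain lam" by (simp add: lap)
    have "inner (cyl_E n v - ?a n *\<^sub>R cyl_E n u) x = 0" for n x
    proof -
      have single: "(\<lambda>k. c k * inner (cyl_E k y) (cyl_E k (cyl_E n x))) sums (c n * inner (cyl_E n y) x)" for c y
      proof -
        have "(\<lambda>k. c k * inner (cyl_E k y) (cyl_E k (cyl_E n x))) = (\<lambda>k. if k = n then c n * inner (cyl_E n y) x else 0)"
          by (auto simp: cyl.E_E cyl.inner_E_both fun_eq_iff)
        then show ?thesis using sums_single[of n "\<lambda>_. c n * inner (cyl_E n y) x"] by simp
      qed
      have g: "cyl_E n x \<in> dirichlet_domain lam"
        using sums_summable[OF single[of ?a "cyl_E n x"]]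
        by (simp add: dirichlet_domain_iff[OF lam] power2_norm_eq_inner)
      then have "dirichlet_form lam u (cyl_E n x) = inner v (cyl_E n x)" using uv by (simp add: lap)
      moreover have "dirichlet_form lam u (cyl_E n x) = ?a n * inner (cyl_E n u) x"
        by (rule sums_unique2[OF dirichlet_form_sums[OF lam u g] single])
      ultimately show ?thesis by (simp add: inner_diff_left cyl.E_sym[of n v])
    qed
    from this[of n "cyl_E n v - ?a n *\<^sub>R cyl_E n u" for n]
    show "(u, v) \<in> diagonal_graph cyl_E ?a" by (simp add: cyl.mem_diagonal_graph)
  next
    assume "(u, v) \<in> diagonal_graph cyl_E ?a"
    then have v: "cyl_E n v = ?a n *\<^sub>R cyl_E n u" for n by (simp add: cyl.mem_diagonal_graph)
    have u: "u \<in> dirichlet_domain lam"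
      using sums_summable[OF cyl.inner_sums[of v u]] by (simp add: v dirichlet_domain_iff[OF lam] power2_norm_eq_inner)
    moreover have "dirichlet_form lam u g = inner v g" if "g \<in> dirichlet_domain lam" for g
      using sums_unique2[OF dirichlet_form_sums[OF lam u that]] cyl.inner_sums[of v g] by (simp add: v)
    ultimately show "(u, v) \<in> laplacian lam" by (simp add: lap)
  qed
  then show ?thesis by auto
qed


section \<open>Lipschitz functions\<close>

lemma ultra_dist_le:
  assumes lam: "lam > 1" and agree: "\<And>k. k < n \<Longrightarrow> x k = y k"
  shows "ultra_dist lam x y \<le> (1 / lam) ^ n"
proof (cases "x = y")
  case False
  let ?k = "LEAST k. x k \<noteq> y k"
  have "\<exists>k. x k \<noteq> y k" using False by auto
  then have "x ?k \<noteq> y ?k" by (rule LeastI_ex)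
  then have "n \<le> ?k" using agree by (meson not_le)
  then have "(1 / lam) ^ ?k \<le> (1 / lam) ^ n" using lam by (intro power_decreasing) auto
  then show ?thesis using lam False
    by (simp add: ultra_dist_def powr_minus powr_realpow power_one_over inverse_eq_divide)
qed (use lam in \<open>simp add: ultra_dist_def\<close>)

lemma ultra_dist_ge:
  assumes lam: "lam > 1" and differ: "k < n" "x k \<noteq> y k"
  shows "(1 / lam) ^ n \<le> ultra_dist lam x y"
proof -
  let ?k = "LEAST k. x k \<noteq> y k"
  have "?k \<le> k" using differ by (intro Least_le)
  then have "(1 / lam) ^ n \<le> (1 / lam) ^ ?k" using lam differ by (intro power_decreasing) auto
  then show ?thesis using lam differ
    by (auto simp: ultra_dist_def powr_minus powr_realpow power_one_over inverse_eq_divide)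
qed

lemma ultra_dist_nonneg: "0 \<le> ultra_dist lam x y"
  by (simp add: ultra_dist_def)

text \<open>
  On a cylinder of length \<open>n\<close> a Lipschitz function varies by at most \<open>C \<lambda>\<^bsup>-n\<^esup>\<close>; the double
  integral for the tail only sees pairs of points in a common cylinder.
\<close>

lemma lipschitz_tail:
  fixes f :: "(nat \<Rightarrow> 'a::finite) \<Rightarrow> real"
  assumes lam: "lam > 1" and f: "square_integrable f"
    and lip: "\<And>x y. \<bar>f x - f y\<bar> \<le> C * ultra_dist lam x y"
  shows "(norm (abs_l2 f - cyl_proj n (abs_l2 f)))\<^sup>2 \<le> (C * (1 / lam) ^ n)\<^sup>2"
proof -
  let ?N = "real CARD('a)" and ?c = "(C * (1 / lam) ^ n)\<^sup>2" and ?t = "(norm (abs_l2 f - cyl_proj n (abs_l2 f)))\<^sup>2"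
  have bound: "(f x - f y)\<^sup>2 * agree n x y \<le> ?c * indicator (cylinder (map x [0..<n])) y" for x y
  proof (cases "\<forall>k<n. x k = y k")
    case True
    have "(f x - f y)\<^sup>2 \<le> (C * ultra_dist lam x y)\<^sup>2"
      using lip[of x y] by (intro abs_le_square_iff[THEN iffD1]) linarith
    also have "\<dots> \<le> ?c"
      using ultra_dist_le[OF lam, of n x y] True ultra_dist_nonneg[of lam x y]
      by (simp add: power_mult_distrib mult_left_mono power_mono)
    finally show ?thesis using True by (simp add: agree_eq cylinder_def)
  next
    case False
    then have "agree n x y = 0" by (auto simp: agree_eq)
    then show ?thesis by simp
  qed
  have "ennreal (2 / ?N ^ n * ?t) = (\<integral>\<^sup>+x. \<integral>\<^sup>+y. ennreal ((f x - f y)\<^sup>2 * agree n x y) \<partial>bernoulli \<partial>bernoulli)"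
    by (rule nn_integral_agree[OF f, symmetric])
  also have "\<dots> \<le> (\<integral>\<^sup>+x. \<integral>\<^sup>+y. ennreal ?c * indicator (cylinder (map x [0..<n])) y \<partial>bernoulli \<partial>(bernoulli :: (nat \<Rightarrow> 'a) measure))"
  proof (intro nn_integral_mono)
    fix x y :: "nat \<Rightarrow> 'a"
    have "ennreal ?c * indicator (cylinder (map x [0..<n])) y = ennreal (?c * indicator (cylinder (map x [0..<n])) y)"
      by (auto split: split_indicator)
    then show "ennreal ((f x - f y)\<^sup>2 * agree n x y) \<le> ennreal ?c * indicator (cylinder (map x [0..<n])) y"
      using bound[of x y] by (simp only: ennreal_leI)
  qed
  also have "\<dots> = ennreal (?c / ?N ^ n)"
    by (simp add: nn_integral_cmult_indicator bernoulli.emeasure_eq_measure measure_cylinder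
        ennreal_mult[symmetric] bernoulli.prob_space[simplified])
  finally have "2 / ?N ^ n * ?t \<le> ?c / ?N ^ n"
    by (subst (asm) ennreal_le_iff) auto
  then have "2 * ?t \<le> ?c" by (simp add: field_simps)
  then show ?thesis by (smt (verit) zero_le_power2)
qed

text \<open>
  A nonnegative sequence with finite sum \<open>M\<close> is bounded by \<open>M\<close>, so its squares are dominated by
  \<open>M\<close> times the sequence.
\<close>

lemma summable_linear_geometric_squared:
  fixes q :: real
  assumes "0 \<le> q" "q < 1"
  shows "summable (\<lambda>n. (real (Suc n) * q ^ n)\<^sup>2)"
proof -
  have sm: "summable (\<lambda>n. real (Suc n) * q ^ n)"
    using sums_summable[OF geometric_deriv_sums[of q]] assms by simp
  have "real (Suc n) * q ^ n \<le> (\<Sum>n. real (Suc n) * q ^ n)" for n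
    using sum_le_suminf[OF sm, of "{n}"] assms by simp
  then have "norm ((real (Suc n) * q ^ n)\<^sup>2) \<le> (\<Sum>n. real (Suc n) * q ^ n) * (real (Suc n) * q ^ n)" for n
    using assms by (simp add: power2_eq_square mult_right_mono del: of_nat_Suc)
  then show ?thesis by (intro summable_comparison_test'[OF summable_mult[OF sm]])
qed

text \<open>
  The eigenvalues grow linearly, whereas the components of a Lipschitz function decay like
  \<open>\<lambda>\<^bsup>-n\<^esup>\<close>.
\<close>

lemma lipschitz_subset_domain:
  assumes lam: "lam > 1"
  shows "lipschitz_functions lam \<subseteq> Domain (diagonal_graph (cyl_E :: nat \<Rightarrow> 'a::finite l2 \<Rightarrow> 'a l2) (eigenvalue (real CARD('a))))"
proof
  let ?a = "eigenvalue (real CARD('a))"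
  fix u :: "'a l2" assume "u \<in> lipschitz_functions lam"
  then obtain f C where f: "u = abs_l2 f" "square_integrable f"
    and lip: "\<And>x y. \<bar>f x - f y\<bar> \<le> C * ultra_dist lam x y" by (auto simp: lipschitz_functions_def)
  have bound: "(?a (Suc n))\<^sup>2 * (norm (cyl_E (Suc n) u))\<^sup>2 \<le> C\<^sup>2 * (real (Suc n) * (1 / lam) ^ n)\<^sup>2" for n
  proof -
    have "(norm (cyl_E (Suc n) u))\<^sup>2 \<le> (norm (u - cyl_proj n u))\<^sup>2"
      using sum_le_suminf[OF sums_summable[OF norm_tail_sums[of n u]], of "{Suc n}"]
        sums_unique[OF norm_tail_sums[of n u]] by simp
    also have "\<dots> \<le> (C * (1 / lam) ^ n)\<^sup>2"
      unfolding f(1) by (rule lipschitz_tail[OF lam f(2) lip])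
    finally have 1: "(norm (cyl_E (Suc n) u))\<^sup>2 \<le> (C * (1 / lam) ^ n)\<^sup>2" .
    have N: "real CARD('a) \<ge> 1" by (simp add: Suc_leI)
    have "?a (Suc n) \<le> real (Suc n)"
      using N by (simp add: eigenvalue_def mult_left_le)
    then have 2: "(?a (Suc n))\<^sup>2 \<le> (real (Suc n))\<^sup>2"
      using eigenvalue_nonneg[OF N, of "Suc n"] by (intro power_mono) auto
    have "(?a (Suc n))\<^sup>2 * (norm (cyl_E (Suc n) u))\<^sup>2 \<le> (real (Suc n))\<^sup>2 * (C * (1 / lam) ^ n)\<^sup>2"
      by (intro mult_mono 1 2) auto
    then show ?thesis by (simp add: power_mult_distrib mult_ac)
  qed
  have "summable (\<lambda>n. C\<^sup>2 * (real (Suc n) * (1 / lam) ^ n)\<^sup>2)"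
    using lam by (intro summable_mult summable_linear_geometric_squared) auto
  then have "summable (\<lambda>n. (?a (Suc n))\<^sup>2 * (norm (cyl_E (Suc n) u))\<^sup>2)"
  proof (rule summable_comparison_test')
    show "norm ((?a (Suc n))\<^sup>2 * (norm (cyl_E (Suc n) u))\<^sup>2) \<le> C\<^sup>2 * (real (Suc n) * (1 / lam) ^ n)\<^sup>2" for n
      using bound[of n] by (simp del: of_nat_Suc)
  qed
  then have "summable (\<lambda>n. (?a n)\<^sup>2 * (norm (cyl_E n u))\<^sup>2)" by (subst (asm) summable_Suc_iff)
  then show "u \<in> Domain (diagonal_graph cyl_E ?a)" by (simp add: cyl.Domain_diagonal_graph)
qed

lemma subspace_lipschitz: "subspace (lipschitz_functions lam :: 'a::finite l2 set)"
proof (rule subspaceI)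
  show "0 \<in> (lipschitz_functions lam :: 'a l2 set)"
    unfolding lipschitz_functions_def
    by (auto intro!: exI[of _ "\<lambda>_. 0"] exI[of _ 0] simp: abs_l2_zero)
next
  fix u v :: "'a l2" assume "u \<in> lipschitz_functions lam" "v \<in> lipschitz_functions lam"
  then obtain f g C D where u: "u = abs_l2 f" "square_integrable f" "\<And>x y. \<bar>f x - f y\<bar> \<le> C * ultra_dist lam x y"
    and v: "v = abs_l2 g" "square_integrable g" "\<And>x y. \<bar>g x - g y\<bar> \<le> D * ultra_dist lam x y"
    by (auto simp: lipschitz_functions_def)
  have "\<bar>(f x + g x) - (f y + g y)\<bar> \<le> (C + D) * ultra_dist lam x y" for x y
    using u(3)[of x y] v(3)[of x y] by (simp add: distrib_right)
  then show "u + v \<in> lipschitz_functions lam"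
    unfolding lipschitz_functions_def u(1) v(1) abs_l2_add[OF u(2) v(2), symmetric]
    using square_integrable_add[OF u(2) v(2)] by blast
next
  fix c :: real and u :: "'a l2" assume "u \<in> lipschitz_functions lam"
  then obtain f C where u: "u = abs_l2 f" "square_integrable f" "\<And>x y. \<bar>f x - f y\<bar> \<le> C * ultra_dist lam x y"
    by (auto simp: lipschitz_functions_def)
  have "\<bar>c * f x - c * f y\<bar> \<le> (\<bar>c\<bar> * C) * ultra_dist lam x y" for x y
    using mult_left_mono[OF u(3)[of x y], of "\<bar>c\<bar>"] by (simp add: abs_mult[symmetric] right_diff_distrib mult.assoc)
  then show "c *\<^sub>R u \<in> lipschitz_functions lam"
    unfolding lipschitz_functions_def u(1) abs_l2_scale[OF u(2), symmetric]
    using square_integrable_scale[OF u(2)] by blast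
qed

lemma cyl_lipschitz:
  assumes lam: "lam > 1"
  shows "cyl w \<in> lipschitz_functions lam"
proof -
  have "\<bar>indicator (cylinder w) x - indicator (cylinder w) y\<bar> \<le> lam ^ length w * ultra_dist lam x y" for x y
  proof (cases "\<forall>k<length w. x k = y k")
    case True
    then have "x \<in> cylinder w \<longleftrightarrow> y \<in> cylinder w" by (auto simp: cylinder_def)
    then show ?thesis using lam ultra_dist_nonneg[of lam x y] by (simp add: indicator_def)
  next
    case False
    then obtain k where "k < length w" "x k \<noteq> y k" by blast
    from mult_left_mono[OF ultra_dist_ge[of lam k "length w" x y, OF lam this], of "lam ^ length w"]
    have "1 \<le> lam ^ length w * ultra_dist lam x y" using lam by (simp add: power_one_over)
    moreover have "\<bar>indicator (cylinder w) x - indicator (cylinder w) y :: real\<bar> \<le> 1" by (simp add: indicator_def)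
    ultimately show ?thesis by linarith
  qed
  then show ?thesis
    unfolding cyl_def lipschitz_functions_def
    by (intro CollectI exI[of _ "indicator (cylinder w)"] conjI) auto
qed

lemma cylinder_span_lipschitz:
  assumes "lam > 1" shows "cylinder_span n \<subseteq> lipschitz_functions lam"
  unfolding cylinder_span_def
  by (intro span_minimal subspace_lipschitz) (auto simp: cyl_def[symmetric] cyl_lipschitz[OF assms])

lemma is_core_lipschitz:
  assumes lam: "lam > 1"
  shows "is_core (lipschitz_functions lam) (diagonal_graph (cyl_E :: nat \<Rightarrow> 'a::finite l2 \<Rightarrow> 'a l2) (eigenvalue (real CARD('a))))"
proof (rule cyl.is_core_diagonal_graph[OF lipschitz_subset_domain[OF lam]])
  fix n and u :: "'a l2"
  have "(\<Sum>k<n. cyl_E k u) \<in> cylinder_span n"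
    unfolding span_cyl_onb[symmetric] using cyl.range_E[of _ n] by (intro span_sum) blast
  then show "(\<Sum>k<n. cyl_E k u) \<in> lipschitz_functions lam"
    using cylinder_span_lipschitz[OF lam] by blast
qed


section \<open>The heat operator\<close>

text \<open>
  Apart from its first term this is a geometric series with ratio \<open>N exp (- t (1 - 1/N))\<close>; at the critical
  \<open>t\<close> the ratio is \<open>1\<close> and the series diverges.
\<close>

lemma summable_heat_trace:
  fixes N t :: real
  assumes N: "N > 1"
  shows "summable (\<lambda>n. exp (- t * eigenvalue N n) * (case n of 0 \<Rightarrow> 1 | Suc k \<Rightarrow> N ^ Suc k - N ^ k))
    \<longleftrightarrow> t > N * ln N / (N - 1)"
proof -
  let ?q = "N * exp (- t * (1 - 1 / N))" and ?s = "\<lambda>n. exp (- t * eigenvalue N n) * (case n of 0 \<Rightarrow> 1 | Suc k \<Rightarrow> N ^ Suc k - N ^ k)"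
  have "?s (Suc k) = (exp (- t) * (N - 1)) * ?q ^ k" for k
  proof -
    have "exp (- t * eigenvalue N (Suc k)) = exp (- t) * exp (- t * (1 - 1 / N)) ^ k"
      by (simp add: eigenvalue_def exp_of_nat_mult[symmetric] exp_add[symmetric] algebra_simps)
    then show ?thesis by (simp add: power_mult_distrib algebra_simps)
  qed
  then have "summable (\<lambda>k. ?s (Suc k)) \<longleftrightarrow> summable (\<lambda>k. ?q ^ k)"
    using N by (simp add: summable_cmult_iff)
  then have "summable ?s \<longleftrightarrow> ?q < 1"
    using N by (subst summable_Suc_iff[symmetric]) (simp add: summable_geometric_iff)
  also have "?q < 1 \<longleftrightarrow> ln ?q < 0" using N by simp
  also have "\<dots> \<longleftrightarrow> ln N < t * (1 - 1 / N)" using N by (simp add: ln_mult)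
  also have "\<dots> \<longleftrightarrow> t > N * ln N / (N - 1)" using N by (simp add: field_simps)
  finally show ?thesis .
qed

lemma eigenvalue_at_top:
  assumes "N > 1" shows "filterlim (eigenvalue N) at_top sequentially"
proof -
  have "0 < 1 - 1 / N" using assms by simp
  then have "filterlim (\<lambda>k. 1 + real k * (1 - 1 / N)) at_top sequentially"
    by (intro filterlim_tendsto_add_at_top[OF tendsto_const] filterlim_at_top_mult_tendsto_pos[OF tendsto_const]
        filterlim_real_sequentially)
  then have "filterlim (\<lambda>k. eigenvalue N (Suc k)) at_top sequentially" by (simp add: eigenvalue_def)
  then show ?thesis by (subst (asm) filterlim_sequentially_Suc)
qed

theorem proposition5p7:
  fixes N :: nat and lam :: real
    and Delta :: "'a::finite l2 graph" and P Q :: "nat \<Rightarrow> 'a l2 \<Rightarrow> 'a l2"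
  assumes "CARD('a) = N" and "N \<ge> 2" and "lam > 1"
    and "Delta = laplacian lam"
    and "\<And>n f. P n f = orth_proj (cylinder_span n) f"
    and "\<And>n f. Q n f = P (Suc n) f - P n f"
  shows "(\<forall>n. is_orth_proj (Q n))
    \<and> orthogonal_direct_sum (case_nat (range (P 0)) (\<lambda>n. range (Q n)))
    \<and> range (P 0) = {u. (u, 0) \<in> Delta}
    \<and> range (P 0) = {abs_l2 (\<lambda>_. c) | c. True}
    \<and> (\<forall>n. range (Q n) \<subseteq> Domain Delta \<and>
          (\<exists>c::real. \<forall>u\<in>range (Q n). \<forall>v. (u, v) \<in> Delta \<longleftrightarrow> v = c *\<^sub>R u))
    \<and> is_core (lipschitz_functions lam) Delta
    \<and> (\<forall>t>0. compact_operator (functional_calculus Delta (\<lambda>s. exp (- t * s)))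
          \<and> (trace_class (functional_calculus Delta (\<lambda>s. exp (- t * s)))
              \<longleftrightarrow> t > real N * ln (real N) / (real N - 1)))"
proof -
  let ?a = "eigenvalue (real CARD('a))"
  have N: "real CARD('a) = real N" "real N > 1" using assms(1,2) by auto
  have P: "P n = cyl_proj n" for n using assms(5) by (auto simp: orth_proj_cylinder_span)
  have Q: "Q n = cyl_E (Suc n)" for n using assms(6) by (auto simp: P cyl_E_Suc)
  have Delta: "Delta = diagonal_graph cyl_E ?a"
    using assms(3,4) by (simp add: laplacian_diagonal)
  have "is_orth_proj (Q n)" for n unfolding Q by (rule cyl.proj)
  moreover have "case_nat (range (P 0)) (\<lambda>n. range (Q n)) = (\<lambda>n. range (cyl_E n))"
    by (rule ext) (simp add: P Q cyl_E_0 split: nat.split)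
  then have "orthogonal_direct_sum (case_nat (range (P 0)) (\<lambda>n. range (Q n)))"
    using cyl.orthogonal_direct_sum_E by simp
  moreover have "range (P 0) = {u. (u, 0) \<in> Delta}"
  proof -
    have "?a 0 = 0" "?a (Suc n) \<noteq> 0" for n
      using N by (auto simp: eigenvalue_def add_nonneg_eq_0_iff)
    from cyl.diagonal_graph_kernel[of ?a, OF this] show ?thesis
      unfolding P Delta cyl_E_0 ..
  qed
  moreover have "range (P 0) = {abs_l2 (\<lambda>_. c) | c. True}"
  proof -
    have "cylinder_span 0 = span {abs_l2 (\<lambda>_. 1) :: 'a l2}"
      by (simp add: cylinder_span_def cylinder_def)
    moreover have "c *\<^sub>R abs_l2 (\<lambda>_. 1) = (abs_l2 (\<lambda>_. c) :: 'a l2)" for c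
      using abs_l2_scale[of "\<lambda>_ :: nat \<Rightarrow> 'a. 1" c] by simp
    ultimately show ?thesis unfolding P range_cyl_proj by (auto simp: span_singleton)
  qed
  moreover have "range (Q n) \<subseteq> Domain Delta \<and>
      (\<exists>c::real. \<forall>u\<in>range (Q n). \<forall>v. (u, v) \<in> Delta \<longleftrightarrow> v = c *\<^sub>R u)" for n
    unfolding Q Delta using cyl.diagonal_graph_E[of "Suc n" _ _ ?a] by blast
  moreover have "is_core (lipschitz_functions lam) Delta"
    unfolding Delta by (rule is_core_lipschitz[OF assms(3)])
  moreover have "compact_operator (functional_calculus Delta (\<lambda>s. exp (- t * s)))
      \<and> (trace_class (functional_calculus Delta (\<lambda>s. exp (- t * s)))
          \<longleftrightarrow> t > real N * ln (real N) / (real N - 1))" if t: "t > 0" for t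
  proof -
    let ?c = "\<lambda>n. exp (- t * ?a n)"
    let ?T = "cyl.diagonal_op ?c :: 'a l2 \<Rightarrow> 'a l2"
    have c: "0 < ?c n" "?c n \<le> 1" for n
      using t eigenvalue_nonneg[of "real CARD('a)" n] N by simp_all
    have c1: "\<bar>?c n\<bar> \<le> 1" for n using c[of n] by simp
    have fc: "functional_calculus Delta (\<lambda>s. exp (- t * s)) = ?T"
      unfolding Delta by (rule cyl.functional_calculus_diagonal[where M=1]) (use c1 in simp_all)
    have "filterlim (\<lambda>n. t * ?a n) at_top sequentially"
      using t N by (intro filterlim_tendsto_pos_mult_at_top[OF tendsto_const] eigenvalue_at_top) simp_all
    then have "?c \<longlonglongrightarrow> 0"
      by (intro filterlim_compose[OF exp_at_bot]) (simp add: filterlim_uminus_at_top)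
    from cyl.compact_operator_diagonal_op[of ?c, OF c1 this]
    have "compact_operator ?T" .
    moreover have "trace_class ?T \<longleftrightarrow> t > real N * ln (real N) / (real N - 1)"
    proof -
      have "trace_class ?T \<longleftrightarrow> summable (\<lambda>n. ?c n *
          (case n of 0 \<Rightarrow> 1 | Suc k \<Rightarrow> real CARD('a) ^ Suc k - real CARD('a) ^ k))"
      proof (rule cyl.trace_class_diagonal_op[OF c])
        fix B :: "'a l2 set" and n assume B: "orthonormal_basis B"
        show "((\<lambda>e. (norm (cyl_E n e))\<^sup>2) has_sum
            (case n of 0 \<Rightarrow> 1 | Suc k \<Rightarrow> real CARD('a) ^ Suc k - real CARD('a) ^ k)) B"
          using cyl_E_has_sum[OF B, of n] by simp
      qed
      also have "\<dots> \<longleftrightarrow> t > real N * ln (real N) / (real N - 1)"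
        unfolding N(1) by (rule summable_heat_trace[OF N(2)])
      finally show ?thesis .
    qed
    ultimately show ?thesis unfolding fc by blast
  qed
  ultimately show ?thesis by blast
qed

end
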